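(* Let $M$ be a smooth manifold of dimension $n=6$ with a conformal class $\mathbf{c}$ of pseudo-Riemannian metrics of some signature $(p,q)$. Let $\mathcal{T}$ be the standard conformal tractor bundle, $\nabla^{\mathcal{T}}$ the tractor connection with curvature $\Omega$, and let $\mathfrak{D}\nabla^{\mathcal{T}}=\delta Q_2\Omega-[\delta\Omega,\Omega]$, where $\delta$ and $Q_2$ are the operators associated to $\nabla^{\mathcal T}$. For any choice of $g\in\mathbf{c}$, with associated splitting operators $X^B,Y^B,Z^{Bc}$, $$(\mathfrak{D}\nabla^{\mathcal{T}})_c{}^D{}_E=(X_EZ^{Dd}-X^DZ_E{}^d)\,16\,\mathcal{O}^6_{cd},$$ where $\mathcal{O}^6_{ab}$ is the Fefferman-Graham obstruction tensor in dimension $6$ (normalised as in the context), and hence $$\mathcal{O}^6_{ce}=\frac{1}{32}\,(Y^EZ_{De}-Y_DZ^E{}_e)\,(\mathfrak{D}\nabla^{\mathcal{T}})_c{}^D{}_E .$$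
   Context: Abstract index notation is used: lowercase indices for $TM,T^*M$; uppercase for tractor bundles. Parentheses on indices denote symmetrisation with factor $1/2$ for two indices. **Densities.** $\mathcal{E}[w]$ denotes the bundle of conformal densities of weight $w$, i.e. sections are homogeneous functions of degree $w$ on the ray bundle $\mathcal{Q}\subset S^2T^*M$ of metrics in $\mathbf{c}$ (so $f(t^2g_x,x)=t^wf(g_x,x)$). The conformal metric $\mathbf{g}_{ab}$ is the tautological section of $S^2T^*M\otimes\mathcal{E}[2]$, with inverse $\mathbf{g}^{ab}$ of weight $-2$; indices are raised and lowered with it. A metric $g\in\mathbf{c}$ determines $\xi^g\in\Gamma(\mathcal{E}[1])$, positive, with $g=(\xi^g)^{-2}\mathbf{g}$, and the Levi-Civita connection $\nabla$ of $g$ acts on densities with $\nabla\xi^g=0$. (Fixing $g$ and trivialising densities by $\xi^g$, all formulas may be read as ordinary tensor formulas with indices raised and lowered by $g$.) **Curvature conventions.** $(\nabla_a\nabla_b-\nabla_b\nabla_a)v^c=R_{ab}{}^c{}_dv^d$; $\mathrm{Ric}_{ab}=R^c{}_{acb}$; $\mathrm{Sc}=\mathrm{Ric}_a{}^a$; $P_{ab}=\frac{1}{n-2}\big(\mathrm{Ric}_{ab}-\frac{1}{2(n-1)}g_{ab}\mathrm{Sc}\big)$; $J=P_a{}^a$; $\Delta=\nabla_a\nabla^a$. Cotton tensor: $A_{abc}=\nabla_bP_{ca}-\nabla_cP_{ba}$. Weyl tensor: $C_{abcd}=R_{abcd}+\mathbf{g}_{cb}P_{ad}-\mathbf{g}_{ca}P_{bd}+\mathbf{g}_{da}P_{bc}-\mathbf{g}_{db}P_{ac}$.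 Bach tensor (in any dimension): $B_{ab}=\nabla^cA_{acb}+P^{cd}C_{cadb}$. **Obstruction tensor.** The Fefferman-Graham (ambient) obstruction tensor in dimension 6 is the natural symmetric trace-free conformally invariant 2-tensor (of conformal weight $-4$) obstructing the formal ambient metric construction. With the normalisation used here it is given explicitly by $$16\,\mathcal{O}^6_{ab}=\Delta B_{ab}+2C_{acbd}B^{cd}-4JB_{ab}-8P^{cd}\nabla_cA_{(ab)d}-4(\nabla^cJ)A_{(ab)c}+4C_{acbd}P^c{}_eP^{ed}+2A_a{}^{cd}A_{bcd}-4A_{cad}A^d{}_b{}^c .$$ **Tractors.** A choice of $g\in\mathbf{c}$ identifies $\mathcal{T}$ (rank $n+2$) with $\mathcal{E}[1]\oplus(T^*M\otimes\mathcal{E}[1])\oplus\mathcal{E}[-1]$; under $\hat g=e^{2\Upsilon}g$, with $\Upsilon_a=\nabla_a\Upsilon$, the identifications are related by $(\hat\sigma,\hat\mu_a,\hat\rho)=(\sigma,\mu_a+\Upsilon_a\sigma,\rho-\Upsilon^c\mu_c-\frac12\Upsilon^c\Upsilon_c\sigma)$. The splitting operators $Y^B,Z^{Bc},X^B$ (weights $-1,-1,1$) are defined by $(\sigma,\mu_c,\rho)\leftrightarrow\sigma Y^B+\mu_cZ^{Bc}+\rho X^B$. The tractor metric (used to raise and lower uppercase indices) has $Y_BX^B=1$, $Z_{Ba}Z^B{}_c=\mathbf{g}_{ac}$, and all other contractions of pairs of splitting operators zero. The tractor connection $\nabla^{\mathcal{T}}$, coupled with the Levi-Civita connection of $g$ and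 denoted $\nabla$, is the connection determined by $$\nabla_aY^B=P_{ac}Z^{Bc},\quad \nabla_aZ^B{}_c=-P_{ac}X^B-\mathbf{g}_{ac}Y^B,\quad \nabla_aX^B=Z^B{}_a.$$ It is independent of the choice of $g$ and preserves the tractor metric. Its curvature $\Omega_{ab}{}^D{}_E$ is defined by $(\nabla_a\nabla_b-\nabla_b\nabla_a)V^D=\Omega_{ab}{}^D{}_EV^E$. **The operator $\mathfrak{D}$.** For $\mathrm{End}(\mathcal{T})$-valued (weighted) forms, with $\nabla$ the coupled Levi-Civita–tractor connection: $(d\eta)_{ab}=\nabla_a\eta_b-\nabla_b\eta_a$ on 1-forms; $(\delta\omega)_c=-\nabla^b\omega_{bc}$ on 2-forms; $(P\#\omega)_{ab}=P_a{}^c\omega_{cb}+P_b{}^c\omega_{ac}$; and $Q_2\omega=d\delta\omega-4P\#\omega+2J\omega$ on 2-forms. Finally $[\delta\Omega,\Omega]_c{}^D{}_E=(\delta\Omega)_b{}^D{}_G\,\Omega^b{}_c{}^G{}_E-\Omega^b{}_c{}^D{}_G\,(\delta\Omega)_b{}^G{}_E$. *)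

theory Defs
  imports "HOL-Analysis.Analysis"
begin

section \<open>Smooth manifolds, pseudo-Riemannian metrics, conformal classes\<close>

text \<open>\<open>Ck k S f\<close>: \<open>f\<close> is \<open>k\<close> times continuously differentiable on \<open>S\<close>; only meaningful for open \<open>S\<close>,
  because the partial derivatives are taken with respect to the whole space.\<close>

primrec Ck :: "nat \<Rightarrow> (real^'n) set \<Rightarrow> (real^'n \<Rightarrow> real) \<Rightarrow> bool" where
  "Ck 0 S f \<longleftrightarrow> continuous_on S f"
| "Ck (Suc k) S f \<longleftrightarrow>
     f differentiable_on S \<and> (\<forall>i. Ck k S (\<lambda>y. frechet_derivative f (at y) (axis i 1)))"

text \<open>A chart is a pair of a coordinate domain and a coordinate map, which is only used on the domain.\<close>

type_synonym ('m, 'n) chart = "'m set \<times> ('m \<Rightarrow> real^'n)"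

abbreviation chart_dom :: "('m, 'n) chart \<Rightarrow> 'm set" where
  "chart_dom \<equiv> fst"

abbreviation coord :: "('m, 'n) chart \<Rightarrow> 'm \<Rightarrow> real^'n" where
  "coord \<equiv> snd"

definition in_coords :: "('m, 'n) chart \<Rightarrow> ('m \<Rightarrow> real) \<Rightarrow> real^'n \<Rightarrow> real" where
  "in_coords \<kappa> f = (\<lambda>y. f (inv_into (chart_dom \<kappa>) (coord \<kappa>) y))"

definition smooth_in :: "('m, 'n::finite) chart \<Rightarrow> 'm set \<Rightarrow> ('m \<Rightarrow> real) \<Rightarrow> bool" where
  "smooth_in \<kappa> W f \<longleftrightarrow> (\<forall>k. Ck k (coord \<kappa> ` W) (in_coords \<kappa> f))"

text \<open>The coordinate derivative \<open>\<partial>f/\<partial>x\<^sup>a\<close>, as a function on the manifold.\<close>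

definition cderiv :: "('m, 'n::finite) chart \<Rightarrow> 'n \<Rightarrow> ('m \<Rightarrow> real) \<Rightarrow> 'm \<Rightarrow> real" where
  "cderiv \<kappa> a f x = frechet_derivative (in_coords \<kappa> f) (at (coord \<kappa> x)) (axis a 1)"

definition smooth_manifold :: "'m topology \<Rightarrow> ('m, 'n::finite) chart set \<Rightarrow> bool" where
  "smooth_manifold M \<A> \<longleftrightarrow>
     Hausdorff_space M \<and> second_countable M \<and>
     (\<Union>\<kappa>\<in>\<A>. chart_dom \<kappa>) = topspace M \<and>
     (\<forall>\<kappa>\<in>\<A>. openin M (chart_dom \<kappa>) \<and> open (coord \<kappa> ` chart_dom \<kappa>) \<and>
        homeomorphic_map (subtopology M (chart_dom \<kappa>))
          (top_of_set (coord \<kappa> ` chart_dom \<kappa>)) (coord \<kappa>)) \<and>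
     (\<forall>\<kappa>\<in>\<A>. \<forall>\<kappa>'\<in>\<A>. \<forall>i. smooth_in \<kappa> (chart_dom \<kappa> \<inter> chart_dom \<kappa>') (\<lambda>x. coord \<kappa>' x $ i))"

definition smooth_function :: "('m, 'n::finite) chart set \<Rightarrow> ('m \<Rightarrow> real) \<Rightarrow> bool" where
  "smooth_function \<A> f \<longleftrightarrow> (\<forall>\<kappa>\<in>\<A>. smooth_in \<kappa> (chart_dom \<kappa>) f)"

definition has_signature :: "nat \<Rightarrow> nat \<Rightarrow> real^'n^'n \<Rightarrow> bool" where
  "has_signature p q S \<longleftrightarrow>
     (\<exists>E. \<exists>\<epsilon>::'n \<Rightarrow> real.
        transpose E ** S ** E = (\<chi> i j. if i = j then \<epsilon> i else 0) \<and>
        (\<forall>i. \<epsilon> i = 1 \<or> \<epsilon> i = -1) \<and>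
        card {i. \<epsilon> i = 1} = p \<and> card {i. \<epsilon> i = -1} = q)"

text \<open>A metric is given by its components \<open>g \<kappa> a b\<close> in every chart \<open>\<kappa>\<close>, as functions on the chart
  domain, subject to the tensor transformation law on overlaps.\<close>

type_synonym ('m, 'n) metric = "('m, 'n) chart \<Rightarrow> 'n \<Rightarrow> 'n \<Rightarrow> 'm \<Rightarrow> real"

definition pseudo_metric ::
  "('m, 'n::finite) chart set \<Rightarrow> nat \<Rightarrow> nat \<Rightarrow> ('m, 'n) metric \<Rightarrow> bool" where
  "pseudo_metric \<A> p q g \<longleftrightarrow>
     (\<forall>\<kappa>\<in>\<A>. \<forall>a b. smooth_in \<kappa> (chart_dom \<kappa>) (g \<kappa> a b)) \<and>
     (\<forall>\<kappa>\<in>\<A>. \<forall>x\<in>chart_dom \<kappa>.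
        (\<forall>a b. g \<kappa> a b x = g \<kappa> b a x) \<and> has_signature p q (\<chi> a b. g \<kappa> a b x)) \<and>
     (\<forall>\<kappa>\<in>\<A>. \<forall>\<kappa>'\<in>\<A>. \<forall>x\<in>chart_dom \<kappa> \<inter> chart_dom \<kappa>'. \<forall>a b.
        g \<kappa>' a b x = (\<Sum>i\<in>UNIV. \<Sum>j\<in>UNIV.
          cderiv \<kappa>' a (\<lambda>y. coord \<kappa> y $ i) x * cderiv \<kappa>' b (\<lambda>y. coord \<kappa> y $ j) x * g \<kappa> i j x))"

definition conformal_class ::
  "('m, 'n::finite) chart set \<Rightarrow> nat \<Rightarrow> nat \<Rightarrow> ('m, 'n) metric set \<Rightarrow> bool" where
  "conformal_class \<A> p q c \<longleftrightarrow>
     (\<exists>g0. pseudo_metric \<A> p q g0 \<and>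
        c = {g. pseudo_metric \<A> p q g \<and>
               (\<exists>\<Upsilon>. smooth_function \<A> \<Upsilon> \<and>
                  (\<forall>\<kappa>\<in>\<A>. \<forall>x\<in>chart_dom \<kappa>. \<forall>a b. g \<kappa> a b x = exp (2 * \<Upsilon> x) * g0 \<kappa> a b x))})"

section \<open>Tensor calculus of a metric in a chart\<close>

text \<open>Index set for the splitting \<open>\<E>[1] \<oplus> T\<^sup>*M[1] \<oplus> \<E>[-1]\<close> of the tractor bundle: a tractor
  \<open>V = \<sigma>Y + \<mu>\<^sub>cZ\<^sup>c + \<rho>X\<close> has components \<open>V tY = \<sigma>\<close>, \<open>V (tZ c) = \<mu>\<^sub>c\<close>, \<open>V tX = \<rho>\<close>.\<close>

datatype 'n tidx = tY | tZ 'n | tX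

lemma UNIV_tidx: "(UNIV :: 'n tidx set) = {tY, tX} \<union> range tZ"
  by (auto intro: tidx.exhaust)

instance tidx :: (finite) finite
  by standard (simp add: UNIV_tidx)

lemma sum_tidx:
  fixes f :: "'n::finite tidx \<Rightarrow> real"
  shows "(\<Sum>D\<in>UNIV. f D) = f tY + (\<Sum>c\<in>UNIV. f (tZ c)) + f tX"
proof -
  have "(\<Sum>D\<in>UNIV. f D) = (\<Sum>D\<in>{tY, tX}. f D) + (\<Sum>D\<in>range tZ. f D)"
    unfolding UNIV_tidx by (rule sum.union_disjoint) auto
  also have "(\<Sum>D\<in>range tZ. f D) = (\<Sum>c\<in>UNIV. f (tZ c))"
    by (subst sum.reindex) (auto simp: inj_on_def)
  finally show ?thesis by simp
qed

text \<open>\<open>Y_up B\<close>, \<open>Z_up B c\<close>, \<open>X_up B\<close> are \<open>Y\<^sup>B\<close>, \<open>Z\<^sup>B\<^sup>c\<close>, \<open>X\<^sup>B\<close>.\<close>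

definition Y_up :: "'n tidx \<Rightarrow> real" where "Y_up B = of_bool (B = tY)"

definition Z_up :: "'n tidx \<Rightarrow> 'n \<Rightarrow> real" where "Z_up B c = of_bool (B = tZ c)"

definition X_up :: "'n tidx \<Rightarrow> real" where "X_up B = of_bool (B = tX)"

text \<open>In the following locale \<open>g\<close> stands for the components in the chart \<open>\<kappa>\<close> of the chosen metric of the
  conformal class. All densities are trivialised by the scale \<open>\<xi>\<^sup>g\<close>, so that weighted tensors become
  ordinary ones and \<open>\<^bold>g\<close> becomes \<open>g\<close>. A tensor is given by its components, which are functions on
  the chart domain; \<open>T a b x\<close> is the component \<open>T\<^sub>a\<^sub>b\<close> at \<open>x\<close>. The index of a covariant derivative
  comes first: \<open>nab2 T c a b\<close> is \<open>\<nabla>\<^sub>c T\<^sub>a\<^sub>b\<close>.\<close>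

locale chart_metric =
  fixes \<kappa> :: "('m, 'n::finite) chart"
    and g :: "'n \<Rightarrow> 'n \<Rightarrow> 'm \<Rightarrow> real"
begin

abbreviation pd :: "'n \<Rightarrow> ('m \<Rightarrow> real) \<Rightarrow> 'm \<Rightarrow> real" where
  "pd \<equiv> cderiv \<kappa>"

definition gi :: "'n \<Rightarrow> 'n \<Rightarrow> 'm \<Rightarrow> real" where
  "gi a b x = matrix_inv (\<chi> i j. g i j x) $ a $ b"

text \<open>\<open>chr c a b\<close> is the Christoffel symbol \<open>\<Gamma>\<^sup>c\<^sub>a\<^sub>b\<close> of the Levi-Civita connection.\<close>

definition chr :: "'n \<Rightarrow> 'n \<Rightarrow> 'n \<Rightarrow> 'm \<Rightarrow> real" where
  "chr c a b x =
     1/2 * (\<Sum>d\<in>UNIV. gi c d x * (pd a (g b d) x + pd b (g a d) x - pd d (g a b) x))"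

text \<open>Covariant derivatives of \<open>v\<^sup>c\<close> and of \<open>T\<^sub>b\<^sup>c\<close>.\<close>

definition nab_vec :: "('n \<Rightarrow> 'm \<Rightarrow> real) \<Rightarrow> 'n \<Rightarrow> 'n \<Rightarrow> 'm \<Rightarrow> real" where
  "nab_vec v a c x = pd a (v c) x + (\<Sum>d\<in>UNIV. chr c a d x * v d x)"

definition nab_mix :: "('n \<Rightarrow> 'n \<Rightarrow> 'm \<Rightarrow> real) \<Rightarrow> 'n \<Rightarrow> 'n \<Rightarrow> 'n \<Rightarrow> 'm \<Rightarrow> real" where
  "nab_mix T a b c x = pd a (T b c) x
     - (\<Sum>d\<in>UNIV. chr d a b x * T d c x) + (\<Sum>d\<in>UNIV. chr c a d x * T b d x)"

definition nab1 :: "('n \<Rightarrow> 'm \<Rightarrow> real) \<Rightarrow> 'n \<Rightarrow> 'n \<Rightarrow> 'm \<Rightarrow> real" where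
  "nab1 T a b x = pd a (T b) x - (\<Sum>e\<in>UNIV. chr e a b x * T e x)"

definition nab2 :: "('n \<Rightarrow> 'n \<Rightarrow> 'm \<Rightarrow> real) \<Rightarrow> 'n \<Rightarrow> 'n \<Rightarrow> 'n \<Rightarrow> 'm \<Rightarrow> real" where
  "nab2 T a b c x = pd a (T b c) x
     - (\<Sum>e\<in>UNIV. chr e a b x * T e c x) - (\<Sum>e\<in>UNIV. chr e a c x * T b e x)"

definition nab3 ::
  "('n \<Rightarrow> 'n \<Rightarrow> 'n \<Rightarrow> 'm \<Rightarrow> real) \<Rightarrow> 'n \<Rightarrow> 'n \<Rightarrow> 'n \<Rightarrow> 'n \<Rightarrow> 'm \<Rightarrow> real" where
  "nab3 T a b c d x = pd a (T b c d) x
     - (\<Sum>e\<in>UNIV. chr e a b x * T e c d x) - (\<Sum>e\<in>UNIV. chr e a c x * T b e d x)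
     - (\<Sum>e\<in>UNIV. chr e a d x * T b c e x)"

text \<open>\<open>riem a b c d\<close> is \<open>R\<^sub>a\<^sub>b\<^sup>c\<^sub>d\<close>, where \<open>(\<nabla>\<^sub>a\<nabla>\<^sub>b - \<nabla>\<^sub>b\<nabla>\<^sub>a)v\<^sup>c = R\<^sub>a\<^sub>b\<^sup>c\<^sub>d v\<^sup>d\<close>. The left-hand side is tensorial in
  \<open>v\<close>, so the components are read off by taking for \<open>v\<close> the coordinate field \<open>\<partial>\<^sub>d\<close>.\<close>

definition riem :: "'n \<Rightarrow> 'n \<Rightarrow> 'n \<Rightarrow> 'n \<Rightarrow> 'm \<Rightarrow> real" where
  "riem a b c d x =
     (let v = (\<lambda>e y. of_bool (e = d)) in nab_mix (nab_vec v) a b c x - nab_mix (nab_vec v) b a c x)"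

definition riem_low :: "'n \<Rightarrow> 'n \<Rightarrow> 'n \<Rightarrow> 'n \<Rightarrow> 'm \<Rightarrow> real" where
  "riem_low a b c d x = (\<Sum>e\<in>UNIV. g c e x * riem a b e d x)"

definition ric :: "'n \<Rightarrow> 'n \<Rightarrow> 'm \<Rightarrow> real" where
  "ric a b x = (\<Sum>c\<in>UNIV. riem c a c b x)"

definition scal :: "'m \<Rightarrow> real" where
  "scal x = (\<Sum>a\<in>UNIV. \<Sum>b\<in>UNIV. gi a b x * ric a b x)"

definition P :: "'n \<Rightarrow> 'n \<Rightarrow> 'm \<Rightarrow> real" where
  "P a b x = 1 / (real CARD('n) - 2) *
     (ric a b x - 1 / (2 * (real CARD('n) - 1)) * g a b x * scal x)"

text \<open>\<open>P_mix a c\<close> is \<open>P\<^sub>a\<^sup>c\<close>, which by symmetry is also \<open>P\<^sup>c\<^sub>a\<close>; \<open>P_up a b\<close> is \<open>P\<^sup>a\<^sup>b\<close>.\<close>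

definition P_mix :: "'n \<Rightarrow> 'n \<Rightarrow> 'm \<Rightarrow> real" where
  "P_mix a c x = (\<Sum>d\<in>UNIV. gi c d x * P a d x)"

definition P_up :: "'n \<Rightarrow> 'n \<Rightarrow> 'm \<Rightarrow> real" where
  "P_up a b x = (\<Sum>c\<in>UNIV. \<Sum>d\<in>UNIV. gi a c x * gi b d x * P c d x)"

definition J :: "'m \<Rightarrow> real" where
  "J x = (\<Sum>a\<in>UNIV. \<Sum>b\<in>UNIV. gi a b x * P a b x)"

definition cotton :: "'n \<Rightarrow> 'n \<Rightarrow> 'n \<Rightarrow> 'm \<Rightarrow> real" where
  "cotton a b c x = nab2 P b c a x - nab2 P c b a x"

definition weyl :: "'n \<Rightarrow> 'n \<Rightarrow> 'n \<Rightarrow> 'n \<Rightarrow> 'm \<Rightarrow> real" where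
  "weyl a b c d x = riem_low a b c d x
     + g c b x * P a d x - g c a x * P b d x + g d a x * P b c x - g d b x * P a c x"

definition bach :: "'n \<Rightarrow> 'n \<Rightarrow> 'm \<Rightarrow> real" where
  "bach a b x =
     (\<Sum>c\<in>UNIV. \<Sum>d\<in>UNIV. gi c d x * nab3 cotton d a c b x)
     + (\<Sum>c\<in>UNIV. \<Sum>d\<in>UNIV. P_up c d x * weyl c a d b x)"

definition bach_up :: "'n \<Rightarrow> 'n \<Rightarrow> 'm \<Rightarrow> real" where
  "bach_up a b x = (\<Sum>c\<in>UNIV. \<Sum>d\<in>UNIV. gi a c x * gi b d x * bach c d x)"

definition lap_bach :: "'n \<Rightarrow> 'n \<Rightarrow> 'm \<Rightarrow> real" where
  "lap_bach a b x = (\<Sum>c\<in>UNIV. \<Sum>d\<in>UNIV. gi c d x * nab3 (nab2 bach) c d a b x)"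

text \<open>The obstruction tensor of dimension 6. The summands are, in this order,
  \<open>\<Delta>B\<^sub>a\<^sub>b\<close>, \<open>2C\<^sub>a\<^sub>c\<^sub>b\<^sub>dB\<^sup>c\<^sup>d\<close>, \<open>-4JB\<^sub>a\<^sub>b\<close>, \<open>-8P\<^sup>c\<^sup>d\<nabla>\<^sub>cA\<^sub>(\<^sub>a\<^sub>b\<^sub>)\<^sub>d\<close>, \<open>-4(\<nabla>\<^sup>cJ)A\<^sub>(\<^sub>a\<^sub>b\<^sub>)\<^sub>c\<close>, \<open>4C\<^sub>a\<^sub>c\<^sub>b\<^sub>dP\<^sup>c\<^sub>eP\<^sup>e\<^sup>d\<close>,
  \<open>2A\<^sub>a\<^sup>c\<^sup>dA\<^sub>b\<^sub>c\<^sub>d\<close>, \<open>-4A\<^sub>c\<^sub>a\<^sub>dA\<^sup>d\<^sub>b\<^sup>c\<close>.\<close>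

definition obstruction6 :: "'n \<Rightarrow> 'n \<Rightarrow> 'm \<Rightarrow> real" where
  "obstruction6 a b x = 1/16 * (
       lap_bach a b x
     + 2 * (\<Sum>c\<in>UNIV. \<Sum>d\<in>UNIV. weyl a c b d x * bach_up c d x)
     - 4 * J x * bach a b x
     - 8 * (\<Sum>c\<in>UNIV. \<Sum>d\<in>UNIV. P_up c d x * (1/2 * (nab3 cotton c a b d x + nab3 cotton c b a d x)))
     - 4 * (\<Sum>c\<in>UNIV. \<Sum>d\<in>UNIV. gi c d x * pd d J x * (1/2 * (cotton a b c x + cotton b a c x)))
     + 4 * (\<Sum>c\<in>UNIV. \<Sum>d\<in>UNIV. \<Sum>e\<in>UNIV. weyl a c b d x * P_mix e c x * P_up e d x)
     + 2 * (\<Sum>c\<in>UNIV. \<Sum>d\<in>UNIV. \<Sum>c'\<in>UNIV. \<Sum>d'\<in>UNIV.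
              gi c c' x * gi d d' x * cotton a c' d' x * cotton b c d x)
     - 4 * (\<Sum>c\<in>UNIV. \<Sum>d\<in>UNIV. \<Sum>c'\<in>UNIV. \<Sum>d'\<in>UNIV.
              gi c c' x * gi d d' x * cotton c a d x * cotton d' b c' x))"

section \<open>Tractors in the splitting determined by the metric\<close>

text \<open>\<open>Z_mix B c\<close> is \<open>Z\<^sup>B\<^sub>c\<close>.\<close>

definition Z_mix :: "'n tidx \<Rightarrow> 'n \<Rightarrow> 'm \<Rightarrow> real" where
  "Z_mix B c x = (\<Sum>d\<in>UNIV. g c d x * Z_up B d)"

text \<open>The tractor metric \<open>h\<^sub>D\<^sub>E\<close>; the condition \<open>Z\<^sub>B\<^sub>aZ\<^sup>B\<^sub>c = g\<^sub>a\<^sub>c\<close> reads \<open>h(Z\<^sup>c, Z\<^sup>d) = g\<^sup>c\<^sup>d\<close> for the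
  operators with raised tensor index.\<close>

fun tmetric :: "'n tidx \<Rightarrow> 'n tidx \<Rightarrow> 'm \<Rightarrow> real" where
  "tmetric tY tX x = 1"
| "tmetric tX tY x = 1"
| "tmetric (tZ c) (tZ d) x = gi c d x"
| "tmetric _ _ x = 0"

text \<open>\<open>Y_low B\<close>, \<open>X_low B\<close>, \<open>Z_lowup B d\<close>, \<open>Z_low B c\<close> are \<open>Y\<^sub>B\<close>, \<open>X\<^sub>B\<close>, \<open>Z\<^sub>B\<^sup>d\<close>, \<open>Z\<^sub>B\<^sub>c\<close>.\<close>

definition Y_low :: "'n tidx \<Rightarrow> 'm \<Rightarrow> real" where
  "Y_low B x = (\<Sum>F\<in>UNIV. tmetric B F x * Y_up F)"

definition X_low :: "'n tidx \<Rightarrow> 'm \<Rightarrow> real" where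
  "X_low B x = (\<Sum>F\<in>UNIV. tmetric B F x * X_up F)"

definition Z_lowup :: "'n tidx \<Rightarrow> 'n \<Rightarrow> 'm \<Rightarrow> real" where
  "Z_lowup B d x = (\<Sum>F\<in>UNIV. tmetric B F x * Z_up F d)"

definition Z_low :: "'n tidx \<Rightarrow> 'n \<Rightarrow> 'm \<Rightarrow> real" where
  "Z_low B c x = (\<Sum>F\<in>UNIV. tmetric B F x * Z_mix F c x)"

text \<open>The tractor connection is given by its values on the splitting operators,
  \<open>\<nabla>\<^sub>aY\<^sup>B = P\<^sub>a\<^sub>cZ\<^sup>B\<^sup>c\<close>, \<open>\<nabla>\<^sub>aZ\<^sup>B\<^sup>c = -P\<^sub>a\<^sup>cX\<^sup>B - \<delta>\<^sub>a\<^sup>cY\<^sup>B\<close> and \<open>\<nabla>\<^sub>aX\<^sup>B = Z\<^sup>B\<^sub>a\<close>, and extended by the Leibniz rule.\<close>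

definition nab_Y :: "'n \<Rightarrow> 'n tidx \<Rightarrow> 'm \<Rightarrow> real" where
  "nab_Y a B x = (\<Sum>c\<in>UNIV. P a c x * Z_up B c)"

definition nab_Z :: "'n \<Rightarrow> 'n \<Rightarrow> 'n tidx \<Rightarrow> 'm \<Rightarrow> real" where
  "nab_Z a c B x = - P_mix a c x * X_up B - of_bool (a = c) * Y_up B"

definition nab_X :: "'n \<Rightarrow> 'n tidx \<Rightarrow> 'm \<Rightarrow> real" where
  "nab_X a B x = Z_mix B a x"

definition tnab :: "('n tidx \<Rightarrow> 'm \<Rightarrow> real) \<Rightarrow> 'n \<Rightarrow> 'n tidx \<Rightarrow> 'm \<Rightarrow> real" where
  "tnab V a B x =
     (let \<sigma> = V tY; \<mu> = (\<lambda>c. V (tZ c)); \<rho> = V tX in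
        pd a \<sigma> x * Y_up B + \<sigma> x * nab_Y a B x
      + (\<Sum>c\<in>UNIV. nab1 \<mu> a c x * Z_up B c + \<mu> c x * nab_Z a c B x)
      + pd a \<rho> x * X_up B + \<rho> x * nab_X a B x)"

text \<open>The connection coefficients: \<open>tnab V a D = \<partial>\<^sub>aV\<^sup>D + tconn a D E V\<^sup>E\<close>, so \<open>tconn a D E\<close> is the
  component \<open>D\<close> of the derivative of the frame section numbered \<open>E\<close>.\<close>

definition tconn :: "'n \<Rightarrow> 'n tidx \<Rightarrow> 'n tidx \<Rightarrow> 'm \<Rightarrow> real" where
  "tconn a D E x = tnab (\<lambda>F y. of_bool (F = E)) a D x"

text \<open>The coupled connection on tractor valued 1-forms \<open>W\<^sub>b\<^sup>D\<close>, on \<open>End(\<T>)\<close>-valued 1-forms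
  \<open>\<eta>\<^sub>b\<^sup>D\<^sub>E\<close> and on \<open>End(\<T>)\<close>-valued 2-forms \<open>\<omega>\<^sub>b\<^sub>c\<^sup>D\<^sub>E\<close>.\<close>

definition tnab1 :: "('n \<Rightarrow> 'n tidx \<Rightarrow> 'm \<Rightarrow> real) \<Rightarrow> 'n \<Rightarrow> 'n \<Rightarrow> 'n tidx \<Rightarrow> 'm \<Rightarrow> real" where
  "tnab1 W a b D x = pd a (W b D) x - (\<Sum>e\<in>UNIV. chr e a b x * W e D x)
     + (\<Sum>F\<in>UNIV. tconn a D F x * W b F x)"

definition enab1 ::
  "('n \<Rightarrow> 'n tidx \<Rightarrow> 'n tidx \<Rightarrow> 'm \<Rightarrow> real) \<Rightarrow> 'n \<Rightarrow> 'n \<Rightarrow> 'n tidx \<Rightarrow> 'n tidx \<Rightarrow> 'm \<Rightarrow> real" where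
  "enab1 \<eta> a b D E x = pd a (\<eta> b D E) x - (\<Sum>e\<in>UNIV. chr e a b x * \<eta> e D E x)
     + (\<Sum>F\<in>UNIV. tconn a D F x * \<eta> b F E x) - (\<Sum>F\<in>UNIV. \<eta> b D F x * tconn a F E x)"

definition enab2 ::
  "('n \<Rightarrow> 'n \<Rightarrow> 'n tidx \<Rightarrow> 'n tidx \<Rightarrow> 'm \<Rightarrow> real)
    \<Rightarrow> 'n \<Rightarrow> 'n \<Rightarrow> 'n \<Rightarrow> 'n tidx \<Rightarrow> 'n tidx \<Rightarrow> 'm \<Rightarrow> real" where
  "enab2 \<omega> a b c D E x = pd a (\<omega> b c D E) x
     - (\<Sum>e\<in>UNIV. chr e a b x * \<omega> e c D E x) - (\<Sum>e\<in>UNIV. chr e a c x * \<omega> b e D E x)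
     + (\<Sum>F\<in>UNIV. tconn a D F x * \<omega> b c F E x) - (\<Sum>F\<in>UNIV. \<omega> b c D F x * tconn a F E x)"

definition ext_d ::
  "('n \<Rightarrow> 'n tidx \<Rightarrow> 'n tidx \<Rightarrow> 'm \<Rightarrow> real) \<Rightarrow> 'n \<Rightarrow> 'n \<Rightarrow> 'n tidx \<Rightarrow> 'n tidx \<Rightarrow> 'm \<Rightarrow> real" where
  "ext_d \<eta> a b D E x = enab1 \<eta> a b D E x - enab1 \<eta> b a D E x"

definition delta ::
  "('n \<Rightarrow> 'n \<Rightarrow> 'n tidx \<Rightarrow> 'n tidx \<Rightarrow> 'm \<Rightarrow> real) \<Rightarrow> 'n \<Rightarrow> 'n tidx \<Rightarrow> 'n tidx \<Rightarrow> 'm \<Rightarrow> real" where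
  "delta \<omega> c D E x = - (\<Sum>a\<in>UNIV. \<Sum>b\<in>UNIV. gi a b x * enab2 \<omega> a b c D E x)"

definition P_hash ::
  "('n \<Rightarrow> 'n \<Rightarrow> 'n tidx \<Rightarrow> 'n tidx \<Rightarrow> 'm \<Rightarrow> real)
    \<Rightarrow> 'n \<Rightarrow> 'n \<Rightarrow> 'n tidx \<Rightarrow> 'n tidx \<Rightarrow> 'm \<Rightarrow> real" where
  "P_hash \<omega> a b D E x =
     (\<Sum>c\<in>UNIV. P_mix a c x * \<omega> c b D E x) + (\<Sum>c\<in>UNIV. P_mix b c x * \<omega> a c D E x)"

definition Q2 ::
  "('n \<Rightarrow> 'n \<Rightarrow> 'n tidx \<Rightarrow> 'n tidx \<Rightarrow> 'm \<Rightarrow> real)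
    \<Rightarrow> 'n \<Rightarrow> 'n \<Rightarrow> 'n tidx \<Rightarrow> 'n tidx \<Rightarrow> 'm \<Rightarrow> real" where
  "Q2 \<omega> a b D E x =
     ext_d (delta \<omega>) a b D E x - 4 * P_hash \<omega> a b D E x + 2 * J x * \<omega> a b D E x"

definition form_bracket ::
  "('n \<Rightarrow> 'n tidx \<Rightarrow> 'n tidx \<Rightarrow> 'm \<Rightarrow> real) \<Rightarrow> ('n \<Rightarrow> 'n \<Rightarrow> 'n tidx \<Rightarrow> 'n tidx \<Rightarrow> 'm \<Rightarrow> real)
    \<Rightarrow> 'n \<Rightarrow> 'n tidx \<Rightarrow> 'n tidx \<Rightarrow> 'm \<Rightarrow> real" where
  "form_bracket \<eta> \<omega> c D E x =
     (\<Sum>a\<in>UNIV. \<Sum>b\<in>UNIV. gi a b x *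
        (\<Sum>G\<in>UNIV. \<eta> b D G x * \<omega> a c G E x - \<omega> a c D G x * \<eta> b G E x))"

text \<open>\<open>\<DD>\<nabla>\<close> as a function of the curvature \<open>\<Omega>\<close> of the tractor connection.\<close>

definition frakD ::
  "('n \<Rightarrow> 'n \<Rightarrow> 'n tidx \<Rightarrow> 'n tidx \<Rightarrow> 'm \<Rightarrow> real) \<Rightarrow> 'n \<Rightarrow> 'n tidx \<Rightarrow> 'n tidx \<Rightarrow> 'm \<Rightarrow> real" where
  "frakD \<Omega> c D E x = delta (Q2 \<Omega>) c D E x - form_bracket (delta \<Omega>) \<Omega> c D E x"

end

section \<open>The tractor bundle and its curvature\<close>

text \<open>A section of the tractor bundle over a chart domain is a family of triples \<open>(\<sigma>, \<mu>\<^sub>a, \<rho>)\<close>, one for each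
  metric of the conformal class, related by the tractor transformation law. The factors \<open>exp \<Upsilon>\<close>
  and \<open>exp (- \<Upsilon>)\<close>, which the weighted form of that law does not show, come from the trivialisation of densities by
  \<open>\<xi>\<^sup>g\<close>, which changes to \<open>exp (-\<Upsilon>) \<xi>\<^sup>g\<close> when \<open>g\<close> changes to \<open>exp (2\<Upsilon>) g\<close>.\<close>

definition tractor_section ::
  "('m, 'n::finite) metric set \<Rightarrow> ('m, 'n) chart
    \<Rightarrow> (('m, 'n) metric \<Rightarrow> 'n tidx \<Rightarrow> 'm \<Rightarrow> real) \<Rightarrow> bool" where
  "tractor_section c \<kappa> V \<longleftrightarrow>
     (\<forall>g\<in>c. \<forall>B. smooth_in \<kappa> (chart_dom \<kappa>) (V g B)) \<and>
     (\<forall>g\<in>c. \<forall>g'\<in>c. \<forall>\<Upsilon>.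
        smooth_in \<kappa> (chart_dom \<kappa>) \<Upsilon> \<and>
        (\<forall>x\<in>chart_dom \<kappa>. \<forall>a b. g' \<kappa> a b x = exp (2 * \<Upsilon> x) * g \<kappa> a b x) \<longrightarrow>
        (\<forall>x\<in>chart_dom \<kappa>.
           (let gi = (\<lambda>a b. chart_metric.gi (g \<kappa>) a b x);
                \<Upsilon>d = (\<lambda>a. cderiv \<kappa> a \<Upsilon> x);
                \<sigma> = V g tY x; \<mu> = (\<lambda>a. V g (tZ a) x); \<rho> = V g tX x
            in V g' tY x = exp (\<Upsilon> x) * \<sigma> \<and>
               (\<forall>a. V g' (tZ a) x = exp (\<Upsilon> x) * (\<mu> a + \<Upsilon>d a * \<sigma>)) \<and>
               V g' tX x = exp (- \<Upsilon> x) *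
                 (\<rho> - (\<Sum>a\<in>UNIV. \<Sum>b\<in>UNIV. gi a b * \<Upsilon>d a * \<mu> b)
                    - 1/2 * (\<Sum>a\<in>UNIV. \<Sum>b\<in>UNIV. gi a b * \<Upsilon>d a * \<Upsilon>d b) * \<sigma>))))"

text \<open>\<open>\<Omega> a b D E\<close> are the components \<open>\<Omega>\<^sub>a\<^sub>b\<^sup>D\<^sub>E\<close>, in the chart \<open>\<kappa>\<close> and the splitting given by \<open>g\<close>, of the
  curvature of the tractor connection.\<close>

definition tractor_curvature ::
  "('m, 'n::finite) metric set \<Rightarrow> ('m, 'n) chart \<Rightarrow> ('m, 'n) metric
    \<Rightarrow> ('n \<Rightarrow> 'n \<Rightarrow> 'n tidx \<Rightarrow> 'n tidx \<Rightarrow> 'm \<Rightarrow> real) \<Rightarrow> bool" where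
  "tractor_curvature c \<kappa> g \<Omega> \<longleftrightarrow>
     (\<forall>V. tractor_section c \<kappa> V \<longrightarrow>
        (\<forall>x\<in>chart_dom \<kappa>. \<forall>a b D.
           (let W = chart_metric.tnab1 \<kappa> (g \<kappa>) (chart_metric.tnab \<kappa> (g \<kappa>) (V g))
            in W a b D x - W b a D x) = (\<Sum>E\<in>UNIV. \<Omega> a b D E x * V g E x)))"

end

theory Submission
  imports Defs
begin

text \<open>In the splitting given by \<open>g\<close>, an endomorphism of \<open>\<T>\<close> that is skew for the tractor metric is a quadruple
  of slots \<open>(w, m, f, r)\<close>, and \<open>\<Omega>\<^sub>a\<^sub>b\<close> has the slots \<open>(0, C\<^sub>a\<^sub>b\<^sub>c\<^sub>d, 0, A\<^sub>c\<^sub>a\<^sub>b)\<close>. The trace of the \<open>m\<close> slot of the Bianchi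
  identity \<open>d\<Omega> = 0\<close> is \<open>\<nabla>\<^sup>aC\<^sub>a\<^sub>b\<^sub>c\<^sub>d = 3A\<^sub>b\<^sub>c\<^sub>d\<close>, so that \<open>\<eta> = \<delta>\<Omega>\<close> has the slots \<open>(0, -2A\<^sub>b\<^sub>c\<^sub>d, 0, -B\<^sub>c\<^sub>b)\<close>; the slots of \<open>\<delta>\<eta> = 0\<close>
  are the symmetry of the Bach tensor and a formula for its divergence. Commuting derivatives gives
  \<open>\<DD>\<nabla> = -\<Delta>\<eta>\<^sub>c + 3J\<eta>\<^sub>c + 2(\<nabla>\<^sup>aJ)\<Omega>\<^sub>a\<^sub>c + 4P\<^sup>a\<^sup>e\<nabla>\<^sub>a\<Omega>\<^sub>e\<^sub>c + 2A\<^sub>c\<^sup>a\<^sup>e\<Omega>\<^sub>a\<^sub>e - 2[\<eta>\<^sub>a, \<Omega>\<^sup>a\<^sub>c]\<close>.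
  The \<open>r\<close> slot of this expression is \<open>16\<O>\<close> term by term; the \<open>w\<close> and \<open>f\<close> slots vanish by the facts on the
  Bach tensor, and the \<open>m\<close> slot by the formula for \<open>\<Delta>A\<close> that is the \<open>r\<close> slot of the Weitzenboeck formula
  for \<open>\<Delta>\<Omega>\<close>.\<close>

section \<open>Differentiable functions of several variables\<close>

text \<open>Why dimension 6: in dimension n the Weyl tensor has divergence (n-3)A and \<eta> has the
  \<open>m\<close> slot -(n-4)A, so the \<open>w\<close> slot of -\<Delta>\<eta> is -2(n-4) times a
  divergence of A plus (n-2)B. The term 4P\<nabla>\<Omega> adds -4 times the contraction of P with
  C, and the definition of B makes the sum vanish because 2(n-4) = n-2 = 4. The \<open>m\<close>
  slot is the obstacle. It contains \<Delta>A, which no definition expresses through simpler terms;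
  but A is a slot of \<Omega>, so d\<Omega> = 0 determines \<Delta>A up to derivatives of \<eta> and
  curvature terms. A second difficulty is that \<Omega> is known only by its action on sections
  given compatibly for all metrics of the class. Frame sections have to be built in every splitting
  before \<Omega> can be compared with the curvature of the connection coefficients, and the
  comparison must hold on the whole chart domain because \<DD> differentiates \<Omega>.\<close>

definition partial :: "'n::finite \<Rightarrow> (real^'n \<Rightarrow> real) \<Rightarrow> real^'n \<Rightarrow> real" where
  "partial i f y = frechet_derivative f (at y) (axis i 1)"

text \<open>No differentiability is assumed: \<open>frechet_derivative\<close> is a choice among the
  derivatives at \<open>y\<close>, and both functions have the same derivatives there.\<close>

lemma frechet_derivative_cong_open:
  assumes "open S" "y \<in> S" "\<And>z. z \<in> S \<Longrightarrow> f z = h z"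
  shows "frechet_derivative f (at y) = frechet_derivative h (at y)"
proof -
  have "(f has_derivative f') (at y) \<longleftrightarrow> (h has_derivative f') (at y)" for f'
    using has_derivative_transform_within_open[OF _ assms(1,2)] assms(3) by metis
  then show ?thesis unfolding frechet_derivative_def by simp
qed

lemma partial_cong:
  assumes "open S" "y \<in> S" "\<And>z. z \<in> S \<Longrightarrow> f z = h z"
  shows "partial i f y = partial i h y"
  unfolding partial_def using frechet_derivative_cong_open[OF assms] by simp

lemma partial_eqI: "(f has_derivative f') (at y) \<Longrightarrow> partial i f y = f' (axis i 1)"
  unfolding partial_def using frechet_derivative_at by metis

lemma Ck_Suc: "Ck (Suc k) S f \<longleftrightarrow> f differentiable_on S \<and> (\<forall>i. Ck k S (partial i f))"
  unfolding Ck.simps partial_def by (simp add: partial_def[abs_def])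

text \<open>The derivatives in \<open>Ck\<close> are taken in the whole space; openness of
  \<open>S\<close> makes them depend on the values in \<open>S\<close> alone. This matters because
  \<open>in_coords\<close> has arbitrary values outside the image of the chart.\<close>

lemma Ck_cong:
  assumes "open S" "\<And>z. z \<in> S \<Longrightarrow> f z = h z"
  shows "Ck k S f \<longleftrightarrow> Ck k S h"
  using assms(2)
proof (induction k arbitrary: f h)
  case 0
  then show ?case by (simp cong: continuous_on_cong)
next
  case (Suc k)
  have "Ck k S (partial i f) \<longleftrightarrow> Ck k S (partial i h)" for i
    by (rule Suc.IH) (use partial_cong[OF assms(1)] Suc.prems in blast)
  moreover have "f differentiable_on S \<longleftrightarrow> h differentiable_on S"
    using Suc.prems has_derivative_transform[of _ S h f] has_derivative_transform[of _ S f h]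
    unfolding differentiable_on_def differentiable_def by metis
  ultimately show ?case by (simp only: Ck_Suc)
qed

lemma Ck_SucD: "Ck (Suc k) S f \<Longrightarrow> Ck k S f"
proof (induction k arbitrary: f)
  case 0
  then show ?case by (simp add: differentiable_imp_continuous_on)
next
  case (Suc k)
  then have "f differentiable_on S" "\<And>i. Ck (Suc k) S (partial i f)"
    by (simp_all only: Ck_Suc[of "Suc k"])
  with Suc.IH show ?case unfolding Ck_Suc[of k] by blast
qed

lemma Ck_Suc_partial: "Ck (Suc k) S f \<Longrightarrow> Ck k S (partial i f)"
  by (simp only: Ck_Suc)

lemma Ck_Suc_has_derivative:
  assumes "open S" "Ck (Suc k) S f" "y \<in> S"
  shows "(f has_derivative frechet_derivative f (at y)) (at y)"
proof -
  have "f differentiable (at y)"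
    using assms by (simp add: differentiable_on_eq_differentiable_at)
  then show ?thesis by (simp add: frechet_derivative_works)
qed

lemma partial_add:
  assumes "open S" "Ck (Suc k) S f" "Ck (Suc l) S h" "y \<in> S"
  shows "partial i (\<lambda>z. f z + h z) y = partial i f y + partial i h y"
  using partial_eqI[OF has_derivative_add[OF Ck_Suc_has_derivative[OF assms(1,2,4)]
        Ck_Suc_has_derivative[OF assms(1,3,4)]]]
  by (simp add: partial_def)

lemma partial_mult:
  assumes "open S" "Ck (Suc k) S f" "Ck (Suc l) S h" "y \<in> S"
  shows "partial i (\<lambda>z. f z * h z) y = f y * partial i h y + partial i f y * h y"
  using partial_eqI[OF has_derivative_mult[OF Ck_Suc_has_derivative[OF assms(1,2,4)]
        Ck_Suc_has_derivative[OF assms(1,3,4)]]]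
  by (simp add: partial_def)

lemma partial_inverse:
  assumes "open S" "Ck (Suc k) S f" "y \<in> S" "f y \<noteq> 0"
  shows "partial i (\<lambda>z. inverse (f z)) y = - (partial i f y * (inverse (f y) * inverse (f y)))"
  using partial_eqI[OF Deriv.has_derivative_inverse[OF assms(4) Ck_Suc_has_derivative[OF assms(1,2,3)]]]
  by (simp add: partial_def mult_ac)

lemma partial_exp:
  assumes "open S" "Ck (Suc k) S f" "y \<in> S"
  shows "partial i (\<lambda>z. exp (f z)) y = exp (f y) * partial i f y"
  using partial_eqI[OF has_derivative_exp[OF Ck_Suc_has_derivative[OF assms]]]
  by (simp add: partial_def mult_ac)

lemma partial_const: "partial i (\<lambda>z. c) y = 0"
  by (simp add: partial_def)

lemma Ck_const: "Ck k S (\<lambda>z. c)"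
  by (induction k arbitrary: c) (auto simp: Ck_Suc partial_const[abs_def] simp del: Ck.simps(2))

lemma Ck_add:
  assumes "open S" "Ck k S f" "Ck k S h" shows "Ck k S (\<lambda>z. f z + h z)"
  using assms(2,3)
proof (induction k arbitrary: f h)
  case (Suc k)
  have "Ck k S (\<lambda>z. partial i f z + partial i h z)" for i
    using Suc.prems by (intro Suc.IH) (auto simp: Ck_Suc simp del: Ck.simps)
  then have "Ck k S (partial i (\<lambda>z. f z + h z))" for i
    by (subst Ck_cong[OF assms(1) partial_add[OF assms(1) Suc.prems]])
  then show ?case using Suc.prems by (auto simp: Ck_Suc simp del: Ck.simps)
qed (auto intro: continuous_intros)

lemma Ck_mult:
  assumes "open S" "Ck k S f" "Ck k S h" shows "Ck k S (\<lambda>z. f z * h z)"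
  using assms(2,3)
proof (induction k arbitrary: f h)
  case (Suc k)
  have "Ck k S (\<lambda>z. f z * partial i h z + partial i f z * h z)" for i
    using Suc.prems[THEN Ck_SucD] Suc.prems[THEN Ck_Suc_partial]
    by (intro Ck_add assms(1) Suc.IH)
  then have "Ck k S (partial i (\<lambda>z. f z * h z))" for i
    by (subst Ck_cong[OF assms(1) partial_mult[OF assms(1) Suc.prems]])
  then show ?case using Suc.prems by (auto simp: Ck_Suc simp del: Ck.simps)
qed (auto intro: continuous_intros)

lemma Ck_minus:
  assumes "open S" "Ck k S f" shows "Ck k S (\<lambda>z. - f z)"
  using Ck_mult[OF assms(1) Ck_const[of k S "-1"] assms(2)] by simp

lemma Ck_inverse:
  assumes "open S" "\<And>z. z \<in> S \<Longrightarrow> f z \<noteq> 0" "Ck k S f" shows "Ck k S (\<lambda>z. inverse (f z))"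
  using assms(3)
proof (induction k)
  case (Suc k)
  have "Ck k S (\<lambda>z. - (partial i f z * (inverse (f z) * inverse (f z))))" for i
    using Suc.IH[OF Ck_SucD[OF Suc.prems]] Suc.prems[THEN Ck_Suc_partial]
    by (intro Ck_minus Ck_mult assms(1))
  then have "Ck k S (partial i (\<lambda>z. inverse (f z)))" for i
    by (subst Ck_cong[OF assms(1) partial_inverse[OF assms(1) Suc.prems _ assms(2)]])
  then show ?case using Suc.prems assms(2)
    by (auto simp: Ck_Suc differentiable_on_inverse simp del: Ck.simps)
qed (use assms in \<open>auto intro: continuous_intros\<close>)

lemma Ck_exp:
  assumes "open S" "Ck k S f" shows "Ck k S (\<lambda>z. exp (f z))"
  using assms(2)
proof (induction k)
  case (Suc k)
  have "Ck k S (\<lambda>z. exp (f z) * partial i f z)" for i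
    using Suc.IH[OF Ck_SucD[OF Suc.prems]] Suc.prems[THEN Ck_Suc_partial]
    by (intro Ck_mult assms(1))
  then have "Ck k S (partial i (\<lambda>z. exp (f z)))" for i
    by (subst Ck_cong[OF assms(1) partial_exp[OF assms(1) Suc.prems]])
  moreover have "(\<lambda>z. exp (f z)) differentiable_on S"
    unfolding differentiable_on_eq_differentiable_at[OF assms(1)]
    using has_derivative_exp[OF Ck_Suc_has_derivative[OF assms(1) Suc.prems]] differentiableI by blast
  ultimately show ?case by (auto simp: Ck_Suc simp del: Ck.simps)
qed (auto intro: continuous_intros)

section \<open>Symmetry of second partial derivatives\<close>

lemma continuous_on_ball_bound:
  fixes f :: "real^'n::finite \<Rightarrow> real"
  assumes "open S" "continuous_on S f" "y \<in> S" "\<epsilon> > 0"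
  obtains \<delta> where "\<delta> > 0" "ball y \<delta> \<subseteq> S" "\<And>z. z \<in> ball y \<delta> \<Longrightarrow> \<bar>f z - f y\<bar> < \<epsilon>"
proof -
  obtain d where d: "d > 0" "ball y d \<subseteq> S" using assms(1,3) openE by blast
  obtain e where e: "e > 0" "\<And>z. z \<in> S \<Longrightarrow> dist z y < e \<Longrightarrow> dist (f z) (f y) < \<epsilon>"
    using assms(2,3,4) unfolding continuous_on_iff by metis
  show thesis
    by (rule that[of "min d e"]) (use d e in \<open>auto simp: dist_real_def dist_commute subset_iff\<close>)
qed

text \<open>The mean value theorem is applied twice: in direction \<open>i\<close> to the difference
  of \<open>f\<close> over a segment in direction \<open>j\<close>, then in direction
  \<open>j\<close> to \<open>partial i f\<close>. The bound on \<open>h\<close> keeps the whole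
  square inside the ball.\<close>

lemma second_difference_mvt:
  fixes f :: "real^'n::finite \<Rightarrow> real"
  assumes "open S" "Ck 2 S f" "ball y \<delta> \<subseteq> S" "h > 0" "2 * h < \<delta>"
  obtains z where "z \<in> ball y \<delta>"
    "f (y + h *\<^sub>R axis i 1 + h *\<^sub>R axis j 1) - f (y + h *\<^sub>R axis i 1) - f (y + h *\<^sub>R axis j 1) + f y
       = h * h * partial j (partial i f) z"
proof -
  define p where "p s t = y + s *\<^sub>R axis i 1 + t *\<^sub>R axis j 1" for s t :: real
  have pin: "p s t \<in> ball y \<delta>" if "0 \<le> s" "s \<le> h" "0 \<le> t" "t \<le> h" for s t
  proof -
    have "norm (s *\<^sub>R axis i 1 + t *\<^sub>R axis j 1 :: real^'n) \<le> s + t"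
      using norm_triangle_ineq[of "s *\<^sub>R axis i 1 :: real^'n" "t *\<^sub>R axis j 1"] that by simp
    moreover have "dist y (p s t) = norm (s *\<^sub>R axis i 1 + t *\<^sub>R axis j 1 :: real^'n)"
      by (simp add: p_def dist_norm norm_minus_commute algebra_simps)
    ultimately show ?thesis using that assms(5) by auto
  qed
  have C: "Ck (Suc 1) S f" using assms(2) by (simp only: numeral_2_eq_2 One_nat_def)
  have Ci: "Ck (Suc 0) S (partial i f)" using C by (auto simp: Ck_Suc simp del: Ck.simps)
  have ds: "((\<lambda>s. f (p s t)) has_real_derivative partial i f (p s t)) (at s)"
    if "p s t \<in> S" for s t
  proof -
    have "((\<lambda>s. p s t) has_derivative (\<lambda>s. s *\<^sub>R axis i 1)) (at s)"
      unfolding p_def by (auto intro!: derivative_eq_intros)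
    from has_derivative_compose[OF this Ck_Suc_has_derivative[OF assms(1) C that]]
    have "((\<lambda>s. f (p s t)) has_derivative
        (\<lambda>r. frechet_derivative f (at (p s t)) (r *\<^sub>R axis i 1))) (at s)" by simp
    moreover have "frechet_derivative f (at (p s t)) (r *\<^sub>R axis i 1) = partial i f (p s t) * r" for r
      using linear_frechet_derivative[OF differentiableI[OF Ck_Suc_has_derivative[OF assms(1) C that]]]
      by (simp add: partial_def linear_cmul)
    ultimately show ?thesis by (simp add: has_field_derivative_def)
  qed
  have dt: "((\<lambda>t. partial i f (p s t)) has_real_derivative partial j (partial i f) (p s t)) (at t)"
    if "p s t \<in> S" for s t
  proof -
    have "((\<lambda>t. p s t) has_derivative (\<lambda>t. t *\<^sub>R axis j 1)) (at t)"
      unfolding p_def by (auto intro!: derivative_eq_intros)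
    from has_derivative_compose[OF this Ck_Suc_has_derivative[OF assms(1) Ci that]]
    have "((\<lambda>t. partial i f (p s t)) has_derivative
        (\<lambda>r. frechet_derivative (partial i f) (at (p s t)) (r *\<^sub>R axis j 1))) (at t)" by simp
    moreover have "frechet_derivative (partial i f) (at (p s t)) (r *\<^sub>R axis j 1)
        = partial j (partial i f) (p s t) * r" for r
      using linear_frechet_derivative[OF differentiableI[OF Ck_Suc_has_derivative[OF assms(1) Ci that]]]
      by (simp add: partial_def[of j] linear_cmul)
    ultimately show ?thesis by (simp add: has_field_derivative_def)
  qed
  have "\<exists>s. 0 < s \<and> s < h \<and> (f (p h h) - f (p h 0)) - (f (p 0 h) - f (p 0 0))
      = (h - 0) * (partial i f (p s h) - partial i f (p s 0))"
    by (rule MVT2[OF assms(4), of "\<lambda>s. f (p s h) - f (p s 0)"])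
       (use pin assms(3,4) in \<open>auto intro!: DERIV_diff ds\<close>)
  then obtain s where s: "0 < s" "s < h" "(f (p h h) - f (p h 0)) - (f (p 0 h) - f (p 0 0))
      = h * (partial i f (p s h) - partial i f (p s 0))" by auto
  have "\<exists>t. 0 < t \<and> t < h \<and> partial i f (p s h) - partial i f (p s 0)
      = (h - 0) * partial j (partial i f) (p s t)"
    by (rule MVT2[OF assms(4), of "\<lambda>t. partial i f (p s t)"])
       (use pin assms(3,4) s in \<open>auto intro!: dt\<close>)
  then obtain t where t: "0 < t" "t < h" "partial i f (p s h) - partial i f (p s 0)
      = h * partial j (partial i f) (p s t)" by auto
  show thesis
  proof (rule that[of "p s t"])
    show "p s t \<in> ball y \<delta>" using pin s t by simp
    show "f (y + h *\<^sub>R axis i 1 + h *\<^sub>R axis j 1) - f (y + h *\<^sub>R axis i 1) - f (y + h *\<^sub>R axis j 1) + f y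
       = h * h * partial j (partial i f) (p s t)"
      using s(3) unfolding t(3) by (simp add: p_def mult.assoc)
  qed
qed

text \<open>The second difference over a square does not depend on the order of \<open>i\<close> and
  \<open>j\<close>, so the two mixed derivatives agree at two points that are both arbitrarily close
  to \<open>y\<close>.\<close>

lemma partial_commute:
  assumes "open S" "Ck 2 S f" "y \<in> S"
  shows "partial i (partial j f) y = partial j (partial i f) y"
proof (rule ccontr)
  assume ne: "partial i (partial j f) y \<noteq> partial j (partial i f) y"
  \<comment> \<open>Half the gap: two numbers strictly closer than this to the two different values
    cannot be equal.\<close>
  define \<epsilon> where "\<epsilon> = \<bar>partial i (partial j f) y - partial j (partial i f) y\<bar> / 2"
  have e: "\<epsilon> > 0" using ne by (simp add: \<epsilon>_def)
  have c: "continuous_on S (partial i (partial j f))" for i j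
    using assms(2) by (simp add: numeral_2_eq_2 partial_def[abs_def] del: Ck.simps(2) add: Ck_Suc)
  obtain d1 where d1: "d1 > 0" "ball y d1 \<subseteq> S"
    "\<And>z. z \<in> ball y d1 \<Longrightarrow> \<bar>partial i (partial j f) z - partial i (partial j f) y\<bar> < \<epsilon>"
    using continuous_on_ball_bound[OF assms(1) c assms(3) e] by metis
  obtain d2 where d2: "d2 > 0" "ball y d2 \<subseteq> S"
    "\<And>z. z \<in> ball y d2 \<Longrightarrow> \<bar>partial j (partial i f) z - partial j (partial i f) y\<bar> < \<epsilon>"
    using continuous_on_ball_bound[OF assms(1) c assms(3) e] by metis
  define h where "h = min d1 d2 / 3"
  have h: "h > 0" "2 * h < d1" "2 * h < d2" using d1 d2 by (auto simp: h_def)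
  obtain z1 where z1: "z1 \<in> ball y d1"
    "f (y + h *\<^sub>R axis j 1 + h *\<^sub>R axis i 1) - f (y + h *\<^sub>R axis j 1) - f (y + h *\<^sub>R axis i 1) + f y
       = h * h * partial i (partial j f) z1"
    using second_difference_mvt[OF assms(1,2) d1(2) h(1,2)] by metis
  obtain z2 where z2: "z2 \<in> ball y d2"
    "f (y + h *\<^sub>R axis i 1 + h *\<^sub>R axis j 1) - f (y + h *\<^sub>R axis i 1) - f (y + h *\<^sub>R axis j 1) + f y
       = h * h * partial j (partial i f) z2"
    using second_difference_mvt[OF assms(1,2) d2(2) h(1,3)] by metis
  have "h * h * partial i (partial j f) z1 = h * h * partial j (partial i f) z2"
    unfolding z1(2)[symmetric] z2(2)[symmetric] by (simp add: add_ac)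
  then have "partial i (partial j f) z1 = partial j (partial i f) z2" using h by simp
  then show False using d1(3)[OF z1(1)] d2(3)[OF z2(1)] unfolding \<epsilon>_def by (simp add: abs_if split: if_splits)
qed

section \<open>Smooth functions on a chart domain and their coordinate derivatives\<close>

named_theorems smooth_intros

lemma sum_of_bool_mult [simp]:
  fixes k :: "'a::finite \<Rightarrow> real"
  shows "(\<Sum>d\<in>UNIV. of_bool (c = d) * k d) = k c" "(\<Sum>d\<in>UNIV. of_bool (d = c) * k d) = k c"
    "(\<Sum>d\<in>UNIV. k d * of_bool (c = d)) = k c" "(\<Sum>d\<in>UNIV. k d * of_bool (d = c)) = k c"
  by (simp_all add: of_bool_def if_distrib[of "\<lambda>b. b * _"] if_distrib[of "\<lambda>b. _ * b"] cong: if_cong)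

text \<open>What the calculation in one chart needs to know about a pseudo-Riemannian metric; of the
  signature only nondegeneracy is kept, as a nonzero determinant.\<close>

locale smooth_chart_metric = chart_metric \<kappa> g
  for \<kappa> :: "('m, 'n::finite) chart" and g :: "'n \<Rightarrow> 'n \<Rightarrow> 'm \<Rightarrow> real" +
  assumes open_coord: "open (coord \<kappa> ` chart_dom \<kappa>)"
    and inj_coord: "inj_on (coord \<kappa>) (chart_dom \<kappa>)"
    and smooth_g: "\<And>a b. smooth_in \<kappa> (chart_dom \<kappa>) (g a b)"
    and g_sym: "\<And>a b x. x \<in> chart_dom \<kappa> \<Longrightarrow> g a b x = g b a x"
    and det_g: "\<And>x. x \<in> chart_dom \<kappa> \<Longrightarrow> det (\<chi> i j. g i j x) \<noteq> 0"
begin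

abbreviation U :: "'m set" where "U \<equiv> chart_dom \<kappa>"

abbreviation sm :: "('m \<Rightarrow> real) \<Rightarrow> bool" where "sm \<equiv> smooth_in \<kappa> U"

lemma in_coords_apply: "x \<in> U \<Longrightarrow> in_coords \<kappa> f (coord \<kappa> x) = f x"
  using inj_coord by (simp add: in_coords_def)

lemma pd_partial: "pd a f x = partial a (in_coords \<kappa> f) (coord \<kappa> x)"
  by (simp add: cderiv_def partial_def)

lemma sm_Ck: "sm f \<Longrightarrow> Ck k (coord \<kappa> ` U) (in_coords \<kappa> f)"
  by (simp add: smooth_in_def)

lemma in_coords_cong:
  assumes "\<And>y. y \<in> U \<Longrightarrow> f y = h y" "z \<in> coord \<kappa> ` U"
  shows "in_coords \<kappa> f z = in_coords \<kappa> h z"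
  using assms by (auto simp: in_coords_apply)

lemma sm_cong:
  assumes "\<And>y. y \<in> U \<Longrightarrow> f y = h y"
  shows "sm f \<longleftrightarrow> sm h"
proof -
  have "Ck k (coord \<kappa> ` U) (in_coords \<kappa> f) \<longleftrightarrow> Ck k (coord \<kappa> ` U) (in_coords \<kappa> h)" for k
    by (rule Ck_cong[OF open_coord]) (rule in_coords_cong[OF assms])
  then show ?thesis by (simp add: smooth_in_def)
qed

lemma pd_cong:
  assumes "x \<in> U" "\<And>y. y \<in> U \<Longrightarrow> f y = h y"
  shows "pd a f x = pd a h x"
  unfolding pd_partial
  by (rule partial_cong[OF open_coord]) (use assms in \<open>auto simp: in_coords_apply\<close>)

lemma sm_const [smooth_intros]: "sm (\<lambda>y. c)"
  unfolding smooth_in_def in_coords_def by (simp add: Ck_const)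

lemma sm_add [smooth_intros]: "sm f \<Longrightarrow> sm h \<Longrightarrow> sm (\<lambda>y. f y + h y)"
  unfolding smooth_in_def in_coords_def by (auto intro: Ck_add open_coord)

lemma sm_mult [smooth_intros]: "sm f \<Longrightarrow> sm h \<Longrightarrow> sm (\<lambda>y. f y * h y)"
  unfolding smooth_in_def in_coords_def by (auto intro: Ck_mult open_coord)

lemma sm_minus [smooth_intros]: "sm f \<Longrightarrow> sm (\<lambda>y. - f y)"
  unfolding smooth_in_def in_coords_def by (auto intro: Ck_minus open_coord)

lemma sm_diff [smooth_intros]: "sm f \<Longrightarrow> sm h \<Longrightarrow> sm (\<lambda>y. f y - h y)"
  using sm_add[OF _ sm_minus] by simp

lemma sm_exp [smooth_intros]: "sm f \<Longrightarrow> sm (\<lambda>y. exp (f y))"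
  unfolding smooth_in_def in_coords_def by (auto intro: Ck_exp open_coord)

lemma sm_inverse: "sm f \<Longrightarrow> (\<And>y. y \<in> U \<Longrightarrow> f y \<noteq> 0) \<Longrightarrow> sm (\<lambda>y. inverse (f y))"
  unfolding smooth_in_def
proof
  fix k
  assume f: "\<forall>k. Ck k (coord \<kappa> ` U) (in_coords \<kappa> f)" "\<And>y. y \<in> U \<Longrightarrow> f y \<noteq> 0"
  have "Ck k (coord \<kappa> ` U) (\<lambda>z. inverse (in_coords \<kappa> f z))"
    by (rule Ck_inverse[OF open_coord]) (use f in \<open>auto simp: in_coords_apply\<close>)
  then show "Ck k (coord \<kappa> ` U) (in_coords \<kappa> (\<lambda>y. inverse (f y)))"
    unfolding in_coords_def .
qed

lemma sm_sum [smooth_intros]: "(\<And>i. i \<in> I \<Longrightarrow> sm (f i)) \<Longrightarrow> sm (\<lambda>y. \<Sum>i\<in>I. f i y)"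
  by (induction I rule: infinite_finite_induct) (auto intro: smooth_intros)

lemma sm_if [smooth_intros]: "sm f \<Longrightarrow> sm h \<Longrightarrow> sm (\<lambda>y. if c then f y else h y)"
  by (cases c) simp_all

lemma sm_prod [smooth_intros]: "(\<And>i. i \<in> I \<Longrightarrow> sm (f i)) \<Longrightarrow> sm (\<lambda>y. \<Prod>i\<in>I. f i y)"
  by (induction I rule: infinite_finite_induct) (auto intro: smooth_intros)

lemma in_coords_pd:
  assumes "z \<in> coord \<kappa> ` U"
  shows "in_coords \<kappa> (pd a f) z = partial a (in_coords \<kappa> f) z"
  unfolding in_coords_def[of \<kappa> "pd a f"] pd_partial using assms by (simp add: f_inv_into_f)

lemma sm_pd [smooth_intros]: assumes "sm f" shows "sm (pd a f)"
proof -
  have "Ck k (coord \<kappa> ` U) (in_coords \<kappa> (pd a f)) \<longleftrightarrow> Ck k (coord \<kappa> ` U) (partial a (in_coords \<kappa> f))" for k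
    by (rule Ck_cong[OF open_coord]) (rule in_coords_pd)
  then show ?thesis using Ck_Suc_partial[OF sm_Ck[OF assms]] by (simp add: smooth_in_def)
qed

lemma pd_const: "pd a (\<lambda>y. c) x = 0"
  by (simp add: pd_partial in_coords_def partial_const)

lemma pd_add:
  assumes "x \<in> U" "sm f" "sm h"
  shows "pd a (\<lambda>y. f y + h y) x = pd a f x + pd a h x"
  using partial_add[OF open_coord sm_Ck[OF assms(2), of "Suc 0"] sm_Ck[OF assms(3), of "Suc 0"], of "coord \<kappa> x"]
    assms(1) unfolding pd_partial by (simp add: in_coords_def)

lemma pd_mult:
  assumes "x \<in> U" "sm f" "sm h"
  shows "pd a (\<lambda>y. f y * h y) x = f x * pd a h x + pd a f x * h x"
proof -
  have "pd a (\<lambda>y. f y * h y) x = partial a (\<lambda>z. in_coords \<kappa> f z * in_coords \<kappa> h z) (coord \<kappa> x)"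
    unfolding pd_partial by (simp add: in_coords_def)
  then show ?thesis
    using partial_mult[OF open_coord sm_Ck[OF assms(2), of "Suc 0"] sm_Ck[OF assms(3), of "Suc 0"], of "coord \<kappa> x"]
      assms(1) by (simp add: pd_partial in_coords_apply)
qed

lemma pd_cmult: "x \<in> U \<Longrightarrow> sm f \<Longrightarrow> pd a (\<lambda>y. c * f y) x = c * pd a f x"
  using pd_mult[OF _ sm_const, of x f a c] by (simp add: pd_const)

lemma pd_minus: "x \<in> U \<Longrightarrow> sm f \<Longrightarrow> pd a (\<lambda>y. - f y) x = - pd a f x"
  using pd_cmult[of x f a "-1"] by simp

lemma pd_diff: "x \<in> U \<Longrightarrow> sm f \<Longrightarrow> sm h \<Longrightarrow> pd a (\<lambda>y. f y - h y) x = pd a f x - pd a h x"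
  using pd_add[OF _ _ sm_minus, of x f h a] by (simp add: pd_minus)

lemma pd_sum:
  assumes "x \<in> U" "\<And>i. i \<in> I \<Longrightarrow> sm (f i)"
  shows "pd a (\<lambda>y. \<Sum>i\<in>I. f i y) x = (\<Sum>i\<in>I. pd a (f i) x)"
  using assms(2)
proof (induction I rule: infinite_finite_induct)
  case (insert i I)
  then show ?case using pd_add[OF assms(1), of "f i" "\<lambda>y. \<Sum>i\<in>I. f i y" a]
    by (simp add: sm_sum)
qed (auto simp: pd_const)

lemma pd_commute:
  assumes "x \<in> U" "sm f"
  shows "pd a (pd b f) x = pd b (pd a f) x"
proof -
  have "pd a (pd b f) x = partial a (partial b (in_coords \<kappa> f)) (coord \<kappa> x)" for a b
    unfolding pd_partial[of a "pd b f"]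
    by (rule partial_cong[OF open_coord]) (use assms(1) in_coords_pd in auto)
  then show ?thesis
    using partial_commute[OF open_coord sm_Ck[OF assms(2)]] assms(1) by auto
qed

section \<open>The inverse metric, contractions and Christoffel symbols\<close>

lemma matrix_inv_g:
  assumes "x \<in> U"
  shows "(\<chi> i j. g i j x) ** (\<chi> i j. gi i j x) = mat 1" "(\<chi> i j. gi i j x) ** (\<chi> i j. g i j x) = mat 1"
proof -
  have "invertible (\<chi> i j. g i j x)" using det_g[OF assms] invertible_det_nz by blast
  moreover have "(\<chi> i j. gi i j x) = matrix_inv (\<chi> i j. g i j x)"
    by (simp add: gi_def vec_eq_iff)
  ultimately show "(\<chi> i j. g i j x) ** (\<chi> i j. gi i j x) = mat 1"
    "(\<chi> i j. gi i j x) ** (\<chi> i j. g i j x) = mat 1"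
    unfolding invertible_def matrix_inv_def by (metis (mono_tags, lifting) someI_ex)+
qed

lemma g_gi: "x \<in> U \<Longrightarrow> (\<Sum>c\<in>UNIV. g a c x * gi c b x) = of_bool (a = b)"
  using arg_cong[OF matrix_inv_g(1), of x "\<lambda>A. A $ a $ b"]
  by (simp add: matrix_matrix_mult_def mat_def)

lemma gi_g: "x \<in> U \<Longrightarrow> (\<Sum>c\<in>UNIV. gi a c x * g c b x) = of_bool (a = b)"
  using arg_cong[OF matrix_inv_g(2), of x "\<lambda>A. A $ a $ b"]
  by (simp add: matrix_matrix_mult_def mat_def)

lemma gi_sym:
  assumes "x \<in> U" shows "gi a b x = gi b a x"
proof -
  let ?G = "(\<chi> i j. g i j x)" and ?H = "(\<chi> i j. gi i j x)"
  have t: "transpose ?G = ?G" by (simp add: transpose_def vec_eq_iff g_sym[OF assms])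
  have "transpose ?H ** ?G = mat 1"
    using arg_cong[OF matrix_inv_g(1)[OF assms], of transpose] t
    by (simp add: matrix_transpose_mul)
  then have "transpose ?H ** ?G ** ?H = ?H"
    by simp
  then have "transpose ?H = ?H"
    by (simp only: matrix_mul_assoc[symmetric] matrix_inv_g(1)[OF assms] matrix_mul_rid)
  then have "transpose ?H $ a $ b = ?H $ a $ b" by simp
  then show ?thesis by (simp add: transpose_def)
qed

text \<open>By Cramer's rule an entry of the inverse is a quotient of two determinants, which are
  polynomials in the components of \<open>g\<close>. \<open>E\<close> has column \<open>a\<close>
  replaced by the unit vector \<open>b\<close>.\<close>

lemma sm_gi [smooth_intros]: "sm (gi a b)"
proof -
  define D where "D y = det (\<chi> i j. g i j y)" for y
  define E where "E y = det (\<chi> i j. if j = a then of_bool (i = b) else g i j y)" for y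
  have "gi a b y = E y * inverse (D y)" if "y \<in> U" for y
  proof -
    have "(\<chi> i j. g i j y) *v (\<chi> c. gi c b y) = (\<chi> i. of_bool (i = b))"
      using g_gi[OF that] by (simp add: matrix_vector_mult_def vec_eq_iff)
    then have "(\<chi> c. gi c b y) $ a = (\<chi> k. det (\<chi> i j. if j = k then (\<chi> i. of_bool (i = b)) $ i
        else (\<chi> i j. g i j y) $ i $ j) / det (\<chi> i j. g i j y)) $ a"
      unfolding cramer[OF det_g[OF that]] by (rule arg_cong)
    also have "\<dots> = E y / D y" by (simp add: E_def D_def cong: if_cong)
    finally have "(\<chi> c. gi c b y) $ a = E y / D y" .
    then show ?thesis by (simp add: field_simps)
  qed
  moreover have "sm E"
    unfolding E_def det_def by (auto intro!: smooth_intros smooth_g)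
  moreover have "sm D"
    unfolding D_def det_def by (intro smooth_intros) (auto intro: smooth_intros smooth_g)
  moreover have "\<And>y. y \<in> U \<Longrightarrow> D y \<noteq> 0"
    by (simp add: D_def det_g)
  ultimately show ?thesis
    using sm_cong[of "gi a b" "\<lambda>y. E y * inverse (D y)"] by (simp add: sm_mult sm_inverse)
qed

lemmas sm_g [smooth_intros] = smooth_g

lemma sm_chr [smooth_intros]: "sm (chr c a b)"
  unfolding chr_def[abs_def] by (intro smooth_intros)

lemma chr_sym: "x \<in> U \<Longrightarrow> chr c a b x = chr c b a x"
proof -
  assume x: "x \<in> U"
  have "pd d (g a b) x = pd d (g b a) x" for d a b
    by (rule pd_cong[OF x]) (rule g_sym)
  then show ?thesis unfolding chr_def by (simp add: add_ac)
qed

text \<open>Tensors are kept with lowered indices and contracted by \<open>tr\<close>, so that index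
  calculations become rewriting with \<open>tr_swap\<close>, \<open>tr_sym\<close> and
  \<open>tr_g\<close>.\<close>

definition tr :: "'m \<Rightarrow> ('n \<Rightarrow> 'n \<Rightarrow> real) \<Rightarrow> real" where
  "tr x f = (\<Sum>a\<in>UNIV. \<Sum>b\<in>UNIV. gi a b x * f a b)"

abbreviation tr2 :: "'m \<Rightarrow> ('n \<Rightarrow> 'n \<Rightarrow> 'n \<Rightarrow> 'n \<Rightarrow> real) \<Rightarrow> real" where
  "tr2 x f \<equiv> tr x (\<lambda>a b. tr x (\<lambda>c d. f a b c d))"

lemma tr_add: "tr x (\<lambda>a b. f a b + h a b) = tr x f + tr x h"
  by (simp add: tr_def sum.distrib distrib_left)

lemma tr_diff: "tr x (\<lambda>a b. f a b - h a b) = tr x f - tr x h"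
  by (simp add: tr_def sum_subtractf right_diff_distrib)

lemma tr_minus: "tr x (\<lambda>a b. - f a b) = - tr x f"
  by (simp add: tr_def sum_negf)

lemma tr_zero: "tr x (\<lambda>a b. 0) = 0"
  by (simp add: tr_def)

lemma tr_cmult: "tr x (\<lambda>a b. c * f a b) = c * tr x f"
  by (simp add: tr_def sum_distrib_left mult.left_commute)

lemma tr_multc: "tr x (\<lambda>a b. f a b * c) = tr x f * c"
  by (simp add: tr_def sum_distrib_right mult.assoc)

lemma tr_sum: "tr x (\<lambda>a b. \<Sum>i\<in>I. f i a b) = (\<Sum>i\<in>I. tr x (f i))"
proof -
  have "tr x (\<lambda>a b. \<Sum>i\<in>I. f i a b) = (\<Sum>a\<in>UNIV. \<Sum>b\<in>UNIV. \<Sum>i\<in>I. gi a b x * f i a b)"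
    by (simp add: tr_def sum_distrib_left)
  also have "\<dots> = (\<Sum>a\<in>UNIV. \<Sum>i\<in>I. \<Sum>b\<in>UNIV. gi a b x * f i a b)"
    by (intro sum.cong refl sum.swap)
  also have "\<dots> = (\<Sum>i\<in>I. tr x (f i))"
    unfolding tr_def by (rule sum.swap)
  finally show ?thesis .
qed

lemma tr_swap: "tr x (\<lambda>a b. tr x (\<lambda>c d. f a b c d)) = tr x (\<lambda>c d. tr x (\<lambda>a b. f a b c d))"
proof -
  have "tr x (\<lambda>a b. \<Sum>c\<in>UNIV. \<Sum>d\<in>UNIV. gi c d x * f a b c d)
      = (\<Sum>c\<in>UNIV. \<Sum>d\<in>UNIV. gi c d x * tr x (\<lambda>a b. f a b c d))"
    by (simp add: tr_sum tr_cmult)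
  then show ?thesis by (simp add: tr_def[of x "\<lambda>c d. _ c d"])
qed

lemma tr_sym: "x \<in> U \<Longrightarrow> tr x (\<lambda>a b. f a b) = tr x (\<lambda>a b. f b a)"
  unfolding tr_def by (subst sum.swap) (simp add: gi_sym)

lemma tr_g1:
  assumes "x \<in> U" shows "tr x (\<lambda>a b. g c a x * f b) = f c"
proof -
  have "tr x (\<lambda>a b. g c a x * f b) = (\<Sum>b\<in>UNIV. (\<Sum>a\<in>UNIV. g c a x * gi a b x) * f b)"
    unfolding tr_def by (subst sum.swap) (simp add: sum_distrib_left mult_ac)
  then show ?thesis by (simp add: g_gi assms)
qed

lemma tr_g:
  assumes "x \<in> U"
  shows "tr x (\<lambda>a b. g c a x * f b) = f c" "tr x (\<lambda>a b. g a c x * f b) = f c"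
    "tr x (\<lambda>a b. g c b x * f a) = f c" "tr x (\<lambda>a b. g b c x * f a) = f c"
    "tr x (\<lambda>a b. f b * g c a x) = f c" "tr x (\<lambda>a b. f b * g a c x) = f c"
    "tr x (\<lambda>a b. f a * g c b x) = f c" "tr x (\<lambda>a b. f a * g b c x) = f c"
  using tr_g1[OF assms, of c f] tr_sym[OF assms, of "\<lambda>a b. g c b x * f a"]
  by (simp_all add: g_sym[OF assms, of _ c] mult.commute)

lemma tr_gtrace:
  assumes "x \<in> U" shows "tr x (\<lambda>a b. g a b x) = real CARD('n)" "tr x (\<lambda>a b. g b a x) = real CARD('n)"
proof -
  have "tr x (\<lambda>a b. g b a x) = (\<Sum>a\<in>UNIV. \<Sum>b\<in>UNIV. gi a b x * g b a x)"
    by (simp add: tr_def)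
  also have "\<dots> = real CARD('n)" by (simp add: gi_g assms)
  finally show "tr x (\<lambda>a b. g b a x) = real CARD('n)" .
  then show "tr x (\<lambda>a b. g a b x) = real CARD('n)" by (subst tr_sym[OF assms])
qed

lemma sm_tr [smooth_intros]: "(\<And>a b. sm (f a b)) \<Longrightarrow> sm (\<lambda>y. tr y (\<lambda>a b. f a b y))"
  unfolding tr_def by (intro smooth_intros)

section \<open>Compatibility of the Christoffel symbols with the metric\<close>

lemma g_chr:
  assumes "x \<in> U"
  shows "(\<Sum>e\<in>UNIV. g c e x * chr e a b x) = 1/2 * (pd a (g b c) x + pd b (g a c) x - pd c (g a b) x)"
proof -
  define k where "k d = pd a (g b d) x + pd b (g a d) x - pd d (g a b) x" for d
  have "(\<Sum>e\<in>UNIV. g c e x * chr e a b x) = (\<Sum>e\<in>UNIV. \<Sum>d\<in>UNIV. 1/2 * (g c e x * gi e d x * k d))"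
    unfolding chr_def k_def by (simp add: sum_distrib_left mult_ac)
  also have "\<dots> = 1/2 * (\<Sum>d\<in>UNIV. (\<Sum>e\<in>UNIV. g c e x * gi e d x) * k d)"
    by (subst sum.swap) (simp add: sum_distrib_right sum_distrib_left)
  also have "\<dots> = 1/2 * k c" by (simp add: g_gi assms)
  finally show ?thesis by (simp add: k_def)
qed

lemma pd_g:
  assumes x: "x \<in> U"
  shows "pd a (g b c) x = (\<Sum>e\<in>UNIV. chr e a b x * g e c x) + (\<Sum>e\<in>UNIV. chr e a c x * g b e x)"
proof -
  have s: "pd d (g a b) x = pd d (g b a) x" for d a b
    by (rule pd_cong[OF x]) (rule g_sym)
  have "(\<Sum>e\<in>UNIV. chr e a b x * g e c x) + (\<Sum>e\<in>UNIV. chr e a c x * g b e x)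
    = (\<Sum>e\<in>UNIV. g c e x * chr e a b x) + (\<Sum>e\<in>UNIV. g b e x * chr e a c x)"
    by (simp add: mult.commute g_sym[OF x, of _ c])
  then show ?thesis
    unfolding g_chr[OF x] by (simp add: s[of a c b] field_simps)
qed

text \<open>Differentiating the identity \<open>gi_g\<close> gives the derivative of
  \<open>gi\<close> contracted with \<open>g\<close> (fact \<open>h\<close>); contracting once more
  with \<open>gi\<close> isolates it (fact \<open>inv\<close>).\<close>

lemma pd_gi:
  assumes x: "x \<in> U"
  shows "pd a (gi b c) x = - (\<Sum>e\<in>UNIV. chr b a e x * gi e c x) - (\<Sum>e\<in>UNIV. chr c a e x * gi b e x)"
proof -
  have z: "(\<Sum>d\<in>UNIV. gi b d x * pd a (g d f) x + pd a (gi b d) x * g d f x) = 0" for f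
  proof -
    have "pd a (\<lambda>y. \<Sum>d\<in>UNIV. gi b d y * g d f y) x = pd a (\<lambda>y. of_bool (b = f)) x"
      by (rule pd_cong[OF x]) (rule gi_g)
    moreover have "pd a (\<lambda>y. \<Sum>d\<in>UNIV. gi b d y * g d f y) x
        = (\<Sum>d\<in>UNIV. gi b d x * pd a (g d f) x + pd a (gi b d) x * g d f x)"
      by (subst pd_sum[OF x]) (auto intro!: smooth_intros simp: pd_mult[OF x] smooth_intros)
    ultimately show ?thesis by (simp add: pd_const)
  qed
  have h: "(\<Sum>d\<in>UNIV. pd a (gi b d) x * g d f x)
      = - chr b a f x - (\<Sum>e\<in>UNIV. (\<Sum>d\<in>UNIV. gi b d x * chr e a d x) * g e f x)" for f
  proof -
    have "(\<Sum>d\<in>UNIV. gi b d x * pd a (g d f) x)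
      = (\<Sum>d\<in>UNIV. \<Sum>e\<in>UNIV. gi b d x * chr e a d x * g e f x)
        + (\<Sum>d\<in>UNIV. \<Sum>e\<in>UNIV. gi b d x * g d e x * chr e a f x)"
      by (simp add: pd_g[OF x] distrib_left sum.distrib sum_distrib_left mult_ac)
    also have "(\<Sum>d\<in>UNIV. \<Sum>e\<in>UNIV. gi b d x * g d e x * chr e a f x)
      = (\<Sum>e\<in>UNIV. (\<Sum>d\<in>UNIV. gi b d x * g d e x) * chr e a f x)"
      by (subst sum.swap) (simp add: sum_distrib_right)
    also have "\<dots> = chr b a f x" by (simp add: gi_g x)
    also have "(\<Sum>d\<in>UNIV. \<Sum>e\<in>UNIV. gi b d x * chr e a d x * g e f x)
      = (\<Sum>e\<in>UNIV. (\<Sum>d\<in>UNIV. gi b d x * chr e a d x) * g e f x)"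
      by (subst sum.swap) (simp add: sum_distrib_right)
    finally show ?thesis using z[of f] by (simp add: sum.distrib)
  qed
  have inv: "(\<Sum>f\<in>UNIV. (\<Sum>d\<in>UNIV. k d * g d f x) * gi f c x) = k c" for k :: "'n \<Rightarrow> real"
  proof -
    have "(\<Sum>f\<in>UNIV. (\<Sum>d\<in>UNIV. k d * g d f x) * gi f c x)
        = (\<Sum>d\<in>UNIV. k d * (\<Sum>f\<in>UNIV. g d f x * gi f c x))"
      by (simp add: sum_distrib_left sum_distrib_right mult.assoc) (rule sum.swap)
    then show ?thesis by (simp add: g_gi x)
  qed
  have "pd a (gi b c) x = (\<Sum>f\<in>UNIV. (\<Sum>d\<in>UNIV. pd a (gi b d) x * g d f x) * gi f c x)"
    by (rule inv[symmetric])
  also have "\<dots> = - (\<Sum>f\<in>UNIV. chr b a f x * gi f c x)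
      - (\<Sum>f\<in>UNIV. (\<Sum>e\<in>UNIV. (\<Sum>d\<in>UNIV. gi b d x * chr e a d x) * g e f x) * gi f c x)"
    unfolding h by (simp add: left_diff_distrib sum_subtractf sum_negf)
  also have "(\<Sum>f\<in>UNIV. (\<Sum>e\<in>UNIV. (\<Sum>d\<in>UNIV. gi b d x * chr e a d x) * g e f x) * gi f c x)
      = (\<Sum>d\<in>UNIV. gi b d x * chr c a d x)" by (rule inv)
  finally show ?thesis by (simp add: mult.commute)
qed

text \<open>The inverse metric is parallel: after renaming summation indices, the Christoffel terms
  of \<open>pd_gi\<close> are those of the covariant derivative in the two contracted
  indices.\<close>

lemma pd_tr:
  assumes x: "x \<in> U" and T: "\<And>c d. sm (T c d)"
  shows "pd a (\<lambda>y. tr y (\<lambda>c d. T c d y)) x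
    = tr x (\<lambda>c d. pd a (T c d) x - (\<Sum>e\<in>UNIV. chr e a c x * T e d x) - (\<Sum>e\<in>UNIV. chr e a d x * T c e x))"
proof -
  have "pd a (\<lambda>y. tr y (\<lambda>c d. T c d y)) x
      = (\<Sum>c\<in>UNIV. \<Sum>d\<in>UNIV. gi c d x * pd a (T c d) x + pd a (gi c d) x * T c d x)"
    unfolding tr_def
    by (subst pd_sum[OF x], (intro smooth_intros T)[1], intro sum.cong refl,
        subst pd_sum[OF x], (intro smooth_intros T)[1], simp add: pd_mult[OF x] T smooth_intros)
  also have "\<dots> = tr x (\<lambda>c d. pd a (T c d) x) + (\<Sum>c\<in>UNIV. \<Sum>d\<in>UNIV. pd a (gi c d) x * T c d x)"
    by (simp add: tr_def sum.distrib)
  also have "(\<Sum>c\<in>UNIV. \<Sum>d\<in>UNIV. pd a (gi c d) x * T c d x)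
      = - (\<Sum>c\<in>UNIV. \<Sum>d\<in>UNIV. \<Sum>e\<in>UNIV. gi e d x * (chr c a e x * T c d x))
        - (\<Sum>c\<in>UNIV. \<Sum>d\<in>UNIV. \<Sum>e\<in>UNIV. gi c e x * (chr d a e x * T c d x))"
    by (simp add: pd_gi[OF x] left_diff_distrib sum_subtractf sum_negf sum_distrib_right mult.left_commute mult.assoc)
  also have "(\<Sum>c\<in>UNIV. \<Sum>d\<in>UNIV. \<Sum>e\<in>UNIV. gi e d x * (chr c a e x * T c d x))
      = tr x (\<lambda>c d. \<Sum>e\<in>UNIV. chr e a c x * T e d x)"
  proof -
    have "(\<Sum>c\<in>UNIV. \<Sum>d\<in>UNIV. \<Sum>e\<in>UNIV. gi e d x * (chr c a e x * T c d x))
        = (\<Sum>c\<in>UNIV. tr x (\<lambda>e d. chr c a e x * T c d x))"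
      unfolding tr_def by (intro sum.cong refl sum.swap)
    then show ?thesis by (simp add: tr_sum)
  qed
  also have "(\<Sum>c\<in>UNIV. \<Sum>d\<in>UNIV. \<Sum>e\<in>UNIV. gi c e x * (chr d a e x * T c d x))
      = tr x (\<lambda>c d. \<Sum>e\<in>UNIV. chr e a d x * T c e x)"
    unfolding tr_def sum_distrib_left by (intro sum.cong refl sum.swap)
  finally show ?thesis by (simp add: tr_diff)
qed

end

lemma sum_UNIV_prod:
  fixes f :: "'i::finite \<times> 'j::finite \<Rightarrow> real"
  shows "(\<Sum>p\<in>UNIV. f p) = (\<Sum>i\<in>UNIV. \<Sum>j\<in>UNIV. f (i, j))"
  by (simp add: sum.cartesian_product flip: UNIV_Times_UNIV)

context smooth_chart_metric
begin

section \<open>Commuting covariant derivatives\<close>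

text \<open>\<open>cov \<Theta>\<close> is the covariant derivative on families of functions indexed by an arbitrary finite type
  \<open>'i\<close>; \<open>\<Theta> a j i\<close> is the connection coefficient that pairs the component \<open>j\<close> with the derivative
  \<open>\<nabla>\<^sub>a\<close> of the component \<open>i\<close>, with the sign convention of covariant indices.\<close>

definition cov ::
  "('n \<Rightarrow> 'i \<Rightarrow> 'i \<Rightarrow> 'm \<Rightarrow> real) \<Rightarrow> ('i::finite \<Rightarrow> 'm \<Rightarrow> real) \<Rightarrow> 'n \<Rightarrow> 'i \<Rightarrow> 'm \<Rightarrow> real" where
  "cov \<Theta> T a i x = pd a (T i) x - (\<Sum>j\<in>UNIV. \<Theta> a j i x * T j x)"

definition cov2 ::
  "('n \<Rightarrow> 'i \<Rightarrow> 'i \<Rightarrow> 'm \<Rightarrow> real) \<Rightarrow> ('i::finite \<Rightarrow> 'm \<Rightarrow> real) \<Rightarrow> 'n \<Rightarrow> 'n \<Rightarrow> 'i \<Rightarrow> 'm \<Rightarrow> real" where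
  "cov2 \<Theta> T a b i x = pd a (cov \<Theta> T b i) x
     - (\<Sum>e\<in>UNIV. chr e a b x * cov \<Theta> T e i x) - (\<Sum>j\<in>UNIV. \<Theta> a j i x * cov \<Theta> T b j x)"

definition curv ::
  "('n \<Rightarrow> 'i \<Rightarrow> 'i \<Rightarrow> 'm \<Rightarrow> real) \<Rightarrow> 'n \<Rightarrow> 'n \<Rightarrow> 'i::finite \<Rightarrow> 'i \<Rightarrow> 'm \<Rightarrow> real" where
  "curv \<Theta> a b k i x = pd a (\<Theta> b k i) x - pd b (\<Theta> a k i) x
     - (\<Sum>j\<in>UNIV. \<Theta> a j i x * \<Theta> b k j x - \<Theta> b j i x * \<Theta> a k j x)"

text \<open>The tensor product connection, acting by \<Theta> on one factor and by \<Phi> on the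
  other. A tensor with several indices becomes a family indexed by nested pairs.\<close>

definition prod_conn ::
  "('n \<Rightarrow> 'i \<Rightarrow> 'i \<Rightarrow> 'm \<Rightarrow> real) \<Rightarrow> ('n \<Rightarrow> 'j \<Rightarrow> 'j \<Rightarrow> 'm \<Rightarrow> real)
    \<Rightarrow> 'n \<Rightarrow> 'i \<times> 'j \<Rightarrow> 'i \<times> 'j \<Rightarrow> 'm \<Rightarrow> real" (infixr "\<boxtimes>" 75) where
  "(\<Theta> \<boxtimes> \<Phi>) a p q x = \<Theta> a (fst p) (fst q) x * of_bool (snd p = snd q)
     + of_bool (fst p = fst q) * \<Phi> a (snd p) (snd q) x"

definition LC :: "'n \<Rightarrow> 'n \<Rightarrow> 'n \<Rightarrow> 'm \<Rightarrow> real" where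
  "LC a j i x = chr j a i x"

text \<open>An upper tractor index; the sign fits it to the covariant convention of
  \<open>cov\<close>. \<open>TL\<close> is the dual connection for a lower index.\<close>

definition TU :: "'n \<Rightarrow> 'n tidx \<Rightarrow> 'n tidx \<Rightarrow> 'm \<Rightarrow> real" where
  "TU a F D x = - tconn a D F x"

definition TL :: "'n \<Rightarrow> 'n tidx \<Rightarrow> 'n tidx \<Rightarrow> 'm \<Rightarrow> real" where
  "TL a F E x = tconn a F E x"

text \<open>The Christoffel terms cancel because the connection is torsion-free, the second
  derivatives because they commute, and the first derivatives of \<open>T\<close> in pairs. The
  arbitrary index type lets one proof serve all the tensors and endomorphism-valued forms
  below.\<close>

lemma cov_commutator:
  assumes x: "x \<in> U" and T: "\<And>i. sm (T i)" and \<Theta>: "\<And>a j i. sm (\<Theta> a j i)"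
  shows "cov2 \<Theta> T a b i x - cov2 \<Theta> T b a i x = - (\<Sum>k\<in>UNIV. curv \<Theta> a b k i x * T k x)"
proof -
  have p: "pd a (cov \<Theta> T b i) x = pd a (pd b (T i)) x
      - (\<Sum>j\<in>UNIV. \<Theta> b j i x * pd a (T j) x) - (\<Sum>j\<in>UNIV. pd a (\<Theta> b j i) x * T j x)" for a b
  proof -
    have "pd a (cov \<Theta> T b i) x = pd a (pd b (T i)) x - (\<Sum>j\<in>UNIV. pd a (\<lambda>y. \<Theta> b j i y * T j y) x)"
      unfolding cov_def[abs_def]
      by (simp add: pd_diff[OF x] pd_sum[OF x] smooth_intros T \<Theta>)
    then show ?thesis by (simp add: pd_mult[OF x] T \<Theta> sum.distrib)
  qed
  have q: "(\<Sum>j\<in>UNIV. \<Theta> a j i x * cov \<Theta> T b j x) = (\<Sum>j\<in>UNIV. \<Theta> a j i x * pd b (T j) x)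
      - (\<Sum>k\<in>UNIV. (\<Sum>j\<in>UNIV. \<Theta> a j i x * \<Theta> b k j x) * T k x)" for a b
  proof -
    have "(\<Sum>j\<in>UNIV. \<Theta> a j i x * (\<Sum>k\<in>UNIV. \<Theta> b k j x * T k x))
        = (\<Sum>j\<in>UNIV. \<Sum>k\<in>UNIV. \<Theta> a j i x * \<Theta> b k j x * T k x)"
      by (simp add: sum_distrib_left mult.assoc)
    also have "\<dots> = (\<Sum>k\<in>UNIV. (\<Sum>j\<in>UNIV. \<Theta> a j i x * \<Theta> b k j x) * T k x)"
      by (subst sum.swap) (simp add: sum_distrib_right)
    finally show ?thesis
      unfolding cov_def by (simp add: right_diff_distrib sum_subtractf)
  qed
  have r: "(\<Sum>k\<in>UNIV. curv \<Theta> a b k i x * T k x)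
      = (\<Sum>k\<in>UNIV. pd a (\<Theta> b k i) x * T k x) - (\<Sum>k\<in>UNIV. pd b (\<Theta> a k i) x * T k x)
        - (\<Sum>k\<in>UNIV. (\<Sum>j\<in>UNIV. \<Theta> a j i x * \<Theta> b k j x) * T k x)
        + (\<Sum>k\<in>UNIV. (\<Sum>j\<in>UNIV. \<Theta> b j i x * \<Theta> a k j x) * T k x)"
    unfolding curv_def by (simp add: left_diff_distrib sum_subtractf sum.distrib algebra_simps)
  show ?thesis
    unfolding cov2_def p q r by (simp add: chr_sym[OF x, of _ b a] pd_commute[OF x T, of a b])
qed

lemma cov_prod:
  "cov (\<Theta> \<boxtimes> \<Phi>) T a (i, j) x
     = pd a (T (i, j)) x - (\<Sum>k\<in>UNIV. \<Theta> a k i x * T (k, j) x) - (\<Sum>k\<in>UNIV. \<Phi> a k j x * T (i, k) x)"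
  by (simp add: cov_def prod_conn_def sum_UNIV_prod distrib_right sum.distrib mult.assoc mult.left_commute[of _ "of_bool _"]
        flip: sum_distrib_left)

lemma sum_prod_conn:
  fixes T :: "'i::finite \<times> 'j::finite \<Rightarrow> real"
  shows "(\<Sum>k\<in>UNIV. (\<Theta> \<boxtimes> \<Phi>) a k (i, j) x * T k)
     = (\<Sum>k\<in>UNIV. \<Theta> a k i x * T (k, j)) + (\<Sum>k\<in>UNIV. \<Phi> a k j x * T (i, k))"
  by (simp add: prod_conn_def sum_UNIV_prod distrib_right sum.distrib mult.assoc mult.left_commute[of _ "of_bool _"]
        flip: sum_distrib_left)

lemma sm_prod_conn:
  "(\<And>a j i. sm (\<Theta> a j i)) \<Longrightarrow> (\<And>a j i. sm (\<Phi> a j i)) \<Longrightarrow> sm ((\<Theta> \<boxtimes> \<Phi>) a p q)"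
  unfolding prod_conn_def[abs_def] by (intro smooth_intros)

lemma curv_prod:
  assumes x: "x \<in> U" and \<Theta>: "\<And>a j i. sm (\<Theta> a j i)" and \<Phi>: "\<And>a j i. sm (\<Phi> a j i)"
  shows "curv (\<Theta> \<boxtimes> \<Phi>) a b p q x = curv \<Theta> a b (fst p) (fst q) x * of_bool (snd p = snd q)
     + of_bool (fst p = fst q) * curv \<Phi> a b (snd p) (snd q) x"
proof -
  obtain k l i j where pq: "p = (k, l)" "q = (i, j)" by (metis surj_pair)
  have d: "pd a ((\<Theta> \<boxtimes> \<Phi>) b p q) x
      = pd a (\<Theta> b k i) x * of_bool (l = j) + of_bool (k = i) * pd a (\<Phi> b l j) x" for a b
    unfolding prod_conn_def[abs_def] pq
    by (simp add: pd_add[OF x] pd_mult[OF x] pd_const smooth_intros \<Theta> \<Phi>)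
  \<comment> \<open>The two mixed products of \<Theta> and \<Phi> are together symmetric in
    \<open>a\<close> and \<open>b\<close>, so they disappear from the curvature.\<close>
  have m: "(\<Sum>r\<in>UNIV. (\<Theta> \<boxtimes> \<Phi>) a r q x * (\<Theta> \<boxtimes> \<Phi>) b p r x)
      = (\<Sum>r\<in>UNIV. \<Theta> a r i x * \<Theta> b k r x) * of_bool (l = j) + \<Theta> a k i x * \<Phi> b l j x
        + \<Phi> a l j x * \<Theta> b k i x + of_bool (k = i) * (\<Sum>r\<in>UNIV. \<Phi> a r j x * \<Phi> b l r x)" for a b
    unfolding pq sum_prod_conn
    by (simp add: prod_conn_def distrib_left sum.distrib sum_distrib_right sum_distrib_left mult_ac
        flip: sum_distrib_left)
  show ?thesis
    unfolding curv_def sum_subtractf d m unfolding pq by (simp add: algebra_simps)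
qed

lemma sum_curv_prod:
  assumes x: "x \<in> U" and \<Theta>: "\<And>a j i. sm (\<Theta> a j i)" and \<Phi>: "\<And>a j i. sm (\<Phi> a j i)"
  shows "(\<Sum>k\<in>UNIV. curv (\<Theta> \<boxtimes> \<Phi>) a b k (i, j) x * T k)
     = (\<Sum>k\<in>UNIV. curv \<Theta> a b k i x * T (k, j)) + (\<Sum>k\<in>UNIV. curv \<Phi> a b k j x * T (i, k))"
  by (simp add: curv_prod[OF assms] sum_UNIV_prod distrib_right sum.distrib mult.assoc
        mult.left_commute[of _ "of_bool _"] flip: sum_distrib_left)

section \<open>Symmetries of the Riemann tensor\<close>

lemma curv_LC: "curv LC a b c d x = riem a b c d x" if x: "x \<in> U"
proof -
  have v: "nab_vec (\<lambda>e y. of_bool (e = d)) a c = chr c a d" for a c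
    unfolding nab_vec_def[abs_def] by (simp add: pd_const)
  have lc: "LC a j i = chr j a i" for a j i unfolding LC_def[abs_def] ..
  show ?thesis
    unfolding riem_def Let_def nab_mix_def v curv_def lc
    by (simp add: chr_sym[OF x, of _ b a] sum_subtractf mult.commute)
qed

lemma sm_LC [smooth_intros]: "sm (LC a j i)"
  unfolding LC_def[abs_def] by (intro smooth_intros)

lemma riem_antisym: "riem a b c d x = - riem b a c d x"
  unfolding riem_def Let_def by simp

lemma nab2_g: "x \<in> U \<Longrightarrow> nab2 g a b c x = 0"
  unfolding nab2_def by (simp add: pd_g)

lemma riem_low_antisym: "riem_low a b c d x = - riem_low b a c d x"
  unfolding riem_low_def by (simp add: riem_antisym[of a b] sum_negf)

text \<open>\<open>g\<close> is parallel, so the commutator of covariant derivatives annihilates it;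
  the two curvature terms that this leaves, one for each index of \<open>g\<close>, are the two
  sides.\<close>

lemma riem_low_skew:
  assumes x: "x \<in> U" shows "riem_low a b c d x = - riem_low a b d c x"
proof -
  let ?T = "\<lambda>p. g (fst p) (snd p)"
  have z: "cov (LC \<boxtimes> LC) ?T b p y = 0" if "y \<in> U" for b p y
    using nab2_g[OF that, of b "fst p" "snd p"] cov_prod[of LC LC ?T b "fst p" "snd p" y]
    by (simp add: nab2_def LC_def)
  have "cov2 (LC \<boxtimes> LC) ?T a b p x = 0" for a b p
  proof -
    have "pd a (cov (LC \<boxtimes> LC) ?T b p) x = pd a (\<lambda>y. 0) x"
      by (rule pd_cong[OF x]) (rule z)
    then show ?thesis unfolding cov2_def by (simp add: z x pd_const)
  qed
  then have "(\<Sum>k\<in>UNIV. curv (LC \<boxtimes> LC) a b k (d, c) x * ?T k x) = 0"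
    using cov_commutator[OF x, of ?T "LC \<boxtimes> LC" a b "(d, c)"] by (simp add: smooth_intros sm_prod_conn)
  then have "(\<Sum>k\<in>UNIV. riem a b k d x * g k c x) + (\<Sum>k\<in>UNIV. riem a b k c x * g d k x) = 0"
    using sum_curv_prod[OF x, of LC LC a b d c "\<lambda>k. ?T k x"] by (simp add: smooth_intros curv_LC x)
  then show ?thesis unfolding riem_low_def by (simp add: mult.commute g_sym[OF x, of c])
qed

lemma riem_cyclic:
  assumes x: "x \<in> U" shows "riem a b c d x + riem b d c a x + riem d a c b x = 0"
proof -
  have lc: "LC a j i = chr j a i" for a j i unfolding LC_def[abs_def] ..
  have s: "pd a (chr c b d) x = pd a (chr c d b) x" for a b c d
    by (rule pd_cong[OF x]) (rule chr_sym)
  show ?thesis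
    unfolding curv_LC[OF x, symmetric] curv_def lc sum_subtractf
    using s[of a c b d] s[of b c a d] s[of d c a b]
    by (simp add: chr_sym[OF x, of _ b a] chr_sym[OF x, of _ d a] chr_sym[OF x, of _ d b])
qed

lemma riem_low_cyclic:
  assumes x: "x \<in> U" shows "riem_low a b c d x + riem_low b d c a x + riem_low d a c b x = 0"
proof -
  have "riem_low a b c d x + riem_low b d c a x + riem_low d a c b x
      = (\<Sum>e\<in>UNIV. g c e x * (riem a b e d x + riem b d e a x + riem d a e b x))"
    unfolding riem_low_def by (simp add: distrib_left sum.distrib)
  then show ?thesis by (simp add: riem_cyclic[OF x])
qed

text \<open>A linear consequence of the four cyclic identities on the indices \<open>a\<close>,
  \<open>b\<close>, \<open>c\<close>, \<open>d\<close> and the skew symmetries in both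
  pairs.\<close>

lemma riem_low_pair:
  assumes x: "x \<in> U" shows "riem_low a b c d x = riem_low c d a b x"
proof -
  note c = riem_low_cyclic[OF x] and s = riem_low_skew[OF x] and t = riem_low_antisym[of _ _ _ _ x]
  show ?thesis
    using c[of a b c d] c[of b c d a] c[of c d a b] c[of d a b c]
      s[of a b c d] s[of b d c a] s[of d a c b] s[of b c d a] s[of c a d b] s[of a b d c] s[of c d a b]
      s[of d b a c] s[of b c a d] s[of d a b c] s[of a c b d] s[of c d b a]
      t[of a b c d] t[of b d c a] t[of d a c b] t[of b c d a] t[of c a d b] t[of a b d c] t[of c d a b]
      t[of d b a c] t[of b c a d] t[of d a b c] t[of a c b d] t[of c d b a] t[of a c d b] t[of b d a c]
      t[of a d c b] t[of c b d a] t[of b d c a] t[of d a c b] t[of c a b d] t[of d b c a]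
    by linarith
qed

lemma gi_riem_low: "x \<in> U \<Longrightarrow> (\<Sum>e\<in>UNIV. gi c e x * riem_low a b e d x) = riem a b c d x"
proof -
  assume x: "x \<in> U"
  have "(\<Sum>e\<in>UNIV. gi c e x * riem_low a b e d x)
      = (\<Sum>e\<in>UNIV. \<Sum>f\<in>UNIV. gi c e x * g e f x * riem a b f d x)"
    unfolding riem_low_def by (simp add: sum_distrib_left mult.assoc)
  also have "\<dots> = (\<Sum>f\<in>UNIV. (\<Sum>e\<in>UNIV. gi c e x * g e f x) * riem a b f d x)"
    by (subst sum.swap) (simp add: sum_distrib_right)
  finally show ?thesis by (simp add: gi_g x)
qed

lemma ric_tr: "x \<in> U \<Longrightarrow> ric a b x = tr x (\<lambda>c d. riem_low c a d b x)"
  unfolding ric_def tr_def by (simp add: gi_riem_low)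

lemma ric_sym: "x \<in> U \<Longrightarrow> ric a b x = ric b a x"
  unfolding ric_tr by (subst tr_sym, assumption) (simp add: riem_low_pair[of x _ a _ b])

lemma P_sym: "x \<in> U \<Longrightarrow> P a b x = P b a x"
  unfolding P_def by (simp add: ric_sym[of x a b] g_sym[of x a b])

section \<open>Smoothness of the curvature quantities\<close>

lemma sm_riem [smooth_intros]: "sm (riem a b c d)"
  unfolding riem_def[abs_def] Let_def nab_mix_def[abs_def] nab_vec_def[abs_def] by (intro smooth_intros)

lemma sm_riem_low [smooth_intros]: "sm (riem_low a b c d)"
  unfolding riem_low_def[abs_def] by (intro smooth_intros)

lemma sm_ric [smooth_intros]: "sm (ric a b)"
  unfolding ric_def[abs_def] by (intro smooth_intros)

lemma sm_scal [smooth_intros]: "sm scal"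
  unfolding scal_def[abs_def] by (intro smooth_intros)

lemma sm_P [smooth_intros]: "sm (P a b)"
  unfolding P_def[abs_def] by (intro smooth_intros)

lemma sm_P_mix [smooth_intros]: "sm (P_mix a b)"
  unfolding P_mix_def[abs_def] by (intro smooth_intros)

lemma sm_P_up [smooth_intros]: "sm (P_up a b)"
  unfolding P_up_def[abs_def] by (intro smooth_intros)

lemma sm_J [smooth_intros]: "sm J"
  unfolding J_def[abs_def] by (intro smooth_intros)

lemma sm_nab2 [smooth_intros]: "(\<And>b c. sm (T b c)) \<Longrightarrow> sm (nab2 T a b c)"
  unfolding nab2_def[abs_def] by (intro smooth_intros)

lemma sm_nab3 [smooth_intros]: "(\<And>b c d. sm (T b c d)) \<Longrightarrow> sm (nab3 T a b c d)"
  unfolding nab3_def[abs_def] by (intro smooth_intros)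

lemma sm_cotton [smooth_intros]: "sm (cotton a b c)"
  unfolding cotton_def[abs_def] by (intro smooth_intros)

lemma sm_weyl [smooth_intros]: "sm (weyl a b c d)"
  unfolding weyl_def[abs_def] by (intro smooth_intros)

lemma sm_bach [smooth_intros]: "sm (bach a b)"
  unfolding bach_def[abs_def] by (intro smooth_intros)

section \<open>The tractor connection and its curvature\<close>

lemma tconn_simps:
  "tconn a tY tY x = 0" "tconn a tY (tZ d) x = - of_bool (a = d)" "tconn a tY tX x = 0"
  "tconn a (tZ c) tY x = P a c x" "tconn a (tZ c) (tZ d) x = - chr d a c x" "tconn a (tZ c) tX x = g a c x"
  "tconn a tX tY x = 0" "tconn a tX (tZ d) x = - P_mix a d x" "tconn a tX tX x = 0"
  by (simp_all add: tconn_def tnab_def Let_def nab_Y_def nab_Z_def nab_X_def Z_mix_def Y_up_def Z_up_def X_up_def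
      nab1_def pd_const distrib_left left_diff_distrib sum.distrib sum_subtractf sum_negf
      mult.left_commute[of "of_bool _"] mult.assoc)

lemma sm_tconn [smooth_intros]: "sm (tconn a D E)"
  by (cases D; cases E) (simp_all add: tconn_simps[abs_def] smooth_intros)

definition end_mult :: "('n tidx \<Rightarrow> 'n tidx \<Rightarrow> real) \<Rightarrow> ('n tidx \<Rightarrow> 'n tidx \<Rightarrow> real) \<Rightarrow> 'n tidx \<Rightarrow> 'n tidx \<Rightarrow> real" where
  "end_mult A B D E = (\<Sum>F\<in>UNIV. A D F * B F E)"

definition end_bracket :: "('n tidx \<Rightarrow> 'n tidx \<Rightarrow> real) \<Rightarrow> ('n tidx \<Rightarrow> 'n tidx \<Rightarrow> real) \<Rightarrow> 'n tidx \<Rightarrow> 'n tidx \<Rightarrow> real" where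
  "end_bracket A B D E = end_mult A B D E - end_mult B A D E"

lemma end_mult_assoc: "end_mult (end_mult A B) C D E = end_mult A (end_mult B C) D E"
proof -
  have "end_mult (end_mult A B) C D E = (\<Sum>G\<in>UNIV. \<Sum>F\<in>UNIV. A D F * (B F G * C G E))"
    by (simp add: end_mult_def sum_distrib_right mult.assoc)
  also have "\<dots> = (\<Sum>F\<in>UNIV. \<Sum>G\<in>UNIV. A D F * (B F G * C G E))" by (rule sum.swap)
  finally show ?thesis by (simp add: end_mult_def sum_distrib_left)
qed

lemma end_mult_add_left: "end_mult (\<lambda>F G. A F G + A' F G) B D E = end_mult A B D E + end_mult A' B D E"
  by (simp add: end_mult_def distrib_right sum.distrib)
lemma end_mult_add_right: "end_mult A (\<lambda>F G. B F G + B' F G) D E = end_mult A B D E + end_mult A B' D E"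
  by (simp add: end_mult_def distrib_left sum.distrib)
lemma end_mult_diff_left: "end_mult (\<lambda>F G. A F G - A' F G) B D E = end_mult A B D E - end_mult A' B D E"
  by (simp add: end_mult_def left_diff_distrib sum_subtractf)
lemma end_mult_diff_right: "end_mult A (\<lambda>F G. B F G - B' F G) D E = end_mult A B D E - end_mult A B' D E"
  by (simp add: end_mult_def right_diff_distrib sum_subtractf)

text \<open>The curvature written in connection matrices, without reference to sections;
  \<open>tractor_curvature_eq\<close> identifies it with \<Omega>.\<close>

definition tcurv :: "'n \<Rightarrow> 'n \<Rightarrow> 'n tidx \<Rightarrow> 'n tidx \<Rightarrow> 'm \<Rightarrow> real" where
  "tcurv a b D E x = pd a (tconn b D E) x - pd b (tconn a D E) x
     + end_bracket (\<lambda>F G. tconn a F G x) (\<lambda>F G. tconn b F G x) D E"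

lemma sm_tcurv [smooth_intros]: "sm (tcurv a b D E)"
  unfolding tcurv_def[abs_def] end_bracket_def end_mult_def by (intro smooth_intros)

lemma tcurv_antisym: "tcurv a b D E x = - tcurv b a D E x"
  by (simp add: tcurv_def end_bracket_def)

lemma curv_TL: "curv TL a b F E x = tcurv a b F E x"
proof -
  have tl: "TL a j i = tconn a j i" for a j i unfolding TL_def[abs_def] ..
  show ?thesis unfolding curv_def tl tcurv_def end_bracket_def end_mult_def
    by (simp add: sum_subtractf mult.commute)
qed

lemma curv_TU:
  assumes "x \<in> U" shows "curv TU a b F D x = - tcurv a b D F x"
  unfolding curv_def TU_def[abs_def] tcurv_def end_bracket_def end_mult_def
  by (simp add: pd_minus[OF assms] sum_subtractf mult.commute smooth_intros)

lemma sm_TL [smooth_intros]: "sm (TL a j i)"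
  unfolding TL_def[abs_def] by (intro smooth_intros)

lemma sm_TU [smooth_intros]: "sm (TU a j i)"
  unfolding TU_def[abs_def] by (intro smooth_intros)

text \<open>Form indices are treated as mere labels here. The versions with form indices differ from
  it by Christoffel terms only, so facts on the endomorphism part are proved once.\<close>

definition enab0 :: "('n tidx \<Rightarrow> 'n tidx \<Rightarrow> 'm \<Rightarrow> real) \<Rightarrow> 'n \<Rightarrow> 'n tidx \<Rightarrow> 'n tidx \<Rightarrow> 'm \<Rightarrow> real" where
  "enab0 s a D E x = pd a (s D E) x
     + (\<Sum>F\<in>UNIV. tconn a D F x * s F E x) - (\<Sum>F\<in>UNIV. s D F x * tconn a F E x)"

definition enab3 ::
  "('n \<Rightarrow> 'n \<Rightarrow> 'n \<Rightarrow> 'n tidx \<Rightarrow> 'n tidx \<Rightarrow> 'm \<Rightarrow> real)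
    \<Rightarrow> 'n \<Rightarrow> 'n \<Rightarrow> 'n \<Rightarrow> 'n \<Rightarrow> 'n tidx \<Rightarrow> 'n tidx \<Rightarrow> 'm \<Rightarrow> real" where
  "enab3 T a b c d D E x = enab0 (T b c d) a D E x
     - (\<Sum>e\<in>UNIV. chr e a b x * T e c d D E x) - (\<Sum>e\<in>UNIV. chr e a c x * T b e d D E x)
     - (\<Sum>e\<in>UNIV. chr e a d x * T b c e D E x)"

definition enab4 ::
  "('n \<Rightarrow> 'n \<Rightarrow> 'n \<Rightarrow> 'n \<Rightarrow> 'n tidx \<Rightarrow> 'n tidx \<Rightarrow> 'm \<Rightarrow> real)
    \<Rightarrow> 'n \<Rightarrow> 'n \<Rightarrow> 'n \<Rightarrow> 'n \<Rightarrow> 'n \<Rightarrow> 'n tidx \<Rightarrow> 'n tidx \<Rightarrow> 'm \<Rightarrow> real" where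
  "enab4 T a b c d e D E x = enab0 (T b c d e) a D E x
     - (\<Sum>f\<in>UNIV. chr f a b x * T f c d e D E x) - (\<Sum>f\<in>UNIV. chr f a c x * T b f d e D E x)
     - (\<Sum>f\<in>UNIV. chr f a d x * T b c f e D E x) - (\<Sum>f\<in>UNIV. chr f a e x * T b c d f D E x)"

lemma enab1_eq: "enab1 \<eta> a b D E x = enab0 (\<eta> b) a D E x - (\<Sum>e\<in>UNIV. chr e a b x * \<eta> e D E x)"
  by (simp add: enab1_def enab0_def)

lemma enab2_eq: "enab2 \<omega> a b c D E x = enab0 (\<omega> b c) a D E x
     - (\<Sum>e\<in>UNIV. chr e a b x * \<omega> e c D E x) - (\<Sum>e\<in>UNIV. chr e a c x * \<omega> b e D E x)"
  by (simp add: enab2_def enab0_def)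

lemma sm_enab0 [smooth_intros]: "(\<And>D E. sm (s D E)) \<Longrightarrow> sm (enab0 s a D E)"
  unfolding enab0_def[abs_def] by (intro smooth_intros)

lemma sm_enab1 [smooth_intros]: "(\<And>b D E. sm (T b D E)) \<Longrightarrow> sm (enab1 T a b D E)"
  unfolding enab1_eq[abs_def] by (intro smooth_intros)

lemma sm_enab2 [smooth_intros]: "(\<And>b c D E. sm (T b c D E)) \<Longrightarrow> sm (enab2 T a b c D E)"
  unfolding enab2_eq[abs_def] by (intro smooth_intros)

lemma enab0_cong:
  assumes "x \<in> U" "\<And>y D E. y \<in> U \<Longrightarrow> s D E y = s' D E y"
  shows "enab0 s a D E x = enab0 s' a D E x"
  unfolding enab0_def using assms pd_cong[OF assms(1), of "s D E" "s' D E" a] by simp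

lemma enab1_cong:
  assumes "x \<in> U" "\<And>y b D E. y \<in> U \<Longrightarrow> s b D E y = s' b D E y"
  shows "enab1 s a b D E x = enab1 s' a b D E x"
  unfolding enab1_eq using assms enab0_cong[OF assms(1), of "s b" "s' b"] by simp

lemma enab2_cong:
  assumes "x \<in> U" "\<And>y b c D E. y \<in> U \<Longrightarrow> s b c D E y = s' b c D E y"
  shows "enab2 s a b c D E x = enab2 s' a b c D E x"
  unfolding enab2_eq using assms enab0_cong[OF assms(1), of "s b c" "s' b c"] by simp

lemma enab3_cong:
  assumes "x \<in> U" "\<And>y b c d D E. y \<in> U \<Longrightarrow> s b c d D E y = s' b c d D E y"
  shows "enab3 s a b c d D E x = enab3 s' a b c d D E x"
  unfolding enab3_def using assms enab0_cong[OF assms(1), of "s b c d" "s' b c d"] by simp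

text \<open>An endomorphism-valued 1-form is a family for the product of \<open>LC\<close>,
  \<open>TU\<close> and \<open>TL\<close>. The curvatures of the two tractor factors have opposite
  signs and combine to a bracket with \<open>tcurv\<close>.\<close>

lemma enab1_commutator:
  assumes x: "x \<in> U" and s: "\<And>c D E. sm (\<eta> c D E)"
  shows "enab2 (enab1 \<eta>) a b c D E x - enab2 (enab1 \<eta>) b a c D E x
    = - (\<Sum>e\<in>UNIV. riem a b e c x * \<eta> e D E x)
      + end_bracket (\<lambda>F G. tcurv a b F G x) (\<lambda>F G. \<eta> c F G x) D E"
proof -
  let ?\<Theta> = "LC \<boxtimes> TU \<boxtimes> TL" and ?T = "\<lambda>(c, D, E). \<eta> c D E"
  have 1: "cov ?\<Theta> ?T b (c, D, E) y = enab1 \<eta> b c D E y" for b c D E y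
    unfolding cov_def sum_prod_conn by (simp add: enab1_def sum_negf LC_def TU_def TL_def mult.commute)
  have 2: "cov2 ?\<Theta> ?T a b (c, D, E) x = enab2 (enab1 \<eta>) a b c D E x" for a b c D E
    unfolding cov2_def sum_prod_conn 1 1[abs_def]
    by (simp add: enab2_def sum_negf LC_def TU_def TL_def mult.commute)
  have 3: "(\<Sum>k\<in>UNIV. curv ?\<Theta> a b k (c, D, E) x * ?T k x)
      = (\<Sum>e\<in>UNIV. riem a b e c x * \<eta> e D E x) - end_bracket (\<lambda>F G. tcurv a b F G x) (\<lambda>F G. \<eta> c F G x) D E"
    by (simp add: sum_curv_prod x smooth_intros sm_prod_conn curv_LC curv_TU curv_TL)
       (simp add: end_bracket_def end_mult_def sum_negf mult.commute)
  show ?thesis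
    using cov_commutator[OF x, of ?T ?\<Theta> a b "(c, D, E)"] unfolding 2 3
    by (simp add: s smooth_intros sm_prod_conn split_beta)
qed

lemma enab2_commutator:
  assumes x: "x \<in> U" and s: "\<And>c d D E. sm (\<omega> c d D E)"
  shows "enab3 (enab2 \<omega>) a b c d D E x - enab3 (enab2 \<omega>) b a c d D E x
    = - (\<Sum>e\<in>UNIV. riem a b e c x * \<omega> e d D E x) - (\<Sum>e\<in>UNIV. riem a b e d x * \<omega> c e D E x)
      + end_bracket (\<lambda>F G. tcurv a b F G x) (\<lambda>F G. \<omega> c d F G x) D E"
proof -
  let ?\<Theta> = "LC \<boxtimes> LC \<boxtimes> TU \<boxtimes> TL" and ?T = "\<lambda>(c, d, D, E). \<omega> c d D E"
  have 1: "cov ?\<Theta> ?T b (c, d, D, E) y = enab2 \<omega> b c d D E y" for b c d D E y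
    unfolding cov_def sum_prod_conn by (simp add: enab2_def sum_negf LC_def TU_def TL_def mult.commute)
  have 2: "cov2 ?\<Theta> ?T a b (c, d, D, E) x = enab3 (enab2 \<omega>) a b c d D E x" for a b c d D E
    unfolding cov2_def sum_prod_conn 1 1[abs_def]
    by (simp add: enab3_def enab0_def sum_negf LC_def TU_def TL_def mult.commute)
  have 3: "(\<Sum>k\<in>UNIV. curv ?\<Theta> a b k (c, d, D, E) x * ?T k x)
      = (\<Sum>e\<in>UNIV. riem a b e c x * \<omega> e d D E x) + (\<Sum>e\<in>UNIV. riem a b e d x * \<omega> c e D E x)
        - end_bracket (\<lambda>F G. tcurv a b F G x) (\<lambda>F G. \<omega> c d F G x) D E"
    by (simp add: sum_curv_prod x smooth_intros sm_prod_conn curv_LC curv_TU curv_TL)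
       (simp add: end_bracket_def end_mult_def sum_negf mult.commute)
  show ?thesis
    using cov_commutator[OF x, of ?T ?\<Theta> a b "(c, d, D, E)"] unfolding 2 3
    by (simp add: s smooth_intros sm_prod_conn split_beta)
qed

text \<open>In the cyclic sum the second derivatives of the connection matrices cancel by symmetry,
  the products of a matrix with a derivative cancel in pairs, and the cubic terms cancel as in the
  Jacobi identity.\<close>

lemma tcurv_bianchi:
  assumes x: "x \<in> U"
  shows "enab2 tcurv a b c D E x + enab2 tcurv b c a D E x + enab2 tcurv c a b D E x = 0"
proof -
  let ?t = "\<lambda>a F G. tconn a F G x" and ?d = "\<lambda>a b F G. pd a (tconn b F G) x"
  have p: "pd a (tcurv b c D E) x = pd a (pd b (tconn c D E)) x - pd a (pd c (tconn b D E)) x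
     + end_mult (?d a b) (?t c) D E + end_mult (?t b) (?d a c) D E - end_mult (?d a c) (?t b) D E - end_mult (?t c) (?d a b) D E" for a b c
  proof -
    have "pd a (\<lambda>y. end_mult (\<lambda>F G. tconn b F G y) (\<lambda>F G. tconn c F G y) D E) x
        = end_mult (?d a b) (?t c) D E + end_mult (?t b) (?d a c) D E" for b c
      unfolding end_mult_def by (simp add: pd_sum[OF x] pd_mult[OF x] smooth_intros sum.distrib)
    then show ?thesis unfolding tcurv_def[abs_def] end_bracket_def
      by (simp add: pd_add[OF x] pd_diff[OF x] smooth_intros end_mult_def)
  qed
  \<comment> \<open>Antisymmetry of \<open>tcurv\<close> and symmetry of \<open>chr\<close> turn the
    second Christoffel term into minus a cyclic image of the first, so both drop out of the cyclic
    sum.\<close>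
  have e: "enab2 tcurv a b c D E x = pd a (tcurv b c D E) x
     - (\<Sum>e\<in>UNIV. chr e a b x * tcurv e c D E x) + (\<Sum>e\<in>UNIV. chr e c a x * tcurv e b D E x)
     + end_bracket (?t a) (\<lambda>F G. tcurv b c F G x) D E" for a b c
    unfolding enab2_def end_bracket_def end_mult_def
    by (simp add: chr_sym[OF x, of _ a c] tcurv_antisym[of b _ _ _ x] sum_negf)
  have q: "end_bracket (?t a) (\<lambda>F G. tcurv b c F G x) D E
     = end_mult (?t a) (?d b c) D E - end_mult (?t a) (?d c b) D E - end_mult (?d b c) (?t a) D E + end_mult (?d c b) (?t a) D E
       + end_mult (?t a) (end_mult (?t b) (?t c)) D E - end_mult (?t a) (end_mult (?t c) (?t b)) D E
       - end_mult (?t b) (end_mult (?t c) (?t a)) D E + end_mult (?t c) (end_mult (?t b) (?t a)) D E" for a b c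
    unfolding end_bracket_def tcurv_def by (simp add: end_mult_add_left end_mult_add_right end_mult_diff_left end_mult_diff_right end_mult_assoc)
  have s: "pd a (pd b (tconn c D E)) x = pd b (pd a (tconn c D E)) x" for a b c
    by (rule pd_commute[OF x]) (intro smooth_intros)
  show ?thesis unfolding e p q using s[of a b c] s[of b c a] s[of c a b]
    by simp
qed

section \<open>The slots of a skew endomorphism of the tractor bundle\<close>

text \<open>A tractor index of type \<open>tZ d\<close> in lower position carries a raised tensor
  index; \<open>up\<close> lets the slots themselves keep lower indices.\<close>

definition up :: "'m \<Rightarrow> 'n \<Rightarrow> ('n \<Rightarrow> real) \<Rightarrow> real" where
  "up x d v = (\<Sum>e\<in>UNIV. gi d e x * v e)"

lemma up_add: "up x d (\<lambda>e. v e + w e) = up x d v + up x d w"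
  by (simp add: up_def distrib_left sum.distrib)
lemma up_diff: "up x d (\<lambda>e. v e - w e) = up x d v - up x d w"
  by (simp add: up_def right_diff_distrib sum_subtractf)
lemma up_minus: "up x d (\<lambda>e. - v e) = - up x d v"
  by (simp add: up_def sum_negf)
lemma up_cmult: "up x d (\<lambda>e. c * v e) = c * up x d v"
  by (simp add: up_def sum_distrib_left mult.left_commute)
lemma up_multc: "up x d (\<lambda>e. v e * c) = up x d v * c"
  by (simp add: up_def sum_distrib_right mult.assoc)
lemma up_zero: "up x d (\<lambda>e. 0) = 0"
  by (simp add: up_def)
lemma up_sum: "up x d (\<lambda>e. \<Sum>i\<in>I. v i e) = (\<Sum>i\<in>I. up x d (v i))"
  unfolding up_def sum_distrib_left by (rule sum.swap)
lemma up_g: "x \<in> U \<Longrightarrow> up x d (\<lambda>e. g e a x) = of_bool (d = a)" "x \<in> U \<Longrightarrow> up x d (\<lambda>e. g a e x) = of_bool (d = a)"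
  by (simp_all add: up_def gi_g g_sym[of x a])
lemma sum_up: "(\<Sum>d\<in>UNIV. u d * up x d v) = tr x (\<lambda>d e. u d * v e)"
    "(\<Sum>d\<in>UNIV. up x d v * u d) = tr x (\<lambda>d e. u d * v e)"
  by (simp_all add: up_def tr_def sum_distrib_left mult_ac)
lemma sm_up [smooth_intros]: "(\<And>e. sm (v e)) \<Longrightarrow> sm (\<lambda>y. up y d (\<lambda>e. v e y))"
  unfolding up_def by (intro smooth_intros)
lemma P_mix_up: "P_mix a c x = up x c (\<lambda>d. P a d x)"
  by (simp add: P_mix_def up_def)

lemma pd_up:
  assumes x: "x \<in> U" and v: "\<And>e. sm (v e)"
  shows "pd a (\<lambda>y. up y d (\<lambda>e. v e y)) x = up x d (\<lambda>e. nab1 v a e x) - (\<Sum>c\<in>UNIV. chr d a c x * up x c (\<lambda>e. v e x))"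
proof -
  have "pd a (\<lambda>y. up y d (\<lambda>e. v e y)) x = (\<Sum>e\<in>UNIV. gi d e x * pd a (v e) x) + (\<Sum>e\<in>UNIV. pd a (gi d e) x * v e x)"
    unfolding up_def by (simp add: pd_sum[OF x] pd_mult[OF x] smooth_intros v sum.distrib)
  also have "(\<Sum>e\<in>UNIV. pd a (gi d e) x * v e x)
      = - (\<Sum>e\<in>UNIV. \<Sum>c\<in>UNIV. chr d a c x * (gi c e x * v e x)) - (\<Sum>e\<in>UNIV. \<Sum>c\<in>UNIV. gi d c x * (chr e a c x * v e x))"
    by (simp add: pd_gi[OF x] left_diff_distrib sum_subtractf sum_negf sum_distrib_right mult.assoc mult.left_commute)
  also have "(\<Sum>e\<in>UNIV. \<Sum>c\<in>UNIV. chr d a c x * (gi c e x * v e x)) = (\<Sum>c\<in>UNIV. chr d a c x * up x c (\<lambda>e. v e x))"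
    by (subst sum.swap) (simp add: up_def sum_distrib_left)
  also have "(\<Sum>e\<in>UNIV. \<Sum>c\<in>UNIV. gi d c x * (chr e a c x * v e x)) = (\<Sum>c\<in>UNIV. gi d c x * (\<Sum>e\<in>UNIV. chr e a c x * v e x))"
    by (subst sum.swap) (simp add: sum_distrib_left)
  finally show ?thesis
    by (simp add: nab1_def up_def right_diff_distrib sum_subtractf)
qed

text \<open>The endomorphism with slots \<open>(w, m, f, r)\<close> maps \<open>(\<sigma>, \<mu>\<^sub>c, \<rho>)\<close> to
  \<open>(w\<^sup>c\<mu>\<^sub>c + f\<sigma>, m\<^sub>c\<^sup>d\<mu>\<^sub>d + r\<^sub>c\<sigma> - w\<^sub>c\<rho>, - r\<^sup>c\<mu>\<^sub>c - f\<rho>)\<close>; every endomorphism that is skew for the tractor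
  metric has this form, with \<open>m\<close> skew.\<close>

fun adj :: "'m \<Rightarrow> ('n \<Rightarrow> real) \<Rightarrow> ('n \<Rightarrow> 'n \<Rightarrow> real) \<Rightarrow> real \<Rightarrow> ('n \<Rightarrow> real) \<Rightarrow> 'n tidx \<Rightarrow> 'n tidx \<Rightarrow> real" where
  "adj x w m f r tY tY = f"
| "adj x w m f r tY (tZ d) = up x d w"
| "adj x w m f r tY tX = 0"
| "adj x w m f r (tZ c) tY = r c"
| "adj x w m f r (tZ c) (tZ d) = up x d (m c)"
| "adj x w m f r (tZ c) tX = - w c"
| "adj x w m f r tX tY = 0"
| "adj x w m f r tX (tZ d) = - up x d r"
| "adj x w m f r tX tX = - f"

lemma adj_cong:
  assumes "\<And>c. w c = w' c" "\<And>c d. m c d = m' c d" "f = f'" "\<And>c. r c = r' c"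
  shows "adj x w m f r D E = adj x w' m' f' r' D E"
  using assms by (cases D; cases E) (simp_all cong: up_def)

lemma adj_add: "adj x w m f r D E + adj x w' m' f' r' D E
    = adj x (\<lambda>c. w c + w' c) (\<lambda>c d. m c d + m' c d) (f + f') (\<lambda>c. r c + r' c) D E"
  by (cases D; cases E) (simp_all add: up_add)

lemma adj_diff: "adj x w m f r D E - adj x w' m' f' r' D E
    = adj x (\<lambda>c. w c - w' c) (\<lambda>c d. m c d - m' c d) (f - f') (\<lambda>c. r c - r' c) D E"
  by (cases D; cases E) (simp_all add: up_diff)

lemma adj_cmult: "k * adj x w m f r D E = adj x (\<lambda>c. k * w c) (\<lambda>c d. k * m c d) (k * f) (\<lambda>c. k * r c) D E"
  by (cases D; cases E) (simp_all add: up_cmult)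

lemma adj_minus: "- adj x w m f r D E = adj x (\<lambda>c. - w c) (\<lambda>c d. - m c d) (- f) (\<lambda>c. - r c) D E"
  by (cases D; cases E) (simp_all add: up_minus)

lemma adj_sum: "(\<Sum>i\<in>I. adj x (w i) (m i) (f i) (r i) D E)
    = adj x (\<lambda>c. \<Sum>i\<in>I. w i c) (\<lambda>c d. \<Sum>i\<in>I. m i c d) (\<Sum>i\<in>I. f i) (\<lambda>c. \<Sum>i\<in>I. r i c) D E"
  by (cases D; cases E) (simp_all add: up_sum sum_negf)

lemma adj_sum_mult: "(\<Sum>i\<in>I. k i * adj x (w i) (m i) (f i) (r i) D E)
    = adj x (\<lambda>c. \<Sum>i\<in>I. k i * w i c) (\<lambda>c d. \<Sum>i\<in>I. k i * m i c d) (\<Sum>i\<in>I. k i * f i) (\<lambda>c. \<Sum>i\<in>I. k i * r i c) D E"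
  by (simp add: adj_cmult adj_sum)

lemma adj_tr: "tr x (\<lambda>a b. adj x (w a b) (m a b) (f a b) (r a b) D E)
    = adj x (\<lambda>c. tr x (\<lambda>a b. w a b c)) (\<lambda>c d. tr x (\<lambda>a b. m a b c d)) (tr x f) (\<lambda>c. tr x (\<lambda>a b. r a b c)) D E"
  by (simp add: tr_def adj_sum_mult adj_sum)

text \<open>The Levi-Civita part of the connection matrix completes the partial derivatives of the
  slots to covariant ones, while its entries \<open>P\<close> and \<open>g\<close> mix neighbouring
  slots. Skewness of \<open>m\<close> reconciles the entries that represent the same slot
  twice.\<close>

lemma enab0_adj:
  assumes x: "x \<in> U" and s: "\<And>c. sm (w c)" "\<And>c d. sm (m c d)" "sm f" "\<And>c. sm (r c)"
    and skew: "\<And>c d. m c d x = - m d c x"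
  shows "enab0 (\<lambda>D E y. adj y (\<lambda>c. w c y) (\<lambda>c d. m c d y) (f y) (\<lambda>c. r c y) D E) a D E x
    = adj x (\<lambda>c. nab1 w a c x - m a c x + f x * g a c x)
        (\<lambda>c d. nab2 m a c d x + P a c x * w d x - P a d x * w c x + g a d x * r c x - g a c x * r d x)
        (pd a f x - r a x - tr x (\<lambda>c d. P a c x * w d x))
        (\<lambda>c. nab1 r a c x + P a c x * f x - tr x (\<lambda>d e. m c d x * P a e x)) D E"
proof -
  note simps = enab0_def sum_tidx tconn_simps pd_const pd_minus[OF x] s smooth_intros sum_negf sum_up
    up_add up_diff up_minus up_cmult up_multc up_g[OF x] pd_up[OF x] tr_g[OF x]
  have mc: "nab2 m a c d x = nab1 (m c) a d x - (\<Sum>e\<in>UNIV. chr e a c x * m e d x)" for c d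
    by (simp add: nab2_def nab1_def)
  have us: "(\<Sum>e\<in>UNIV. k e * up x d (\<lambda>e'. m e e' x)) = up x d (\<lambda>e'. \<Sum>e\<in>UNIV. k e * m e e' x)" for k d
    by (simp add: up_sum up_cmult)
  have ut: "up x d (\<lambda>e. tr x (\<lambda>d' e'. m e d' x * P a e' x)) = - (\<Sum>c\<in>UNIV. P_mix a c x * up x d (\<lambda>e. m c e x))" for d
  proof -
    have "tr x (\<lambda>d' e'. m e d' x * P a e' x) = - (\<Sum>c\<in>UNIV. P_mix a c x * m c e x)" for e
      unfolding P_mix_up sum_up by (subst skew) (simp add: tr_minus)
    then show ?thesis by (simp add: up_minus us)
  qed
  have PP: "(\<Sum>c\<in>UNIV. P_mix a c x * u c) = tr x (\<lambda>c d. P a c x * u d)" for u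
    unfolding P_mix_up sum_up by (subst tr_sym[OF x]) (simp add: mult.commute)
  show ?thesis
  proof (cases D)
    case tY
    then show ?thesis
      by (cases E) (simp_all add: simps)
  next
    case (tZ c)
    then show ?thesis
    proof (cases E)
      case tY
      then show ?thesis using tZ tr_sym[OF x, of "\<lambda>d e. m c d x * P a e x"]
        by (simp add: simps nab1_def mult.commute)
    next
      case (tZ d)
      then show ?thesis using \<open>D = tZ c\<close>
        by (simp add: simps mc us P_mix_up mult.commute)
    next
      case tX
      then show ?thesis using tZ skew[of a c]
        by (simp add: simps nab1_def)
    qed
  next
    case tX
    then show ?thesis
    proof (cases E)
      case tY
      then show ?thesis using tX PP by (simp add: simps mult.commute)
    next
      case (tZ d)
      then show ?thesis using tX by (simp add: simps ut P_mix_up mult.commute)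
    next
      case tX
      then show ?thesis using \<open>D = tX\<close> PP by (simp add: simps)
    qed
  qed
qed

definition nab4 ::
  "('n \<Rightarrow> 'n \<Rightarrow> 'n \<Rightarrow> 'n \<Rightarrow> 'm \<Rightarrow> real) \<Rightarrow> 'n \<Rightarrow> 'n \<Rightarrow> 'n \<Rightarrow> 'n \<Rightarrow> 'n \<Rightarrow> 'm \<Rightarrow> real" where
  "nab4 T a b c d e x = pd a (T b c d e) x
     - (\<Sum>f\<in>UNIV. chr f a b x * T f c d e x) - (\<Sum>f\<in>UNIV. chr f a c x * T b f d e x)
     - (\<Sum>f\<in>UNIV. chr f a d x * T b c f e x) - (\<Sum>f\<in>UNIV. chr f a e x * T b c d f x)"

definition nab5 ::
  "('n \<Rightarrow> 'n \<Rightarrow> 'n \<Rightarrow> 'n \<Rightarrow> 'n \<Rightarrow> 'm \<Rightarrow> real) \<Rightarrow> 'n \<Rightarrow> 'n \<Rightarrow> 'n \<Rightarrow> 'n \<Rightarrow> 'n \<Rightarrow> 'n \<Rightarrow> 'm \<Rightarrow> real" where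
  "nab5 T a b c d e k x = pd a (T b c d e k) x
     - (\<Sum>f\<in>UNIV. chr f a b x * T f c d e k x) - (\<Sum>f\<in>UNIV. chr f a c x * T b f d e k x)
     - (\<Sum>f\<in>UNIV. chr f a d x * T b c f e k x) - (\<Sum>f\<in>UNIV. chr f a e x * T b c d f k x)
     - (\<Sum>f\<in>UNIV. chr f a k x * T b c d e f x)"

lemma sm_nab4 [smooth_intros]: "(\<And>b c d e. sm (T b c d e)) \<Longrightarrow> sm (nab4 T a b c d e)"
  unfolding nab4_def[abs_def] by (intro smooth_intros)

lemma nab2_cong:
  assumes "x \<in> U" "\<And>y b c. y \<in> U \<Longrightarrow> S b c y = T b c y" shows "nab2 S a b c x = nab2 T a b c x"
  unfolding nab2_def using assms(2)[OF assms(1)] pd_cong[OF assms(1), of "S b c" "T b c"] assms(2) by simp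
section \<open>Covariant derivatives of endomorphism-valued tensors by slots\<close>

lemma enab1_adj:
  assumes x: "x \<in> U" and s: "\<And>b c. sm (w b c)" "\<And>b c d. sm (m b c d)" "\<And>b. sm (f b)" "\<And>b c. sm (r b c)"
    and skew: "\<And>b c d. m b c d x = - m b d c x"
  shows "enab1 (\<lambda>b D E y. adj y (\<lambda>c. w b c y) (\<lambda>c d. m b c d y) (f b y) (\<lambda>c. r b c y) D E) a b D E x
    = adj x (\<lambda>c. nab2 w a b c x - m b a c x + f b x * g a c x)
        (\<lambda>c d. nab3 m a b c d x + P a c x * w b d x - P a d x * w b c x + g a d x * r b c x - g a c x * r b d x)
        (nab1 f a b x - r b a x - tr x (\<lambda>c d. P a c x * w b d x))
        (\<lambda>c. nab2 r a b c x + P a c x * f b x - tr x (\<lambda>d e. m b c d x * P a e x)) D E"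
  unfolding enab1_eq enab0_adj[OF x, of "w b" "m b" "f b" "r b", OF s skew] adj_sum_mult adj_diff
  by (rule adj_cong) (simp_all add: nab1_def nab2_def nab3_def)

lemma enab2_adj:
  assumes x: "x \<in> U" and s: "\<And>b b' c. sm (w b b' c)" "\<And>b b' c d. sm (m b b' c d)" "\<And>b b'. sm (f b b')" "\<And>b b' c. sm (r b b' c)"
    and skew: "\<And>b b' c d. m b b' c d x = - m b b' d c x"
  shows "enab2 (\<lambda>b b' D E y. adj y (\<lambda>c. w b b' c y) (\<lambda>c d. m b b' c d y) (f b b' y) (\<lambda>c. r b b' c y) D E) a b b' D E x
    = adj x (\<lambda>c. nab3 w a b b' c x - m b b' a c x + f b b' x * g a c x)
        (\<lambda>c d. nab4 m a b b' c d x + P a c x * w b b' d x - P a d x * w b b' c x + g a d x * r b b' c x - g a c x * r b b' d x)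
        (nab2 f a b b' x - r b b' a x - tr x (\<lambda>c d. P a c x * w b b' d x))
        (\<lambda>c. nab3 r a b b' c x + P a c x * f b b' x - tr x (\<lambda>d e. m b b' c d x * P a e x)) D E"
  unfolding enab2_eq enab0_adj[OF x, of "w b b'" "m b b'" "f b b'" "r b b'", OF s skew] adj_sum_mult adj_diff
  by (rule adj_cong) (simp_all add: nab1_def nab2_def nab3_def nab4_def)

lemma enab3_adj:
  assumes x: "x \<in> U" and s: "\<And>b b' b'' c. sm (w b b' b'' c)" "\<And>b b' b'' c d. sm (m b b' b'' c d)"
      "\<And>b b' b''. sm (f b b' b'')" "\<And>b b' b'' c. sm (r b b' b'' c)"
    and skew: "\<And>b b' b'' c d. m b b' b'' c d x = - m b b' b'' d c x"
  shows "enab3 (\<lambda>b b' b'' D E y. adj y (\<lambda>c. w b b' b'' c y) (\<lambda>c d. m b b' b'' c d y) (f b b' b'' y) (\<lambda>c. r b b' b'' c y) D E)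
      a b b' b'' D E x
    = adj x (\<lambda>c. nab4 w a b b' b'' c x - m b b' b'' a c x + f b b' b'' x * g a c x)
        (\<lambda>c d. nab5 m a b b' b'' c d x + P a c x * w b b' b'' d x - P a d x * w b b' b'' c x
          + g a d x * r b b' b'' c x - g a c x * r b b' b'' d x)
        (nab3 f a b b' b'' x - r b b' b'' a x - tr x (\<lambda>c d. P a c x * w b b' b'' d x))
        (\<lambda>c. nab4 r a b b' b'' c x + P a c x * f b b' b'' x - tr x (\<lambda>d e. m b b' b'' c d x * P a e x)) D E"
  unfolding enab3_def enab0_adj[OF x, of "w b b' b''" "m b b' b''" "f b b' b''" "r b b' b''", OF s skew] adj_sum_mult adj_diff
  by (rule adj_cong) (simp_all add: nab1_def nab2_def nab3_def nab4_def nab5_def)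

text \<open>The \<open>w\<close> slot vanishes since \<open>g\<close> is parallel and
  \<open>chr\<close> symmetric, the \<open>f\<close> slot since \<open>P\<close> is symmetric. The
  products of \<open>P\<close> with \<open>g\<close> in the bracket turn Riemann into Weyl, and the
  antisymmetrised derivatives of \<open>P\<close> give Cotton.\<close>

lemma tcurv_adj:
  assumes x: "x \<in> U"
  shows "tcurv a b D E x = adj x (\<lambda>c. 0) (\<lambda>c d. weyl a b c d x) 0 (\<lambda>c. cotton c a b x) D E"
proof -
  have wu: "up x d (\<lambda>e. weyl a b c e x) = - riem a b d c x
      + g c b x * P_mix a d x - g c a x * P_mix b d x + of_bool (d = a) * P b c x - of_bool (d = b) * P a c x" for c d
  proof -
    have "up x d (\<lambda>e. riem_low a b c e x) = - up x d (\<lambda>e. riem_low a b e c x)"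
      by (subst riem_low_skew[OF x]) (simp add: up_minus)
    also have "\<dots> = - riem a b d c x" using gi_riem_low[OF x, of d a b c] by (simp add: up_def)
    finally show ?thesis
      unfolding weyl_def by (simp add: up_add up_diff up_cmult up_multc up_g[OF x] P_mix_up)
  qed
  have cu: "up x d (\<lambda>e. cotton e a b x) = up x d (\<lambda>e. nab1 (P b) a e x) - up x d (\<lambda>e. nab1 (P a) b e x)" for d
  proof -
    have "cotton e a b x = nab1 (P b) a e x - nab1 (P a) b e x" for e
      by (simp add: cotton_def nab2_def nab1_def chr_sym[OF x, of _ b a])
    then show ?thesis by (simp add: up_diff)
  qed
  have pm: "pd a (P_mix b d) x = up x d (\<lambda>e. nab1 (P b) a e x) - (\<Sum>c\<in>UNIV. chr d a c x * P_mix b c x)" for a b d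
    using pd_up[OF x, of "P b" a d] by (simp add: P_mix_up[abs_def] smooth_intros)
  have tc: "tconn a tY tY = (\<lambda>y. 0)" "tconn a tY (tZ d) = (\<lambda>y. - of_bool (a = d))" "tconn a tY tX = (\<lambda>y. 0)"
    "tconn a (tZ c) tY = P a c" "tconn a (tZ c) (tZ d) = (\<lambda>y. - chr d a c y)" "tconn a (tZ c) tX = g a c"
    "tconn a tX tY = (\<lambda>y. 0)" "tconn a tX (tZ d) = (\<lambda>y. - P_mix a d y)" "tconn a tX tX = (\<lambda>y. 0)" for a c d
    by (rule ext, simp add: tconn_simps)+
  note simps = tcurv_def end_bracket_def end_mult_def sum_tidx tconn_simps tc pd_const pd_minus[OF x] smooth_intros sum_negf up_zero
  have PP: "(\<Sum>c\<in>UNIV. P_mix a c x * P b c x) = (\<Sum>c\<in>UNIV. P_mix b c x * P a c x)"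
    unfolding P_mix_up sum_up by (subst tr_sym[OF x]) (simp add: mult.commute)
  have Pg: "(\<Sum>c\<in>UNIV. P_mix a c x * g b c x) = P a b x" for a b
    unfolding P_mix_up sum_up by (simp add: tr_g[OF x])
  note c1 = chr_sym[OF x, of _ b a]
  show ?thesis
  proof (cases D)
    case tY
    then show ?thesis
      by (cases E) (simp_all add: simps P_sym[OF x, of b a] g_sym[OF x, of b a] c1)
  next
    case (tZ c)
    then show ?thesis
    proof (cases E)
      case tY
      then show ?thesis using tZ
        by (simp add: simps cotton_def nab2_def c1 mult.commute)
    next
      case (tZ d)
      have r: "riem a b d c x = pd a (chr d b c) x - pd b (chr d a c) x
          - (\<Sum>j\<in>UNIV. chr j a c x * chr d b j x) + (\<Sum>j\<in>UNIV. chr j b c x * chr d a j x)"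
        unfolding curv_LC[OF x, symmetric] curv_def LC_def[abs_def] by (simp add: sum_subtractf)
      show ?thesis using tZ \<open>D = tZ c\<close>
        by (simp add: simps wu r g_sym[OF x, of c] of_bool_def)
    next
      case tX
      then show ?thesis using tZ
        by (simp add: simps pd_g[OF x] c1 mult.commute g_sym[OF x, of _ c])
    qed
  next
    case tX
    then show ?thesis
    proof (cases E)
      case tY
      then show ?thesis using tX PP by (simp add: simps)
    next
      case (tZ d)
      then show ?thesis using tX by (simp add: simps pm cu mult.commute)
    next
      case tX
      then show ?thesis using \<open>D = tX\<close> by (simp add: simps Pg P_sym[OF x, of b a])
    qed
  qed
qed

section \<open>Contraction and Leibniz rules\<close>

lemma pd_tr_nab2:
  "x \<in> U \<Longrightarrow> (\<And>c d. sm (T c d)) \<Longrightarrow> pd a (\<lambda>y. tr y (\<lambda>c d. T c d y)) x = tr x (\<lambda>c d. nab2 T a c d x)"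
  unfolding nab2_def by (rule pd_tr)

lemma nab2_tr:
  "x \<in> U \<Longrightarrow> (\<And>c d b e. sm (T c d b e)) \<Longrightarrow>
   nab2 (\<lambda>b e y. tr y (\<lambda>c d. T c d b e y)) a b e x = tr x (\<lambda>c d. nab4 T a c d b e x)"
  by (simp add: nab2_def nab4_def pd_tr tr_diff tr_sum tr_cmult)

lemma nab3_tr:
  "x \<in> U \<Longrightarrow> (\<And>c d b e f. sm (T c d b e f)) \<Longrightarrow>
   nab3 (\<lambda>b e f y. tr y (\<lambda>c d. T c d b e f y)) a b e f x = tr x (\<lambda>c d. nab5 T a c d b e f x)"
  by (simp add: nab3_def nab5_def pd_tr tr_diff tr_sum tr_cmult)

lemma enab0_tr:
  "x \<in> U \<Longrightarrow> (\<And>c d D E. sm (T c d D E)) \<Longrightarrow>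
   enab0 (\<lambda>D E y. tr y (\<lambda>c d. T c d D E y)) a D E x = tr x (\<lambda>c d. enab2 T a c d D E x)"
  by (simp add: enab0_def enab2_def pd_tr tr_diff tr_add tr_sum tr_cmult tr_multc)

lemma enab1_tr:
  "x \<in> U \<Longrightarrow> (\<And>c d b D E. sm (T c d b D E)) \<Longrightarrow>
   enab1 (\<lambda>b D E y. tr y (\<lambda>c d. T c d b D E y)) a b D E x = tr x (\<lambda>c d. enab3 T a c d b D E x)"
  by (simp add: enab1_eq enab3_def enab0_tr enab2_eq tr_diff tr_add tr_sum tr_cmult tr_multc)

lemma enab2_tr:
  "x \<in> U \<Longrightarrow> (\<And>c d b e D E. sm (T c d b e D E)) \<Longrightarrow>
   enab2 (\<lambda>b e D E y. tr y (\<lambda>c d. T c d b e D E y)) a b e D E x = tr x (\<lambda>c d. enab4 T a c d b e D E x)"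
  by (simp add: enab2_eq enab4_def enab0_tr tr_diff tr_add tr_sum tr_cmult tr_multc)

lemma enab2_scale:
  assumes x: "x \<in> U" and s: "sm f" "\<And>b c D E. sm (\<omega> b c D E)"
  shows "enab2 (\<lambda>b c D E y. f y * \<omega> b c D E y) a b c D E x = pd a f x * \<omega> b c D E x + f x * enab2 \<omega> a b c D E x"
  by (simp add: enab2_def pd_mult[OF x] s algebra_simps sum_distrib_left)

lemma enab2_tr_mult_left:
  assumes x: "x \<in> U" and s: "\<And>b c. sm (p b c)" "\<And>b c D E. sm (\<omega> b c D E)"
  shows "enab2 (\<lambda>b c D E y. tr y (\<lambda>e f. p b e y * \<omega> f c D E y)) a b c D E x
    = tr x (\<lambda>e f. nab2 p a b e x * \<omega> f c D E x + p b e x * enab2 \<omega> a f c D E x)"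
proof (subst enab2_tr[OF x, of "\<lambda>e f b c D E y. p b e y * \<omega> f c D E y"], (intro smooth_intros s)[1], rule arg_cong[of _ _ "tr x"], intro ext)
  fix e f
  show "enab4 (\<lambda>e f b c D E y. p b e y * \<omega> f c D E y) a e f b c D E x
    = nab2 p a b e x * \<omega> f c D E x + p b e x * enab2 \<omega> a f c D E x"
    by (simp add: enab4_def enab0_def enab2_def nab2_def pd_mult[OF x] s algebra_simps sum_distrib_left sum_distrib_right)
qed

lemma enab2_transpose: "enab2 (\<lambda>b c D E y. s c b D E y) a b c D E x = enab2 s a c b D E x"
  unfolding enab2_def by simp

lemma enab2_tr_mult_right:
  assumes x: "x \<in> U" and s: "\<And>b c. sm (p b c)" "\<And>b c D E. sm (\<omega> b c D E)"
  shows "enab2 (\<lambda>b c D E y. tr y (\<lambda>e f. p c e y * \<omega> b f D E y)) a b c D E x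
    = tr x (\<lambda>e f. nab2 p a c e x * \<omega> b f D E x + p c e x * enab2 \<omega> a b f D E x)"
  using enab2_tr_mult_left[OF x, of p "\<lambda>b c. \<omega> c b" a c b D E] s
    enab2_transpose[of "\<lambda>b c D E y. tr y (\<lambda>e f. p b e y * \<omega> c f D E y)" a b c D E x]
    enab2_transpose[of \<omega> a _ b D E x]
  by simp

lemma nab3_tr_mult:
  assumes x: "x \<in> U" and s: "\<And>b c d. sm (A b c d)" "\<And>b c. sm (p b c)"
  shows "nab3 (\<lambda>b c d y. tr y (\<lambda>e f. A c d e y * p b f y)) a b c d x
    = tr x (\<lambda>e f. nab3 A a c d e x * p b f x + A c d e x * nab2 p a b f x)"
proof (subst nab3_tr[OF x, of "\<lambda>e f b c d y. A c d e y * p b f y"], (intro smooth_intros s)[1], rule arg_cong[of _ _ "tr x"], intro ext)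
  fix e f
  show "nab5 (\<lambda>e f b c d y. A c d e y * p b f y) a e f b c d x
    = nab3 A a c d e x * p b f x + A c d e x * nab2 p a b f x"
    by (simp add: nab5_def nab3_def nab2_def pd_mult[OF x] s algebra_simps sum_distrib_left sum_distrib_right)
qed

lemma nab4_tr_mult:
  assumes x: "x \<in> U" and s: "\<And>b c d e. sm (C b c d e)" "\<And>b c. sm (p b c)"
  shows "nab4 (\<lambda>c a b e y. tr y (\<lambda>d f. C a b e d y * p c f y)) k c a b e x
    = tr x (\<lambda>d f. nab4 C k a b e d x * p c f x + C a b e d x * nab2 p k c f x)"
proof -
  have 1: "nab4 (\<lambda>c a b e y. tr y (\<lambda>d f. C a b e d y * p c f y)) k c a b e x
    = tr x (\<lambda>d f. pd k (\<lambda>y. C a b e d y * p c f y) x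
       - (\<Sum>j\<in>UNIV. chr j k d x * (C a b e j x * p c f x)) - (\<Sum>j\<in>UNIV. chr j k f x * (C a b e d x * p c j x))
       - (\<Sum>j\<in>UNIV. chr j k c x * (C a b e d x * p j f x)) - (\<Sum>j\<in>UNIV. chr j k a x * (C j b e d x * p c f x))
       - (\<Sum>j\<in>UNIV. chr j k b x * (C a j e d x * p c f x)) - (\<Sum>j\<in>UNIV. chr j k e x * (C a b j d x * p c f x)))"
    unfolding nab4_def using pd_tr[OF x, of "\<lambda>d f y. C a b e d y * p c f y" k]
    by (simp add: s smooth_intros tr_diff tr_sum tr_cmult)
  show ?thesis unfolding 1
    by (rule arg_cong[of _ _ "tr x"], intro ext)
       (simp add: nab4_def nab2_def pd_mult[OF x] s algebra_simps sum_distrib_left sum_distrib_right)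
qed

lemma nab4_g_mult:
  assumes x: "x \<in> U" and s: "\<And>b c. sm (B b c)"
  shows "nab4 (\<lambda>b c d e y. g b e y * B d c y) a b c d e x = g b e x * nab2 B a d c x"
    "nab4 (\<lambda>b c d e y. g b d y * B e c y) a b c d e x = g b d x * nab2 B a e c x"
  by (simp_all add: nab4_def nab2_def pd_mult[OF x] pd_g[OF x] s smooth_intros algebra_simps sum_distrib_left sum_distrib_right)

end

locale smooth_chart_metric6 = smooth_chart_metric \<kappa> g
  for \<kappa> :: "('m, 'n::finite) chart" and g :: "'n \<Rightarrow> 'n \<Rightarrow> 'm \<Rightarrow> real" +
  assumes dim: "CARD('n) = 6"
begin

section \<open>Algebraic properties of the Weyl and Cotton tensors\<close>

lemma J_tr: "J x = tr x (\<lambda>a b. P a b x)"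
  by (simp add: J_def tr_def)

lemma ric_P:
  assumes x: "x \<in> U" shows "ric a b x = 4 * P a b x + J x * g a b x"
proof -
  have s: "scal x = tr x (\<lambda>a b. ric a b x)" by (simp add: scal_def tr_def)
  \<comment> \<open>Here 1/4 is 1/(n-2) and 1/10 is 1/(2(n-1)); with the trace 6 of \<open>g\<close>
    this yields that \<open>scal\<close> is 10 times \<open>J\<close>.\<close>
  have p: "P a b x = 1/4 * (ric a b x - 1/10 * g a b x * scal x)" for a b
    by (simp add: P_def dim)
  have "J x = 1/4 * (scal x - 1/10 * 6 * scal x)"
    unfolding J_tr p by (simp add: tr_cmult tr_diff tr_multc tr_gtrace[OF x] dim s flip: mult.assoc times_divide_eq_left)
  then have "scal x = 10 * J x" by simp
  then show ?thesis unfolding p by (simp add: field_simps)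
qed

lemma weyl_skew12: "weyl a b c d x = - weyl b a c d x"
  unfolding weyl_def by (simp add: riem_low_antisym[of a b])

lemma weyl_skew34: "x \<in> U \<Longrightarrow> weyl a b c d x = - weyl a b d c x"
  unfolding weyl_def by (simp add: riem_low_skew[of x a b c d])

lemma weyl_pair: "x \<in> U \<Longrightarrow> weyl a b c d x = weyl c d a b x"
  unfolding weyl_def
  by (simp add: riem_low_pair[of x a b c d] P_sym[of x a] P_sym[of x b] g_sym[of x c] g_sym[of x d] mult.commute)

lemma weyl_cyclic: "x \<in> U \<Longrightarrow> weyl a b c d x + weyl b d c a x + weyl d a c b x = 0"
  using riem_low_cyclic[of x a b c d] unfolding weyl_def
  by (simp add: P_sym[of x d] P_sym[of x b a] g_sym[of x d] g_sym[of x b a] mult.commute)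

text \<open>The terms that correct Riemann to Weyl have trace -4P - Jg, which cancels the Ricci
  tensor by \<open>ric_P\<close>.\<close>

lemma weyl_tr:
  assumes x: "x \<in> U"
  shows "tr x (\<lambda>a c. weyl a b c d x) = 0" "tr x (\<lambda>a c. weyl c b a d x) = 0" "tr x (\<lambda>a c. weyl b a c d x) = 0"
proof -
  have "tr x (\<lambda>a c. weyl a b c d x) = ric b d x - 4 * P b d x - J x * g b d x" for b d
    unfolding weyl_def
    by (simp add: tr_add tr_diff ric_tr[OF x] tr_g[OF x] tr_multc tr_cmult tr_gtrace[OF x] dim J_tr g_sym[OF x, of d b])
  then show 1: "tr x (\<lambda>a c. weyl a b c d x) = 0" by (simp add: ric_P[OF x])
  then show "tr x (\<lambda>a c. weyl c b a d x) = 0" by (subst tr_sym[OF x])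
  show "tr x (\<lambda>a c. weyl b a c d x) = 0"
    by (subst weyl_skew12) (simp add: tr_minus 1)
qed

lemma cotton_skew: "cotton a b c x = - cotton a c b x"
  by (simp add: cotton_def)

lemma nab2_P_sym: "x \<in> U \<Longrightarrow> nab2 P a b c x = nab2 P a c b x"
proof -
  assume x: "x \<in> U"
  have "pd a (P b c) x = pd a (P c b) x" by (rule pd_cong[OF x]) (rule P_sym)
  then show ?thesis unfolding nab2_def by (simp add: P_sym[OF x, of _ b] P_sym[OF x, of _ c])
qed

lemma cotton_cyclic: "x \<in> U \<Longrightarrow> cotton a b c x + cotton b c a x + cotton c a b x = 0"
  unfolding cotton_def using nab2_P_sym[of x a b c] nab2_P_sym[of x b c a] nab2_P_sym[of x c a b] by simp

section \<open>The slots of the Bianchi identity\<close>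

lemma up_inverse: "x \<in> U \<Longrightarrow> (\<Sum>d\<in>UNIV. g e d x * up x d v) = v e"
  unfolding sum_up by (simp add: tr_g)

lemma adj_eq_zeroD:
  assumes x: "x \<in> U" and z: "\<And>D E. adj x w m f r D E = 0"
  shows "w c = 0" "m c d = 0" "f = 0" "r c = 0"
  using z[of "tZ c" tX] z[of tY tY] z[of "tZ c" tY] up_inverse[OF x, of d "m c"] z[of "tZ c" "tZ _"]
  by simp_all

lemma nab4_skew34:
  assumes x: "x \<in> U" shows "nab4 weyl a b c d e x = - nab4 weyl a b c e d x"
proof -
  have "pd a (weyl b c d e) x = pd a (\<lambda>y. - weyl b c e d y) x" by (rule pd_cong[OF x]) (rule weyl_skew34)
  then show ?thesis
    unfolding nab4_def by (simp add: pd_minus[OF x] smooth_intros weyl_skew34[OF x, of _ _ d] weyl_skew34[OF x, of _ _ _ e] sum_negf)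
qed

lemma nab4_pair:
  assumes x: "x \<in> U" shows "nab4 weyl a b c d e x = nab4 weyl a d e b c x"
proof -
  have "pd a (weyl b c d e) x = pd a (weyl d e b c) x" by (rule pd_cong[OF x]) (rule weyl_pair)
  then show ?thesis
    unfolding nab4_def
    by (simp add: weyl_pair[OF x, of _ c d e] weyl_pair[OF x, of b _ d e] weyl_pair[OF x, of b c _ e] weyl_pair[OF x, of b c d])
qed

text \<open>Contraction commutes with the covariant derivative, so the derivative inherits the
  vanishing traces.\<close>

lemma nab4_weyl_tr:
  assumes x: "x \<in> U"
  shows "tr x (\<lambda>a d. nab4 weyl b c a d e x) = 0" "tr x (\<lambda>a d. nab4 weyl b a c d e x) = 0"
proof -
  have "tr x (\<lambda>a d. nab4 weyl b c a d e x) = tr x (\<lambda>a d. nab4 (\<lambda>a d c e. weyl c a d e) b a d c e x)"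
    by (simp add: nab4_def algebra_simps)
  also have "\<dots> = nab2 (\<lambda>c e y. tr y (\<lambda>a d. weyl c a d e y)) b c e x"
    by (rule nab2_tr[OF x, symmetric]) (intro smooth_intros)
  also have "\<dots> = nab2 (\<lambda>c e y. 0) b c e x"
    by (rule nab2_cong[OF x]) (rule weyl_tr)
  finally show "tr x (\<lambda>a d. nab4 weyl b c a d e x) = 0" by (simp add: nab2_def pd_const)
  have "tr x (\<lambda>a d. nab4 weyl b a c d e x) = tr x (\<lambda>a d. nab4 (\<lambda>a d c e. weyl a c d e) b a d c e x)"
    by (simp add: nab4_def algebra_simps)
  also have "\<dots> = nab2 (\<lambda>c e y. tr y (\<lambda>a d. weyl a c d e y)) b c e x"
    by (rule nab2_tr[OF x, symmetric]) (intro smooth_intros)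
  also have "\<dots> = nab2 (\<lambda>c e y. 0) b c e x"
    by (rule nab2_cong[OF x]) (rule weyl_tr)
  finally show "tr x (\<lambda>a d. nab4 weyl b a c d e x) = 0" by (simp add: nab2_def pd_const)
qed

lemma nab_tcurv:
  assumes x: "x \<in> U"
  shows "enab2 tcurv a b c D E x = adj x (\<lambda>e. - weyl b c a e x)
      (\<lambda>d e. nab4 weyl a b c d e x + g a e x * cotton d b c x - g a d x * cotton e b c x)
      (- cotton a b c x)
      (\<lambda>d. nab3 cotton a d b c x - tr x (\<lambda>e f. weyl b c d e x * P a f x)) D E"
proof -
  have "enab2 tcurv a b c D E x
      = enab2 (\<lambda>b c D E y. adj y (\<lambda>e. 0) (\<lambda>d e. weyl b c d e y) 0 (\<lambda>d. cotton d b c y) D E) a b c D E x"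
    by (rule enab2_cong[OF x]) (rule tcurv_adj)
  also have "\<dots> = adj x (\<lambda>e. - weyl b c a e x)
      (\<lambda>d e. nab4 weyl a b c d e x + g a e x * cotton d b c x - g a d x * cotton e b c x)
      (- cotton a b c x)
      (\<lambda>d. nab3 cotton a d b c x - tr x (\<lambda>e f. weyl b c d e x * P a f x)) D E"
  proof (subst enab2_adj[OF x, of "\<lambda>b c e y. 0" weyl "\<lambda>b c y. 0" "\<lambda>b c d. cotton d b c"])
  qed (auto intro!: smooth_intros weyl_skew34[OF x] adj_cong simp: nab3_def nab2_def pd_const tr_zero)
  finally show ?thesis .
qed

lemma bianchi_m:
  assumes x: "x \<in> U"
  shows "nab4 weyl a b c d e x + g a e x * cotton d b c x - g a d x * cotton e b c x
    + (nab4 weyl b c a d e x + g b e x * cotton d c a x - g b d x * cotton e c a x)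
    + (nab4 weyl c a b d e x + g c e x * cotton d a b x - g c d x * cotton e a b x) = 0"
  using adj_eq_zeroD(2)[OF x tcurv_bianchi[OF x, of a b c, unfolded nab_tcurv[OF x] adj_add], of d e]
  by simp

text \<open>One trace of \<open>bianchi_m\<close> gives the divergence of Weyl up to the unknown
  trace \<open>t\<close> of Cotton; the factor is 3 = 6 - 1 - 2. In a second trace the Weyl side
  vanishes and -3t - 6t + t = -8t remains, so \<open>t\<close> is zero.\<close>

lemma cotton_tr: assumes x: "x \<in> U" shows "tr x (\<lambda>a b. cotton a b c x) = 0"
  and div_weyl: "tr x (\<lambda>a d. nab4 weyl a b c d e x) = 3 * cotton e b c x"
proof -
  define t where "t c = tr x (\<lambda>a d. cotton d c a x)" for c
  have t': "tr x (\<lambda>a d. cotton d a c x) = - t c" for c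
    unfolding t_def by (subst cotton_skew) (simp add: tr_minus)
  have v: "tr x (\<lambda>a d. nab4 weyl a b c d e x) = 3 * cotton e b c x - g b e x * t c + g c e x * t b" for b c e
  proof -
    have "0 = tr x (\<lambda>a d. nab4 weyl a b c d e x + g a e x * cotton d b c x - g a d x * cotton e b c x
    + (nab4 weyl b c a d e x + g b e x * cotton d c a x - g b d x * cotton e c a x)
    + (nab4 weyl c a b d e x + g c e x * cotton d a b x - g c d x * cotton e a b x))"
      by (simp add: bianchi_m[OF x] tr_zero)
    also have "\<dots> = tr x (\<lambda>a d. nab4 weyl a b c d e x) + cotton e b c x - 6 * cotton e b c x
        + g b e x * t c - cotton e c b x - g c e x * t b - cotton e c b x"
      by (simp add: tr_add tr_diff tr_cmult tr_multc tr_g[OF x] tr_gtrace[OF x] dim nab4_weyl_tr[OF x] t' flip: t_def)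
    finally show ?thesis using cotton_skew[of e c b x] by simp
  qed
  have "tr2 x (\<lambda>b e a d. nab4 weyl a b c d e x) = 0" for c
  proof -
    have "tr x (\<lambda>b e. nab4 weyl a b c d e x) = 0" for a d
      by (subst nab4_skew34[OF x]) (simp add: tr_minus nab4_weyl_tr[OF x])
    then show ?thesis by (subst tr_swap) (simp add: tr_zero)
  qed
  moreover have "tr2 x (\<lambda>b e a d. nab4 weyl a b c d e x) = - 8 * t c" for c
    unfolding v by (simp add: tr_add tr_diff tr_cmult tr_multc t' tr_gtrace[OF x] dim tr_g[OF x])
  ultimately have t0: "t c = 0" for c by simp
  show "tr x (\<lambda>a d. nab4 weyl a b c d e x) = 3 * cotton e b c x"
    using v by (simp add: t0)
  show "tr x (\<lambda>a b. cotton a b c x) = 0"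
    using t'[of c] t0 by (subst tr_sym[OF x]) simp
qed

lemma div_weyl1:
  assumes x: "x \<in> U"
  shows "tr x (\<lambda>a b. nab4 weyl a b c d e x) = 3 * cotton c d e x"
  unfolding nab4_pair[OF x, of _ _ c d e] using div_weyl[OF x] .

text \<open>The contracted Bianchi identity: Cotton is trace-free, and its trace is the difference
  of the two sides.\<close>

lemma div_P:
  assumes x: "x \<in> U" shows "tr x (\<lambda>a b. nab2 P a b c x) = pd c J x"
proof -
  have "tr x (\<lambda>a b. nab2 P c a b x) = pd c J x"
    unfolding J_tr[abs_def] by (rule pd_tr_nab2[OF x, symmetric]) (intro smooth_intros)
  moreover have "tr x (\<lambda>a b. cotton a b c x) = tr x (\<lambda>a b. nab2 P a b c x) - tr x (\<lambda>a b. nab2 P c a b x)"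
    unfolding cotton_def tr_diff
    by (subst (2) tr_sym[OF x], subst (1) tr_sym[OF x]) (simp add: nab2_P_sym[OF x, of _ c])
  ultimately show ?thesis by (simp add: cotton_tr[OF x])
qed

lemma sum_gi_gi:
  "(\<Sum>c\<in>UNIV. \<Sum>d\<in>UNIV. (\<Sum>e\<in>UNIV. \<Sum>f\<in>UNIV. gi c e x * gi d f x * S e f) * T c d)
     = tr2 x (\<lambda>c e d f. T c d * S e f)"
proof -
  have "(\<Sum>c\<in>UNIV. \<Sum>d\<in>UNIV. (\<Sum>e\<in>UNIV. \<Sum>f\<in>UNIV. gi c e x * gi d f x * S e f) * T c d)
     = (\<Sum>c\<in>UNIV. \<Sum>d\<in>UNIV. \<Sum>e\<in>UNIV. \<Sum>f\<in>UNIV. gi c e x * (gi d f x * (T c d * S e f)))"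
    by (simp add: sum_distrib_left sum_distrib_right mult_ac)
  also have "\<dots> = tr2 x (\<lambda>c e d f. T c d * S e f)"
    unfolding tr_def sum_distrib_left by (intro sum.cong refl sum.swap)
  finally show ?thesis .
qed

lemma sum_gi_gi':
  "(\<Sum>c\<in>UNIV. \<Sum>d\<in>UNIV. \<Sum>e\<in>UNIV. \<Sum>f\<in>UNIV. gi c e x * gi d f x * S e f c d * T e f c d)
     = tr2 x (\<lambda>c e d f. S e f c d * T e f c d)"
proof -
  have "(\<Sum>c\<in>UNIV. \<Sum>d\<in>UNIV. \<Sum>e\<in>UNIV. \<Sum>f\<in>UNIV. gi c e x * gi d f x * S e f c d * T e f c d)
    = (\<Sum>c\<in>UNIV. \<Sum>d\<in>UNIV. \<Sum>e\<in>UNIV. \<Sum>f\<in>UNIV. gi c e x * (gi d f x * (S e f c d * T e f c d)))"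
    by (simp add: mult.assoc)
  also have "\<dots> = tr2 x (\<lambda>c e d f. S e f c d * T e f c d)"
    unfolding tr_def sum_distrib_left by (intro sum.cong refl sum.swap)
  finally show ?thesis .
qed

lemma bach_tr:
  assumes x: "x \<in> U"
  shows "bach a b x = tr x (\<lambda>c d. nab3 cotton c a d b x) + tr2 x (\<lambda>c e d f. weyl c a d b x * P e f x)"
proof -
  have "(\<Sum>c\<in>UNIV. \<Sum>d\<in>UNIV. gi c d x * nab3 cotton d a c b x) = tr x (\<lambda>c d. nab3 cotton c a d b x)"
    by (subst tr_sym[OF x]) (simp add: tr_def)
  then show ?thesis unfolding bach_def P_up_def sum_gi_gi by simp
qed

section \<open>The divergence of the tractor curvature\<close>

lemma delta_tr: "delta \<omega> c D E x = - tr x (\<lambda>a b. enab2 \<omega> a b c D E x)"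
  by (simp add: delta_def tr_def)

lemma delta_tcurv:
  assumes x: "x \<in> U"
  shows "delta tcurv b D E x = adj x (\<lambda>c. 0) (\<lambda>c d. - 2 * cotton b c d x) 0 (\<lambda>c. - bach c b x) D E"
  unfolding delta_tr nab_tcurv[OF x] adj_tr adj_minus
proof (rule adj_cong)
  fix d e
  show "- tr x (\<lambda>a c. - weyl c b a e x) = 0" by (simp add: tr_minus weyl_tr[OF x])
  show "- tr x (\<lambda>a c. - cotton a c b x) = 0" by (simp add: tr_minus cotton_tr[OF x])
  \<comment> \<open>The divergence of Weyl gives 3A, and the two metric terms add up to -A by the
    cyclic identity: the factor 2 is n-4.\<close>
  have "tr x (\<lambda>a c. nab4 weyl a c b d e x + g a e x * cotton d c b x - g a d x * cotton e c b x)
      = 3 * cotton b d e x + cotton d e b x - cotton e d b x"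
    by (simp add: tr_add tr_diff div_weyl1[OF x] tr_g[OF x])
  then show "- tr x (\<lambda>a c. nab4 weyl a c b d e x + g a e x * cotton d c b x - g a d x * cotton e c b x)
      = - 2 * cotton b d e x"
    using cotton_cyclic[OF x, of b d e] cotton_skew[of e d b x] by simp
  have "tr2 x (\<lambda>a c e f. weyl c b d e x * P a f x) = - tr2 x (\<lambda>e f c a. weyl e d c b x * P f a x)"
  proof -
    have "weyl c b d e x * P a f x = - (weyl e d c b x * P f a x)" for a c e f
      using weyl_pair[OF x, of c b d e] weyl_skew12[of d e c b x] P_sym[OF x, of a f] by simp
    then have "tr2 x (\<lambda>a c e f. weyl c b d e x * P a f x) = - tr2 x (\<lambda>a c e f. weyl e d c b x * P f a x)"
      by (simp add: tr_minus)
    then show ?thesis by (subst (asm) (2) tr_sym[OF x], subst tr_swap) simp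
  qed
  then show "- tr x (\<lambda>a c. nab3 cotton a d c b x - tr x (\<lambda>e f. weyl c b d e x * P a f x)) = - bach d b x"
    unfolding bach_tr[OF x] by (simp add: tr_diff)
qed

text \<open>Endomorphisms with vanishing \<open>w\<close> and \<open>f\<close> form a subalgebra,
  the semidirect product of the \<open>m\<close> slots with the \<open>r\<close> slots. The latter
  commute with each other, which is fact \<open>c\<close>.\<close>

lemma end_bracket_adj:
  assumes x: "x \<in> U" and m: "\<And>c d. m c d = - m d c" and m': "\<And>c d. m' c d = - m' d c"
  shows "end_bracket (adj x (\<lambda>c. 0) m 0 r) (adj x (\<lambda>c. 0) m' 0 r') D E
    = adj x (\<lambda>c. 0) (\<lambda>c d. tr x (\<lambda>e f. m c e * m' f d) - tr x (\<lambda>e f. m' c e * m f d)) 0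
        (\<lambda>c. tr x (\<lambda>e f. m c e * r' f) - tr x (\<lambda>e f. m' c e * r f)) D E"
proof -
  have s: "tr x (\<lambda>d e. r d * m c e) = tr x (\<lambda>e f. m c e * r f)" for r :: "'n \<Rightarrow> real" and m c
    by (subst tr_sym[OF x]) (simp add: mult.commute)
  have c: "tr x (\<lambda>c e. r c * r' e) = tr x (\<lambda>c e. r' c * r e)"
    by (subst tr_sym[OF x]) (simp add: mult.commute)
  have u: "tr x (\<lambda>e f. up x d (m e) * v f) = up x d (\<lambda>d'. tr x (\<lambda>e f. v e * m f d'))"
    for v d and m :: "'n \<Rightarrow> 'n \<Rightarrow> real"
  proof -
    have "tr x (\<lambda>e f. up x d (m e) * v f) = (\<Sum>e\<in>UNIV. up x e v * up x d (m e))"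
      by (simp add: sum_up)
    also have "\<dots> = up x d (\<lambda>d'. \<Sum>e\<in>UNIV. up x e v * m e d')"
      by (simp add: up_sum up_cmult)
    also have "\<dots> = up x d (\<lambda>d'. tr x (\<lambda>e f. v e * m f d'))"
      unfolding sum_up by (subst tr_sym[OF x]) (simp add: mult.commute)
    finally show ?thesis .
  qed
  have k: "tr x (\<lambda>e f. v e * q f d') = - tr x (\<lambda>e f. q d' e * v f)"
    if "\<And>c d. q c d = - q d c" for q :: "'n \<Rightarrow> 'n \<Rightarrow> real" and v d'
    by (subst that) (simp add: tr_minus s mult.commute[of "v _"], subst tr_sym[OF x], simp)
  note simps = end_bracket_def end_mult_def sum_tidx up_zero sum_up s u up_diff sum_negf up_minus c
  note km = k[of m, OF m] and km' = k[of m', OF m']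
  show ?thesis
  proof (cases D)
    case tX
    then show ?thesis
    proof (cases E)
      case (tZ d)
      have "end_bracket (adj x (\<lambda>c. 0) m 0 r) (adj x (\<lambda>c. 0) m' 0 r') D E
          = up x d (\<lambda>d'. tr x (\<lambda>c e. r' c * m e d')) - up x d (\<lambda>d'. tr x (\<lambda>c e. r c * m' e d'))"
        using tX tZ by (simp add: simps)
      then show ?thesis using tX tZ unfolding km km' by (simp add: up_diff up_minus)
    qed (use tX in \<open>simp_all add: simps\<close>)
  qed (cases E; simp add: simps)+
qed

lemma riem_sum:
  assumes x: "x \<in> U"
  shows "(\<Sum>f\<in>UNIV. riem a b f c x * v f) = tr x (\<lambda>f h. riem_low a b f c x * v h)"
proof -
  have "(\<Sum>f\<in>UNIV. riem a b f c x * v f) = (\<Sum>f\<in>UNIV. up x f (\<lambda>h. riem_low a b h c x) * v f)"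
    by (simp add: up_def gi_riem_low[OF x])
  then show ?thesis
    unfolding sum_up by (subst (asm) tr_sym[OF x]) (simp add: mult.commute)
qed

lemma enab2_tcurv_skew:
  assumes x: "x \<in> U" shows "enab2 tcurv a b c D E x = - enab2 tcurv a c b D E x"
proof -
  have "pd a (tcurv b c D E) x = pd a (\<lambda>y. - tcurv c b D E y) x"
    by (rule pd_cong[OF x]) (rule tcurv_antisym)
  then show ?thesis
    unfolding enab2_def by (simp add: pd_minus[OF x] smooth_intros tcurv_antisym[of b _ _ _ x] tcurv_antisym[of _ c _ _ x] sum_negf)
qed

lemma enab3_tcurv_skew:
  assumes x: "x \<in> U" shows "enab3 (enab2 tcurv) d a b c D E x = - enab3 (enab2 tcurv) d a c b D E x"
proof -
  have "pd d (enab2 tcurv a b c D E) x = pd d (\<lambda>y. - enab2 tcurv a c b D E y) x" for D E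
    by (rule pd_cong[OF x]) (rule enab2_tcurv_skew)
  then show ?thesis
    unfolding enab3_def enab0_def by (simp add: pd_minus[OF x] smooth_intros enab2_tcurv_skew[OF x, of _ b]
      enab2_tcurv_skew[OF x, of _ _ c] sum_negf)
qed

lemma delta_eq: "delta \<omega> = (\<lambda>c D E y. - tr y (\<lambda>a b. enab2 \<omega> a b c D E y))"
  by (intro ext) (rule delta_tr)

lemma sm_delta [smooth_intros]: "(\<And>b c D E. sm (T b c D E)) \<Longrightarrow> sm (delta T c D E)"
  unfolding delta_eq by (intro smooth_intros)

lemma enab1_delta:
  assumes x: "x \<in> U" and s: "\<And>b c D E. sm (\<omega> b c D E)"
  shows "enab1 (delta \<omega>) e c D E x = - tr x (\<lambda>a b. enab3 (enab2 \<omega>) e a b c D E x)"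
proof -
  have "enab1 (delta \<omega>) e c D E x = - enab1 (\<lambda>c D E y. tr y (\<lambda>a b. enab2 \<omega> a b c D E y)) e c D E x"
    unfolding delta_eq enab1_def by (simp add: pd_minus[OF x] smooth_intros s sum_negf)
  also have "\<dots> = - tr x (\<lambda>a b. enab3 (enab2 \<omega>) e a b c D E x)"
    by (subst enab1_tr[OF x]) (auto intro!: smooth_intros s)
  finally show ?thesis .
qed

lemma tr_tr_sym_skew:
  assumes x: "x \<in> U" and "\<And>e f. S e f = S f e" and "\<And>f c. T f c = - T c f"
  shows "tr2 x (\<lambda>e c f h. S e f * T h c) = 0"
proof -
  have "tr2 x (\<lambda>e c f h. S e f * T h c) = tr2 x (\<lambda>f h e c. S e f * T h c)"
    by (rule tr_swap)
  also have "\<dots> = tr2 x (\<lambda>f h e c. - (S f e * T c h))"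
  proof (intro arg_cong[of _ _ "tr x"] ext)
    fix f h e c
    show "S e f * T h c = - (S f e * T c h)" using assms(2)[of e f] assms(3)[of h c] by simp
  qed
  also have "\<dots> = - tr2 x (\<lambda>e c f h. S e f * T h c)"
    by (simp add: tr_minus)
  finally show ?thesis by simp
qed

text \<open>\<open>\<delta>\<delta>\<Omega> = 0\<close>: the divergence of the divergence of a curvature is a commutator, in which the curvature is
  paired with itself.\<close>

lemma delta_delta_tcurv:
  assumes x: "x \<in> U"
  shows "tr x (\<lambda>e c. enab1 (delta tcurv) e c D E x) = 0"
proof -
  define N where "N e a b c = enab3 (enab2 tcurv) e a b c D E x" for e a b c
  have comm: "N e a b c - N a e b c
      = - tr x (\<lambda>f h. riem_low e a f b x * tcurv h c D E x) - tr x (\<lambda>f h. riem_low e a f c x * tcurv b h D E x)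
       + end_bracket (\<lambda>F G. tcurv e a F G x) (\<lambda>F G. tcurv b c F G x) D E" for e a b c
    unfolding N_def enab2_commutator[OF x sm_tcurv] riem_sum[OF x] ..
  \<comment> \<open>Skewness of the curvature and exchanging the two contractions show that the
    double divergence is minus the one with its derivatives reversed; hence twice it is a
    commutator.\<close>
  have "tr2 x (\<lambda>e c a b. N e a b c) = - tr2 x (\<lambda>e c a b. N e a c b)"
    unfolding N_def by (subst enab3_tcurv_skew[OF x]) (simp add: tr_minus)
  also have "tr2 x (\<lambda>e c a b. N e a c b) = tr2 x (\<lambda>e c a b. N a e b c)"
    by (rule tr_swap)
  finally have "2 * tr2 x (\<lambda>e c a b. N e a b c) = tr2 x (\<lambda>e c a b. N e a b c - N a e b c)"
    by (simp add: tr_diff)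
  also have "\<dots> = - tr2 x (\<lambda>e c a b. tr x (\<lambda>f h. riem_low e a f b x * tcurv h c D E x))
      - tr2 x (\<lambda>e c a b. tr x (\<lambda>f h. riem_low e a f c x * tcurv b h D E x))
      + tr2 x (\<lambda>e c a b. end_bracket (\<lambda>F G. tcurv e a F G x) (\<lambda>F G. tcurv b c F G x) D E)"
    unfolding comm by (simp add: tr_add tr_diff tr_minus)
  \<comment> \<open>The contraction leaves the symmetric Ricci tensor paired with the skew form
    indices of \<open>tcurv\<close>; the next term is of the same kind.\<close>
  also have "tr2 x (\<lambda>e c a b. tr x (\<lambda>f h. riem_low e a f b x * tcurv h c D E x)) = 0"
  proof -
    have "tr x (\<lambda>a b. riem_low e a f b x) = ric e f x" for e f
      unfolding ric_tr[OF x]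
    proof (intro arg_cong[of _ _ "tr x"] ext)
      fix a b
      show "riem_low e a f b x = riem_low a e b f x"
        using riem_low_antisym[of e a f b x] riem_low_skew[OF x, of a e f b] by simp
    qed
    then have "tr2 x (\<lambda>e c a b. tr x (\<lambda>f h. riem_low e a f b x * tcurv h c D E x))
        = tr2 x (\<lambda>e c f h. ric e f x * tcurv h c D E x)"
      by (subst tr_swap) (simp add: tr_multc)
    then show ?thesis using tr_tr_sym_skew[OF x ric_sym[OF x], of "\<lambda>h c. tcurv h c D E x", OF tcurv_antisym] by simp
  qed
  also have "tr2 x (\<lambda>e c a b. tr x (\<lambda>f h. riem_low e a f c x * tcurv b h D E x)) = 0"
  proof -
    have r: "tr x (\<lambda>e c. riem_low e a f c x) = - ric a f x" for a f
      unfolding ric_tr[OF x] by (subst riem_low_skew[OF x]) (simp add: tr_minus)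
    have "tr2 x (\<lambda>e c a b. tr x (\<lambda>f h. riem_low e a f c x * tcurv b h D E x))
      = tr2 x (\<lambda>a b f h. tr x (\<lambda>e c. riem_low e a f c x * tcurv b h D E x))"
      by (subst tr_swap, subst (2) tr_swap) (rule refl)
    also have "\<dots> = tr2 x (\<lambda>a b f h. ric a f x * tcurv h b D E x)"
    proof -
      have "- (ric a f x * tcurv b h D E x) = ric a f x * tcurv h b D E x" for a b f h
        using tcurv_antisym[of b h D E x] by simp
      then show ?thesis by (simp add: tr_multc r)
    qed
    finally show ?thesis using tr_tr_sym_skew[OF x ric_sym[OF x], of "\<lambda>h c. tcurv h c D E x", OF tcurv_antisym] by simp
  qed
  \<comment> \<open>Contracting both index pairs makes this a sum of brackets of each component with
    its own raised version; relabelling exchanges the two products.\<close>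
  also have "tr2 x (\<lambda>e c a b. end_bracket (\<lambda>F G. tcurv e a F G x) (\<lambda>F G. tcurv b c F G x) D E) = 0"
  proof -
    have m: "end_mult (\<lambda>F G. tcurv c b F G x) (\<lambda>F G. tcurv a e F G x) D E = end_mult (\<lambda>F G. tcurv b c F G x) (\<lambda>F G. tcurv e a F G x) D E" for a b c e
      unfolding end_mult_def by (simp add: tcurv_antisym[of c b] tcurv_antisym[of a e])
    have "tr2 x (\<lambda>e c a b. end_mult (\<lambda>F G. tcurv e a F G x) (\<lambda>F G. tcurv b c F G x) D E)
        = tr2 x (\<lambda>c e b a. end_mult (\<lambda>F G. tcurv e a F G x) (\<lambda>F G. tcurv b c F G x) D E)"
      by (subst tr_sym[OF x], subst (2) tr_sym[OF x]) (rule refl)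
    then show ?thesis unfolding end_bracket_def by (simp add: tr_diff m)
  qed
  finally have "tr2 x (\<lambda>e c a b. N e a b c) = 0" by simp
  then show ?thesis unfolding N_def enab1_delta[OF x sm_tcurv] by (simp add: tr_minus)
qed

section \<open>The Bach tensor\<close>

text \<open>The \<open>m\<close> slot of \<nabla>\<eta>, as \<open>nab_delta_r\<close> is its
  \<open>r\<close> slot. They are named because \<Delta>\<eta> requires them to be differentiated
  again.\<close>

definition nab_delta_m :: "'n \<Rightarrow> 'n \<Rightarrow> 'n \<Rightarrow> 'n \<Rightarrow> 'm \<Rightarrow> real" where
  "nab_delta_m b c d e x = - 2 * nab3 cotton b c d e x - g b e x * bach d c x + g b d x * bach e c x"

definition nab_delta_r :: "'n \<Rightarrow> 'n \<Rightarrow> 'n \<Rightarrow> 'm \<Rightarrow> real" where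
  "nab_delta_r b c d x = - nab2 bach b d c x + 2 * tr x (\<lambda>e f. cotton c d e x * P b f x)"

lemma sm_nab_delta_m [smooth_intros]: "sm (nab_delta_m b c d e)"
  unfolding nab_delta_m_def[abs_def] by (intro smooth_intros)

lemma sm_nab_delta_r [smooth_intros]: "sm (nab_delta_r b c d)"
  unfolding nab_delta_r_def[abs_def] by (intro smooth_intros)

lemma nab_delta:
  assumes x: "x \<in> U"
  shows "enab1 (delta tcurv) b c D E x
    = adj x (\<lambda>d. 2 * cotton c b d x) (\<lambda>d e. nab_delta_m b c d e x) (bach b c x) (\<lambda>d. nab_delta_r b c d x) D E"
proof -
  have m: "nab3 (\<lambda>c d e y. - 2 * cotton c d e y) b c d e x = - 2 * nab3 cotton b c d e x" for d e
    unfolding nab3_def by (simp add: pd_minus[OF x] pd_cmult[OF x] smooth_intros sum_negf sum_distrib_left algebra_simps)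
  have r: "nab2 (\<lambda>c d y. - bach d c y) b c d x = - nab2 bach b d c x" for d
    unfolding nab2_def by (simp add: pd_minus[OF x] smooth_intros sum_negf)
  have t: "tr x (\<lambda>e f. - 2 * cotton c d e x * P b f x) = - 2 * tr x (\<lambda>e f. cotton c d e x * P b f x)" for d
    by (simp only: mult.assoc tr_cmult)
  have "enab1 (delta tcurv) b c D E x
      = enab1 (\<lambda>c D E y. adj y (\<lambda>d. 0) (\<lambda>d e. - 2 * cotton c d e y) 0 (\<lambda>d. - bach d c y) D E) b c D E x"
    by (rule enab1_cong[OF x]) (rule delta_tcurv)
  also have "\<dots> = adj x (\<lambda>d. 2 * cotton c b d x) (\<lambda>d e. nab_delta_m b c d e x) (bach b c x) (\<lambda>d. nab_delta_r b c d x) D E"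
  proof (rule trans[OF enab1_adj[OF x, of "\<lambda>c d y. 0" "\<lambda>c d e y. - 2 * cotton c d e y" "\<lambda>c y. 0"
          "\<lambda>c d y. - bach d c y"]], goal_cases)
    case (5 b c d)
    show ?case using cotton_skew[of b c d x] by simp
  next
    case 6
    show ?case unfolding m r t
      by (rule adj_cong) (simp_all add: nab_delta_m_def nab_delta_r_def nab2_def nab1_def pd_const tr_zero)
  qed (auto intro!: smooth_intros)
  finally show ?thesis .
qed

lemma
  assumes x: "x \<in> U"
  shows bach_tr0: "tr x (\<lambda>a b. bach a b x) = 0"
    and div_cotton_skew: "- 2 * tr x (\<lambda>b c. nab3 cotton b c d e x) - bach d e x + bach e d x = 0"
    and div_bach0: "tr x (\<lambda>b c. nab2 bach b d c x) = 2 * tr2 x (\<lambda>b c e f. cotton c d e x * P b f x)"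
proof -
  note z = adj_eq_zeroD[OF x delta_delta_tcurv[OF x, unfolded nab_delta[OF x] adj_tr]]
  show "tr x (\<lambda>a b. bach a b x) = 0" by (rule z(3))
  show "- 2 * tr x (\<lambda>b c. nab3 cotton b c d e x) - bach d e x + bach e d x = 0"
    using z(2)[of d e] by (simp add: nab_delta_m_def tr_add tr_diff tr_minus tr_cmult tr_g[OF x])
  show "tr x (\<lambda>b c. nab2 bach b d c x) = 2 * tr2 x (\<lambda>b c e f. cotton c d e x * P b f x)"
    using z(4)[of d] by (simp add: nab_delta_r_def tr_add tr_diff tr_minus tr_cmult)
qed

lemma nab3_cotton_cyclic:
  assumes x: "x \<in> U"
  shows "nab3 cotton d a b c x + nab3 cotton d b c a x + nab3 cotton d c a b x = 0"
proof -
  have "pd d (\<lambda>y. cotton a b c y + cotton b c a y + cotton c a b y) x = pd d (\<lambda>y. 0) x"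
    by (rule pd_cong[OF x]) (rule cotton_cyclic)
  then have p: "pd d (cotton a b c) x + pd d (cotton b c a) x + pd d (cotton c a b) x = 0"
    by (simp add: pd_add[OF x] smooth_intros pd_const)
  have "(\<Sum>e\<in>UNIV. chr e d k x * (cotton e l m x + cotton l m e x + cotton m e l x)) = 0" for k l m
    by (simp add: cotton_cyclic[OF x])
  from this[of a b c] this[of b c a] this[of c a b] show ?thesis
    using p unfolding nab3_def by (simp add: distrib_left sum.distrib)
qed

lemma nab3_cotton_skew:
  assumes x: "x \<in> U" shows "nab3 cotton d a b c x = - nab3 cotton d a c b x"
proof -
  have "pd d (cotton a b c) x = pd d (\<lambda>y. - cotton a c b y) x"
    by (rule pd_cong[OF x]) (rule cotton_skew)
  then show ?thesis
    unfolding nab3_def by (simp add: pd_minus[OF x] smooth_intros cotton_skew[of _ b] cotton_skew[of _ _ c] sum_negf)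
qed

text \<open>By the cyclic identity the skew part \<open>bach a b x - bach b a x\<close> equals the
  divergence \<open>X\<close> of Cotton in its first index, while the \<open>m\<close> slot of
  \<delta>\<eta> = 0 says that it equals -2X. Both therefore vanish.\<close>

lemma bach_sym: assumes x: "x \<in> U" shows "bach a b x = bach b a x"
proof -
  define X where "X = tr x (\<lambda>c d. nab3 cotton c d a b x)"
  have C: "tr2 x (\<lambda>c e d f. weyl c a d b x * P e f x) = tr2 x (\<lambda>c e d f. weyl c b d a x * P e f x)"
  proof -
    have "weyl c a d b x * P e f x = weyl d b c a x * P f e x" for c d e f
      using weyl_pair[OF x, of c a d b] P_sym[OF x, of e f] by simp
    then have "tr2 x (\<lambda>c e d f. weyl c a d b x * P e f x) = tr2 x (\<lambda>c e d f. weyl d b c a x * P f e x)"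
      by (intro arg_cong[of _ _ "tr x"] ext)
    also have "\<dots> = tr2 x (\<lambda>d f c e. weyl d b c a x * P f e x)"
      by (rule tr_swap)
    finally show ?thesis .
  qed
  have "tr x (\<lambda>c d. nab3 cotton c a d b x) - tr x (\<lambda>c d. nab3 cotton c b d a x) = X"
    unfolding X_def tr_diff[symmetric]
  proof (intro arg_cong[of _ _ "tr x"] ext)
    fix c d
    show "nab3 cotton c a d b x - nab3 cotton c b d a x = nab3 cotton c d a b x"
      using nab3_cotton_cyclic[OF x, of c a d b] nab3_cotton_skew[OF x, of c b d a]
        nab3_cotton_skew[OF x, of c d a b] nab3_cotton_skew[OF x, of c b a d] by linarith
  qed
  then have "bach a b x - bach b a x = X" unfolding bach_tr[OF x] C by simp
  then show ?thesis using div_cotton_skew[OF x, of a b] unfolding X_def by simp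
qed

lemma nab2_bach_sym: assumes x: "x \<in> U" shows "nab2 bach c a b x = nab2 bach c b a x"
proof -
  have "pd c (bach a b) x = pd c (bach b a) x" by (rule pd_cong[OF x]) (rule bach_sym)
  then show ?thesis unfolding nab2_def by (simp add: bach_sym[OF x, of _ b] bach_sym[OF x, of _ a])
qed

section \<open>A formula for the operator on the tractor curvature\<close>

lemma enab2_add:
  assumes "x \<in> U" "\<And>b c D E. sm (s b c D E)" "\<And>b c D E. sm (t b c D E)"
  shows "enab2 (\<lambda>b c D E y. s b c D E y + t b c D E y) a b c D E x = enab2 s a b c D E x + enab2 t a b c D E x"
  unfolding enab2_def by (simp add: pd_add assms algebra_simps sum.distrib)

lemma enab2_diff:
  assumes "x \<in> U" "\<And>b c D E. sm (s b c D E)" "\<And>b c D E. sm (t b c D E)"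
  shows "enab2 (\<lambda>b c D E y. s b c D E y - t b c D E y) a b c D E x = enab2 s a b c D E x - enab2 t a b c D E x"
  unfolding enab2_def by (simp add: pd_diff assms algebra_simps sum_subtractf)

lemma enab2_cmult:
  assumes "x \<in> U" "\<And>b c D E. sm (s b c D E)"
  shows "enab2 (\<lambda>b c D E y. k * s b c D E y) a b c D E x = k * enab2 s a b c D E x"
  using enab2_scale[OF assms(1) sm_const assms(2), of k] by (simp add: pd_const)

lemma P_hash_tr:
  assumes x: "x \<in> U"
  shows "P_hash \<omega> b c D E x = tr x (\<lambda>e f. P b e x * \<omega> f c D E x) + tr x (\<lambda>e f. P c e x * \<omega> b f D E x)"
proof -
  have "tr x (\<lambda>d e. \<omega> d c D E x * P b e x) = tr x (\<lambda>e f. P b e x * \<omega> f c D E x)"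
    "tr x (\<lambda>d e. \<omega> b d D E x * P c e x) = tr x (\<lambda>e f. P c e x * \<omega> b f D E x)"
    by (subst tr_sym[OF x], simp add: mult.commute)+
  then show ?thesis unfolding P_hash_def P_mix_up sum_up by simp
qed

lemma sm_P_hash [smooth_intros]: "(\<And>b c D E. sm (T b c D E)) \<Longrightarrow> sm (P_hash T a b D E)"
  unfolding P_hash_def[abs_def] by (intro smooth_intros)

lemma form_bracket_end_bracket:
  "form_bracket \<eta> \<omega> c D E x = - tr x (\<lambda>a b. end_bracket (\<lambda>F G. \<omega> a c F G x) (\<lambda>F G. \<eta> b F G x) D E)"
  unfolding form_bracket_def tr_def end_bracket_def end_mult_def
  by (simp add: sum_subtractf sum_negf algebra_simps)

lemma ric_contract:
  assumes x: "x \<in> U"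
  shows "tr2 x (\<lambda>a b f h. riem_low a c f b x * v h) = - 4 * tr x (\<lambda>f h. P c f x * v h) - J x * v c"
proof -
  have "tr x (\<lambda>a b. riem_low a c f b x) = - ric c f x" for f
    unfolding ric_tr[OF x] by (subst riem_low_skew[OF x]) (simp add: tr_minus)
  then have "tr2 x (\<lambda>a b f h. riem_low a c f b x * v h) = - tr x (\<lambda>f h. ric c f x * v h)"
    by (subst tr_swap) (simp add: tr_multc tr_minus)
  also have "tr x (\<lambda>f h. ric c f x * v h) = 4 * tr x (\<lambda>f h. P c f x * v h) + J x * v c"
    unfolding ric_P[OF x] by (simp add: distrib_right tr_add mult.assoc tr_cmult tr_g[OF x])
  finally show ?thesis by simp
qed

text \<open>After the derivatives are commuted the contraction falls on \<delta>\<eta> = 0. What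
  remains is the Ricci tensor 4P + Jg on the form index and a bracket on the tractor
  indices.\<close>

lemma div_enab1_swap:
  assumes x: "x \<in> U"
  defines "\<eta> \<equiv> delta tcurv"
  shows "tr x (\<lambda>a b. enab2 (enab1 \<eta>) a c b D E x)
    = 4 * tr x (\<lambda>e f. P c e x * \<eta> f D E x) + J x * \<eta> c D E x
      + tr x (\<lambda>a b. end_bracket (\<lambda>F G. tcurv a c F G x) (\<lambda>F G. \<eta> b F G x) D E)"
proof -
  have s: "sm (\<eta> c D E)" for c D E unfolding \<eta>_def by (intro smooth_intros)
  have z: "tr x (\<lambda>a b. enab2 (enab1 \<eta>) c a b D E x) = 0"
  proof -
    have "tr x (\<lambda>a b. enab2 (enab1 \<eta>) c a b D E x) = enab0 (\<lambda>D E y. tr y (\<lambda>a b. enab1 \<eta> a b D E y)) c D E x"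
      by (rule enab0_tr[OF x, symmetric]) (intro smooth_intros s)
    also have "\<dots> = enab0 (\<lambda>D E y. 0) c D E x"
      by (rule enab0_cong[OF x]) (simp add: \<eta>_def delta_delta_tcurv)
    finally show ?thesis by (simp add: enab0_def pd_const)
  qed
  have c: "enab2 (enab1 \<eta>) a c b D E x = enab2 (enab1 \<eta>) c a b D E x - tr x (\<lambda>f h. riem_low a c f b x * \<eta> h D E x)
      + end_bracket (\<lambda>F G. tcurv a c F G x) (\<lambda>F G. \<eta> b F G x) D E" for a b
    using enab1_commutator[OF x, of \<eta> a c b D E, OF s] unfolding riem_sum[OF x] by simp
  show ?thesis
    unfolding c by (simp add: tr_add tr_diff z ric_contract[OF x])
qed

lemma div_P_hash:
  assumes x: "x \<in> U"
  shows "tr x (\<lambda>a b. enab2 (P_hash tcurv) a b c D E x)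
    = tr x (\<lambda>a b. pd a J x * tcurv b c D E x)
      + tr2 x (\<lambda>a b e f. P b e x * enab2 tcurv a f c D E x)
      + 1/2 * tr2 x (\<lambda>a b e f. cotton c a e x * tcurv b f D E x)
      - tr x (\<lambda>e f. P c e x * delta tcurv f D E x)"
proof -
  have "enab2 (P_hash tcurv) a b c D E x
      = enab2 (\<lambda>b c D E y. tr y (\<lambda>e f. P b e y * tcurv f c D E y) + tr y (\<lambda>e f. P c e y * tcurv b f D E y)) a b c D E x" for a b
    by (rule enab2_cong[OF x]) (rule P_hash_tr)
  also have "\<dots> a b = tr x (\<lambda>e f. nab2 P a b e x * tcurv f c D E x) + tr x (\<lambda>e f. P b e x * enab2 tcurv a f c D E x)
      + tr x (\<lambda>e f. nab2 P a c e x * tcurv b f D E x) + tr x (\<lambda>e f. P c e x * enab2 tcurv a b f D E x)" for a b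
    by (subst enab2_add[OF x]) (auto intro!: smooth_intros simp: enab2_tr_mult_left[OF x] enab2_tr_mult_right[OF x] smooth_intros tr_add)
  finally have e: "enab2 (P_hash tcurv) a b c D E x = tr x (\<lambda>e f. nab2 P a b e x * tcurv f c D E x) + tr x (\<lambda>e f. P b e x * enab2 tcurv a f c D E x)
      + tr x (\<lambda>e f. nab2 P a c e x * tcurv b f D E x) + tr x (\<lambda>e f. P c e x * enab2 tcurv a b f D E x)" for a b .
  have 1: "tr2 x (\<lambda>a b e f. nab2 P a b e x * tcurv f c D E x) = tr x (\<lambda>a b. pd a J x * tcurv b c D E x)"
    by (subst tr_swap) (simp add: tr_multc div_P[OF x])
  have 2: "tr2 x (\<lambda>a b e f. P c e x * enab2 tcurv a b f D E x) = - tr x (\<lambda>e f. P c e x * delta tcurv f D E x)"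
    unfolding delta_tr by (subst tr_swap) (simp add: tr_cmult tr_minus)
  \<comment> \<open>The skew curvature sees only the part of the derivative of \<open>P\<close> that
    is skew in \<open>a\<close> and \<open>e\<close>, which is half the Cotton tensor.\<close>
  have 3: "tr2 x (\<lambda>a b e f. nab2 P a c e x * tcurv b f D E x)
    = 1/2 * tr2 x (\<lambda>a b e f. cotton c a e x * tcurv b f D E x)"
  proof -
    have "tr2 x (\<lambda>a b e f. nab2 P e c a x * tcurv b f D E x)
        = tr2 x (\<lambda>e f a b. nab2 P e c a x * tcurv b f D E x)"
      by (rule tr_swap)
    also have "\<dots> = tr2 x (\<lambda>e f a b. - (nab2 P e c a x * tcurv f b D E x))"
      by (subst tcurv_antisym) simp
    finally have "tr2 x (\<lambda>a b e f. nab2 P e c a x * tcurv b f D E x)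
        = - tr2 x (\<lambda>a b e f. nab2 P a c e x * tcurv b f D E x)" by (simp add: tr_minus)
    then show ?thesis
      unfolding cotton_def by (simp add: left_diff_distrib tr_diff nab2_P_sym[OF x, of _ _ c])
  qed
  show ?thesis unfolding e by (simp add: tr_add 1 2 3)
qed

text \<open>The products of \<open>P\<close> with \<eta> cancel between the Ricci term and
  \<open>P_hash\<close>. The remaining coefficients are 3 = 2 + 1 for J, from \<open>Q2\<close> and
  Ricci, 2 = 4 - 2 for the derivative of J, and 2 for the bracket, once from commuting and once from
  \<open>form_bracket\<close>.\<close>

lemma frakD_tcurv:
  assumes x: "x \<in> U"
  defines "\<eta> \<equiv> delta tcurv"
  shows "frakD tcurv c D E x
    = - tr x (\<lambda>a b. enab2 (enab1 \<eta>) a b c D E x) + 3 * (J x * \<eta> c D E x)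
      + 2 * tr x (\<lambda>a b. pd a J x * tcurv b c D E x)
      + 4 * tr2 x (\<lambda>a b e f. P b e x * enab2 tcurv a f c D E x)
      + 2 * tr2 x (\<lambda>a b e f. cotton c a e x * tcurv b f D E x)
      + 2 * tr x (\<lambda>a b. end_bracket (\<lambda>F G. tcurv a c F G x) (\<lambda>F G. \<eta> b F G x) D E)"
proof -
  have s: "sm (\<eta> c D E)" for c D E unfolding \<eta>_def by (intro smooth_intros)
  have q: "Q2 tcurv = (\<lambda>b c D E y. (enab1 \<eta> b c D E y - enab1 \<eta> c b D E y) - 4 * P_hash tcurv b c D E y + 2 * (J y * tcurv b c D E y))"
    by (intro ext) (simp add: Q2_def ext_d_def \<eta>_def)
  have "enab2 (Q2 tcurv) a b c D E x = enab2 (enab1 \<eta>) a b c D E x - enab2 (enab1 \<eta>) a c b D E x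
     - 4 * enab2 (P_hash tcurv) a b c D E x + 2 * (pd a J x * tcurv b c D E x + J x * enab2 tcurv a b c D E x)" for a b
  proof -
    have "enab2 (Q2 tcurv) a b c D E x
      = enab2 (\<lambda>b c D E y. enab1 \<eta> b c D E y) a b c D E x - enab2 (\<lambda>b c D E y. enab1 \<eta> c b D E y) a b c D E x
        - 4 * enab2 (P_hash tcurv) a b c D E x + 2 * enab2 (\<lambda>b c D E y. J y * tcurv b c D E y) a b c D E x"
      unfolding q
      by (simp add: enab2_add enab2_diff enab2_cmult x s smooth_intros)
    then show ?thesis
      unfolding enab2_transpose[of "enab1 \<eta>"] enab2_scale[OF x sm_J sm_tcurv] by simp
  qed
  then have "delta (Q2 tcurv) c D E x = - tr x (\<lambda>a b. enab2 (enab1 \<eta>) a b c D E x)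
      + tr x (\<lambda>a b. enab2 (enab1 \<eta>) a c b D E x) + 4 * tr x (\<lambda>a b. enab2 (P_hash tcurv) a b c D E x)
      - 2 * tr x (\<lambda>a b. pd a J x * tcurv b c D E x) + 2 * (J x * \<eta> c D E x)"
    by (simp add: \<eta>_def delta_tr tr_add tr_diff tr_cmult)
  then show ?thesis
    unfolding frakD_def form_bracket_end_bracket div_P_hash[OF x]
    using div_enab1_swap[OF x, of c D E] by (simp add: \<eta>_def)
qed

section \<open>The Laplacian of the Cotton tensor\<close>

definition lap_cotton :: "'n \<Rightarrow> 'n \<Rightarrow> 'n \<Rightarrow> 'm \<Rightarrow> real" where
  "lap_cotton a b c x = tr x (\<lambda>d e. nab4 (nab3 cotton) d e a b c x)"

definition P_cotton :: "'n \<Rightarrow> 'n \<Rightarrow> 'n \<Rightarrow> 'm \<Rightarrow> real" where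
  "P_cotton a b c x = tr x (\<lambda>e f. P a e x * cotton c f b x)"

lemma P_cotton_right: "x \<in> U \<Longrightarrow> tr x (\<lambda>e f. cotton c b e x * P a f x) = - P_cotton a b c x"
  unfolding P_cotton_def by (subst cotton_skew, subst tr_sym) (simp_all add: tr_minus mult.commute)

text \<open>The entry at \<open>tZ e\<close>, \<open>tY\<close> is the \<open>r\<close> slot. The
  derivative of Weyl contracted with \<open>P\<close> counts twice: the second differentiation meets
  it in the \<open>r\<close> slot of \<nabla>\<Omega>, and once more through the \<open>m\<close>
  slot.\<close>

lemma r_slot_lap_tcurv:
  assumes x: "x \<in> U"
  shows "tr x (\<lambda>d a. enab3 (enab2 tcurv) d a b c (tZ e) tY x)
    = lap_cotton e b c x - 2 * tr2 x (\<lambda>d a k l. nab4 weyl d b c e k x * P a l x)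
      - tr x (\<lambda>k l. weyl b c e k x * pd l J x) - J x * cotton e b c x"
proof -
  let ?r = "\<lambda>a b c d y. nab3 cotton a d b c y - tr y (\<lambda>e f. weyl b c d e y * P a f y)"
  let ?m = "\<lambda>a b c d e y. nab4 weyl a b c d e y + g a e y * cotton d b c y - g a d y * cotton e b c y"
  have "enab3 (enab2 tcurv) d a b c (tZ e) tY x
      = enab3 (\<lambda>a b c D E y. adj y (\<lambda>e. - weyl b c a e y) (\<lambda>d e. ?m a b c d e y) (- cotton a b c y) (\<lambda>d. ?r a b c d y) D E)
          d a b c (tZ e) tY x" for d a
    by (rule enab3_cong[OF x]) (rule nab_tcurv)
  also have "\<dots> d a = nab4 ?r d a b c e x + P d e x * - cotton a b c x - tr x (\<lambda>k l. ?m a b c e k x * P d l x)" for d a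
  proof (subst enab3_adj[OF x, of "\<lambda>a b c e y. - weyl b c a e y" ?m "\<lambda>a b c y. - cotton a b c y" ?r])
    show "?m b b' b'' c d x = - ?m b b' b'' d c x" for b b' b'' c d
      using nab4_skew34[OF x, of b b' b'' c d] by simp
  qed (auto intro!: smooth_intros)
  also have "nab4 ?r d a b c e x = nab4 (nab3 cotton) d a e b c x
      - tr x (\<lambda>k l. nab4 weyl d b c e k x * P a l x + weyl b c e k x * nab2 P d a l x)" for d a
  proof -
    have "nab4 ?r d a b c e x = nab4 (nab3 cotton) d a e b c x
      - nab4 (\<lambda>a b c d y. tr y (\<lambda>e f. weyl b c d e y * P a f y)) d a b c e x"
      unfolding nab4_def by (simp add: pd_diff[OF x] smooth_intros algebra_simps sum_subtractf)
    then show ?thesis using nab4_tr_mult[OF x, of weyl P d a b c e] by (simp add: smooth_intros)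
  qed
  finally have 1: "enab3 (enab2 tcurv) d a b c (tZ e) tY x = nab4 (nab3 cotton) d a e b c x
      - tr x (\<lambda>k l. nab4 weyl d b c e k x * P a l x + weyl b c e k x * nab2 P d a l x)
      + P d e x * - cotton a b c x - tr x (\<lambda>k l. ?m a b c e k x * P d l x)" for d a .
  have 2: "tr2 x (\<lambda>d a k l. weyl b c e k x * nab2 P d a l x) = tr x (\<lambda>k l. weyl b c e k x * pd l J x)"
    by (subst tr_swap) (simp add: tr_cmult div_P[OF x])
  have 3: "tr2 x (\<lambda>d a k l. nab4 weyl a b c e k x * P d l x) = tr2 x (\<lambda>d a k l. nab4 weyl d b c e k x * P a l x)"
    by (rule tr_sym[OF x])
  have 4: "tr2 x (\<lambda>d a k l. g a k x * (cotton e b c x * P d l x)) = J x * cotton e b c x"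
    by (subst tr_swap) (simp add: tr_g[OF x] tr_cmult J_tr)
  have 5: "tr2 x (\<lambda>d a k l. g a e x * (cotton k b c x * P d l x)) = tr x (\<lambda>d a. P d e x * cotton a b c x)"
  proof -
    have "tr2 x (\<lambda>d a k l. g a e x * (cotton k b c x * P d l x)) = tr x (\<lambda>k l. cotton k b c x * P e l x)"
      by (subst tr_swap) (simp add: tr_g[OF x])
    also have "\<dots> = tr x (\<lambda>d a. P d e x * cotton a b c x)"
      by (subst tr_sym[OF x]) (simp add: P_sym[OF x, of e] mult.commute)
    finally show ?thesis .
  qed
  show ?thesis
    unfolding 1 lap_cotton_def
    by (simp add: tr_add tr_diff tr_minus left_diff_distrib distrib_right mult.assoc 2 3 4 5)
qed

lemma enab3_bianchi:
  assumes x: "x \<in> U"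
  shows "enab3 (enab2 tcurv) c d a b D E x + enab3 (enab2 tcurv) c a b d D E x + enab3 (enab2 tcurv) c b d a D E x = 0"
proof -
  have e0: "enab0 (enab2 tcurv d a b) c D E x + enab0 (enab2 tcurv a b d) c D E x + enab0 (enab2 tcurv b d a) c D E x = 0"
  proof -
    have "enab0 (\<lambda>D E y. enab2 tcurv d a b D E y + enab2 tcurv a b d D E y + enab2 tcurv b d a D E y) c D E x
        = enab0 (\<lambda>D E y. 0) c D E x"
      by (rule enab0_cong[OF x]) (rule tcurv_bianchi)
    then show ?thesis
      by (simp add: enab0_def pd_add[OF x] smooth_intros pd_const distrib_left distrib_right sum.distrib)
  qed
  have s: "(\<Sum>f\<in>UNIV. chr f c k x * (enab2 tcurv f l m D E x + enab2 tcurv l m f D E x + enab2 tcurv m f l D E x)) = 0" for k l m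
    by (simp add: tcurv_bianchi[OF x])
  show ?thesis
    unfolding enab3_def using e0 s[of d a b] s[of a b d] s[of b d a]
    by (simp add: distrib_left sum.distrib)
qed

text \<open>The Bianchi identity moves the index of the inner derivative onto \<Omega>. Commuting
  the derivatives then puts the contraction on \<Omega>, which gives derivatives of \<eta>, a Ricci
  term for each of \<open>a\<close> and \<open>b\<close>, and brackets.\<close>

lemma weitzenboeck_tcurv:
  assumes x: "x \<in> U"
  defines "\<eta> \<equiv> delta tcurv"
  shows "tr x (\<lambda>c d. enab3 (enab2 tcurv) c d a b D E x)
    = - enab1 \<eta> a b D E x + enab1 \<eta> b a D E x
      + 4 * tr x (\<lambda>e f. P a e x * tcurv f b D E x) - 4 * tr x (\<lambda>e f. P b e x * tcurv f a D E x)
      + 2 * (J x * tcurv a b D E x)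
      - tr2 x (\<lambda>c d e f. riem_low c a e b x * tcurv d f D E x)
      + tr2 x (\<lambda>c d e f. riem_low c b e a x * tcurv d f D E x)
      + tr x (\<lambda>c d. end_bracket (\<lambda>F G. tcurv c a F G x) (\<lambda>F G. tcurv d b F G x) D E)
      - tr x (\<lambda>c d. end_bracket (\<lambda>F G. tcurv c b F G x) (\<lambda>F G. tcurv d a F G x) D E)"
proof -
  have "tr x (\<lambda>c d. enab3 (enab2 tcurv) c a d b D E x)
    = - enab1 \<eta> a b D E x + 4 * tr x (\<lambda>e f. P a e x * tcurv f b D E x) + J x * tcurv a b D E x
      - tr2 x (\<lambda>c d e f. riem_low c a e b x * tcurv d f D E x)
      + tr x (\<lambda>c d. end_bracket (\<lambda>F G. tcurv c a F G x) (\<lambda>F G. tcurv d b F G x) D E)" for a b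
  proof -
    have c: "enab3 (enab2 tcurv) c a d b D E x = enab3 (enab2 tcurv) a c d b D E x
       - tr x (\<lambda>e f. riem_low c a e d x * tcurv f b D E x) - tr x (\<lambda>e f. riem_low c a e b x * tcurv d f D E x)
       + end_bracket (\<lambda>F G. tcurv c a F G x) (\<lambda>F G. tcurv d b F G x) D E" for c d
      using enab2_commutator[OF x, of tcurv c a d b D E, OF sm_tcurv] unfolding riem_sum[OF x] by simp
    have e: "tr x (\<lambda>c d. enab3 (enab2 tcurv) a c d b D E x) = - enab1 \<eta> a b D E x"
      unfolding \<eta>_def by (simp add: enab1_delta[OF x] smooth_intros)
    show ?thesis
      unfolding c by (simp add: tr_add tr_diff e ric_contract[OF x])
  qed
  note h = this
  have "enab3 (enab2 tcurv) c d a b D E x = enab3 (enab2 tcurv) c a d b D E x - enab3 (enab2 tcurv) c b d a D E x" for c d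
    using enab3_bianchi[OF x, of c d a b D E] enab3_tcurv_skew[OF x, of c a b d D E] by simp
  then show ?thesis
    using tcurv_antisym[of b a D E x] by (simp add: tr_diff h)
qed

lemma end_bracket_tcurv:
  assumes x: "x \<in> U"
  shows "end_bracket (\<lambda>F G. tcurv a b F G x) (\<lambda>F G. tcurv c d F G x) D E
    = adj x (\<lambda>k. 0) (\<lambda>k l. tr x (\<lambda>e f. weyl a b k e x * weyl c d f l x) - tr x (\<lambda>e f. weyl c d k e x * weyl a b f l x)) 0
        (\<lambda>k. tr x (\<lambda>e f. weyl a b k e x * cotton f c d x) - tr x (\<lambda>e f. weyl c d k e x * cotton f a b x)) D E"
proof -
  have t: "(\<lambda>F G. tcurv a b F G x) = adj x (\<lambda>k. 0) (\<lambda>k l. weyl a b k l x) 0 (\<lambda>k. cotton k a b x)" for a b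
    by (intro ext) (rule tcurv_adj[OF x])
  show ?thesis unfolding t by (rule end_bracket_adj[OF x]) (rule weyl_skew34[OF x])+
qed

text \<open>Splits Riemann into Weyl and products of \<open>P\<close> with \<open>g\<close>. Two of
  the four products contract a symmetric tensor with the skew pair of Cotton and vanish.\<close>

lemma riem_cotton_contract:
  assumes x: "x \<in> U"
  shows "tr2 x (\<lambda>c d e f. riem_low c a e b x * cotton k d f x)
    = tr2 x (\<lambda>c d e f. weyl c a e b x * cotton k d f x) + P_cotton a b k x - P_cotton b a k x"
proof -
  have R: "riem_low c a e b x = weyl c a e b x - g e a x * P c b x + g e c x * P a b x - g b c x * P a e x + g b a x * P c e x" for c e
    by (simp add: weyl_def)
  have 1: "tr2 x (\<lambda>c d e f. g e a x * (P c b x * cotton k d f x)) = P_cotton b a k x"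
    unfolding P_cotton_def by (simp add: tr_g[OF x] P_sym[OF x, of _ b])
  have 2: "tr2 x (\<lambda>c d e f. g e c x * (P a b x * cotton k d f x)) = 0"
  proof -
    have "tr x (\<lambda>c d. cotton k d c x) = - tr x (\<lambda>c d. cotton k c d x)"
      by (subst cotton_skew) (simp add: tr_minus)
    moreover have "tr x (\<lambda>c d. cotton k d c x) = tr x (\<lambda>c d. cotton k c d x)" by (rule tr_sym[OF x])
    ultimately have "tr x (\<lambda>c d. cotton k d c x) = 0" by simp
    then show ?thesis by (simp add: tr_g[OF x] tr_cmult)
  qed
  have 3: "tr2 x (\<lambda>c d e f. g b c x * (P a e x * cotton k d f x)) = - P_cotton a b k x"
  proof -
    have "tr2 x (\<lambda>c d e f. g b c x * (P a e x * cotton k d f x)) = tr x (\<lambda>e f. P a e x * cotton k b f x)"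
      by (subst tr_swap) (simp add: tr_g[OF x])
    then show ?thesis unfolding P_cotton_def by (subst (asm) cotton_skew) (simp add: tr_minus)
  qed
  have 4: "tr2 x (\<lambda>c d e f. g b a x * (P c e x * cotton k d f x)) = 0"
  proof -
    have "tr2 x (\<lambda>c d e f. P e c x * cotton k f d x) = 0"
    proof -
      have "tr2 x (\<lambda>c d e f. P e c x * cotton k f d x) = tr2 x (\<lambda>e f c d. P e c x * cotton k f d x)"
        by (rule tr_swap)
      also have "\<dots> = tr2 x (\<lambda>e f c d. - (P c e x * cotton k d f x))"
      proof (intro arg_cong[of _ _ "tr x"] ext)
        fix e f c d
        show "P e c x * cotton k f d x = - (P c e x * cotton k d f x)"
          using P_sym[OF x, of e c] cotton_skew[of k f d x] by simp
      qed
      finally show ?thesis by (simp add: tr_minus)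
    qed
    moreover have "tr2 x (\<lambda>c d e f. P c e x * cotton k d f x) = - tr2 x (\<lambda>c d e f. P e c x * cotton k f d x)"
      unfolding tr_minus[symmetric]
    proof (intro arg_cong[of _ _ "tr x"] ext)
      fix e f c d
      show "P c e x * cotton k d f x = - (P e c x * cotton k f d x)"
        using P_sym[OF x, of e c] cotton_skew[of k f d x] by simp
    qed
    ultimately show ?thesis by (simp add: tr_cmult)
  qed
  show ?thesis
    unfolding R by (simp add: left_diff_distrib distrib_right mult.assoc tr_add tr_diff 1 2 3 4)
qed

text \<open>Two expressions for the \<open>r\<close> slot of \<Delta>\<Omega> are compared,
  \<open>r_slot_lap_tcurv\<close> and \<open>weitzenboeck_tcurv\<close>, and solved for the
  Laplacian of Cotton.\<close>

lemma lap_cotton_eq: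
  assumes x: "x \<in> U"
  shows "lap_cotton k a b x
    = 2 * tr2 x (\<lambda>c d e f. nab4 weyl c a b k e x * P d f x) + tr x (\<lambda>e f. weyl a b k e x * pd f J x)
      + 3 * (J x * cotton k a b x) + nab2 bach a k b x - nab2 bach b k a x
      + 2 * P_cotton a k b x - 2 * P_cotton b k a x + 2 * P_cotton a b k x - 2 * P_cotton b a k x
      - tr2 x (\<lambda>c d e f. weyl c a e b x * cotton k d f x)
      + tr2 x (\<lambda>c d e f. weyl c b e a x * cotton k d f x)
      + 2 * tr2 x (\<lambda>c d e f. weyl c a k e x * cotton f d b x)
      - 2 * tr2 x (\<lambda>c d e f. weyl c b k e x * cotton f d a x)"
proof -
  have t: "tcurv a b (tZ k) tY x = cotton k a b x" for a b
    by (simp add: tcurv_adj[OF x])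
  have e: "enab1 (delta tcurv) a b (tZ k) tY x = - nab2 bach a k b x - 2 * P_cotton a k b x" for a b
    by (simp add: nab_delta[OF x] nab_delta_r_def P_cotton_right[OF x])
  have b: "tr x (\<lambda>c d. end_bracket (\<lambda>F G. tcurv c a F G x) (\<lambda>F G. tcurv d b F G x) (tZ k) tY)
      = tr2 x (\<lambda>c d e f. weyl c a k e x * cotton f d b x) - tr2 x (\<lambda>c d e f. weyl c b k e x * cotton f d a x)" for a b
    using tr_sym[OF x, of "\<lambda>c d. tr x (\<lambda>e f. weyl d b k e x * cotton f c a x)"]
    by (simp add: end_bracket_tcurv[OF x] tr_diff)
  have PAe: "tr x (\<lambda>e f. P a e x * cotton k f b x) = P_cotton a b k x" for a b
    by (simp add: P_cotton_def)
  show ?thesis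
    using weitzenboeck_tcurv[OF x, of a b "tZ k" tY]
    unfolding r_slot_lap_tcurv[OF x] e b t riem_cotton_contract[OF x] PAe by simp
qed

section \<open>The slots of the second derivative of the divergence\<close>

lemma nab4_nab_delta_m:
  assumes x: "x \<in> U"
  shows "nab4 nab_delta_m a b c d e x = - 2 * nab4 (nab3 cotton) a b c d e x - g b e x * nab2 bach a d c x + g b d x * nab2 bach a e c x"
proof -
  have "nab4 nab_delta_m a b c d e x = - 2 * nab4 (nab3 cotton) a b c d e x
      - nab4 (\<lambda>b c d e y. g b e y * bach d c y) a b c d e x + nab4 (\<lambda>b c d e y. g b d y * bach e c y) a b c d e x"
    unfolding nab4_def nab_delta_m_def[abs_def]
    by (simp add: pd_add[OF x] pd_diff[OF x] pd_minus[OF x] pd_cmult[OF x] smooth_intros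
        distrib_left right_diff_distrib sum.distrib sum_subtractf sum_negf sum_distrib_left algebra_simps)
  then show ?thesis by (simp add: nab4_g_mult[OF x] smooth_intros)
qed

lemma nab3_nab_delta_r:
  assumes x: "x \<in> U"
  shows "nab3 nab_delta_r a b c d x = - nab3 (nab2 bach) a b d c x
     + 2 * tr x (\<lambda>e f. nab3 cotton a c d e x * P b f x + cotton c d e x * nab2 P a b f x)"
proof -
  have "nab3 nab_delta_r a b c d x = - nab3 (nab2 bach) a b d c x
      + 2 * nab3 (\<lambda>b c d y. tr y (\<lambda>e f. cotton c d e y * P b f y)) a b c d x"
    unfolding nab3_def nab_delta_r_def[abs_def]
    by (simp add: pd_add[OF x] pd_diff[OF x] pd_minus[OF x] pd_cmult[OF x] smooth_intros
        distrib_left right_diff_distrib sum.distrib sum_subtractf sum_negf sum_distrib_left algebra_simps)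
  then show ?thesis using nab3_tr_mult[OF x, of cotton P a b c d] by (simp add: smooth_intros)
qed

lemma nab2_delta:
  assumes x: "x \<in> U"
  shows "enab2 (enab1 (delta tcurv)) a b c D E x = adj x
      (\<lambda>d. 2 * nab3 cotton a c b d x - nab_delta_m b c a d x + bach b c x * g a d x)
      (\<lambda>d e. nab4 nab_delta_m a b c d e x + P a d x * (2 * cotton c b e x) - P a e x * (2 * cotton c b d x)
        + g a e x * nab_delta_r b c d x - g a d x * nab_delta_r b c e x)
      (nab2 bach a b c x - nab_delta_r b c a x - tr x (\<lambda>d e. P a d x * (2 * cotton c b e x)))
      (\<lambda>d. nab3 nab_delta_r a b c d x + P a d x * bach b c x - tr x (\<lambda>e f. nab_delta_m b c d e x * P a f x)) D E"
proof -
  have "enab2 (enab1 (delta tcurv)) a b c D E x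
      = enab2 (\<lambda>b c D E y. adj y (\<lambda>d. 2 * cotton c b d y) (\<lambda>d e. nab_delta_m b c d e y) (bach b c y) (\<lambda>d. nab_delta_r b c d y) D E) a b c D E x"
    by (rule enab2_cong[OF x]) (rule nab_delta)
  also have "\<dots> = adj x
      (\<lambda>d. nab3 (\<lambda>b c d y. 2 * cotton c b d y) a b c d x - nab_delta_m b c a d x + bach b c x * g a d x)
      (\<lambda>d e. nab4 nab_delta_m a b c d e x + P a d x * (2 * cotton c b e x) - P a e x * (2 * cotton c b d x)
        + g a e x * nab_delta_r b c d x - g a d x * nab_delta_r b c e x)
      (nab2 bach a b c x - nab_delta_r b c a x - tr x (\<lambda>d e. P a d x * (2 * cotton c b e x)))
      (\<lambda>d. nab3 nab_delta_r a b c d x + P a d x * bach b c x - tr x (\<lambda>e f. nab_delta_m b c d e x * P a f x)) D E"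
  proof (rule enab2_adj[OF x])
    show "nab_delta_m b c d e x = - nab_delta_m b c e d x" for b c d e
      unfolding nab_delta_m_def using nab3_cotton_skew[OF x, of b c d e] by simp
  qed (auto intro!: smooth_intros)
  finally have e: "enab2 (enab1 (delta tcurv)) a b c D E x = \<dots>" .
  have "nab3 (\<lambda>b c d y. 2 * cotton c b d y) a b c d x = 2 * nab3 cotton a c b d x" for d
    unfolding nab3_def by (simp add: pd_cmult[OF x] smooth_intros sum_distrib_left algebra_simps)
  with e show ?thesis by simp
qed

text \<open>Both the differentiated \<open>w\<close> slot and the \<open>m\<close> slot of
  \<nabla>\<eta> contribute twice the divergence of Cotton. The Bach terms add up to 1 - 6 + 1 = -4,
  where 6 is the trace of \<open>g\<close>.\<close>

lemma lap_delta_w: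
  assumes x: "x \<in> U"
  shows "tr x (\<lambda>a b. 2 * nab3 cotton a c b d x - nab_delta_m b c a d x + bach b c x * g a d x)
    = 4 * tr x (\<lambda>a b. nab3 cotton a c b d x) - 4 * bach d c x"
proof -
  have "tr x (\<lambda>a b. nab3 cotton b c a d x) = tr x (\<lambda>a b. nab3 cotton a c b d x)"
    by (rule tr_sym[OF x])
  then show ?thesis
    unfolding nab_delta_m_def
    by (simp add: tr_add tr_diff tr_minus tr_cmult tr_multc tr_g[OF x] tr_gtrace[OF x] dim mult.assoc)
qed

text \<open>The value of the divergence of the Bach tensor, as found from the \<open>r\<close> slot
  of \<delta>\<eta> = 0.\<close>

definition div_bach :: "'n \<Rightarrow> 'm \<Rightarrow> real" where
  "div_bach c x = 2 * tr2 x (\<lambda>a b e f. cotton b c e x * P a f x)"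

lemma div_bach:
  assumes x: "x \<in> U"
  shows "tr x (\<lambda>a b. nab2 bach a b c x) = div_bach c x" "tr x (\<lambda>a b. nab2 bach b a c x) = div_bach c x"
proof -
  show 1: "tr x (\<lambda>a b. nab2 bach a b c x) = div_bach c x"
    using div_bach0[OF x, of c] unfolding div_bach_def by (simp add: nab2_bach_sym[OF x, of _ c])
  show "tr x (\<lambda>a b. nab2 bach b a c x) = div_bach c x"
    using 1 by (subst tr_sym[OF x])
qed

text \<open>The divergence of Bach arises from the \<open>f\<close> slot and again from the
  \<open>r\<close> slot of \<nabla>\<eta>; the other contractions pair the symmetric
  \<open>P\<close> with the skew indices of Cotton.\<close>

lemma lap_delta_f:
  assumes x: "x \<in> U"
  shows "tr x (\<lambda>a b. nab2 bach a b c x - nab_delta_r b c a x - tr x (\<lambda>d e. P a d x * (2 * cotton c b e x))) = 2 * div_bach c x"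
proof -
  have z: "tr2 x (\<lambda>a b e f. P e a x * cotton c f b x) = 0"
  proof -
    have "tr2 x (\<lambda>a b e f. P e a x * cotton c f b x) = tr2 x (\<lambda>e f a b. P e a x * cotton c f b x)"
      by (rule tr_swap)
    also have "\<dots> = tr2 x (\<lambda>e f a b. - (P a e x * cotton c b f x))"
    proof (intro arg_cong[of _ _ "tr x"] ext)
      fix e f a b
      show "P e a x * cotton c f b x = - (P a e x * cotton c b f x)"
        using P_sym[OF x, of e a] cotton_skew[of c f b x] by simp
    qed
    finally show ?thesis by (simp add: tr_minus)
  qed
  have 1: "tr2 x (\<lambda>a b d e. P a d x * (2 * cotton c b e x)) = 0"
  proof -
    have "tr2 x (\<lambda>a b d e. P a d x * (2 * cotton c b e x)) = tr2 x (\<lambda>a b d e. (- 2) * (P d a x * cotton c e b x))"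
    proof (intro arg_cong[of _ _ "tr x"] ext)
      fix a b d e
      show "P a d x * (2 * cotton c b e x) = (- 2) * (P d a x * cotton c e b x)"
        using P_sym[OF x, of a d] cotton_skew[of c b e x] by simp
    qed
    then show ?thesis by (simp only: tr_cmult z)
  qed
  have 2: "tr2 x (\<lambda>a b e f. cotton c a e x * P b f x) = 0"
  proof -
    have "tr x (\<lambda>e f. cotton c a e x * P b f x) = tr x (\<lambda>e f. P e b x * cotton c a f x)" for a b
      by (subst tr_sym[OF x]) (simp add: P_sym[OF x, of b] mult.commute)
    then have "tr2 x (\<lambda>a b e f. cotton c a e x * P b f x) = tr2 x (\<lambda>b a e f. P e b x * cotton c a f x)"
      by (subst tr_sym[OF x]) simp
    also have "\<dots> = - tr2 x (\<lambda>b a e f. P e b x * cotton c f a x)"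
      by (subst cotton_skew) (simp add: tr_minus)
    finally show ?thesis by (simp add: z)
  qed
  show ?thesis
    unfolding nab_delta_r_def by (simp add: tr_add tr_diff tr_minus tr_cmult 1 2 div_bach[OF x])
qed

lemma P_cotton_tr:
  assumes x: "x \<in> U"
  shows "tr x (\<lambda>a b. P a d x * cotton c b e x) = P_cotton d e c x"
    "tr x (\<lambda>a b. P a d x * (2 * cotton c b e x)) = 2 * P_cotton d e c x"
  unfolding P_cotton_def by (simp_all add: P_sym[OF x, of _ d] mult.left_commute tr_cmult)

lemma nab_delta_r_P_cotton: "x \<in> U \<Longrightarrow> nab_delta_r b c d x = - nab2 bach b d c x - 2 * P_cotton b d c x"
  unfolding nab_delta_r_def by (simp add: P_cotton_right)

text \<open>The derivatives of Bach come equally from the \<open>m\<close> slot of \<nabla>\<eta>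
  and from its \<open>r\<close> slot, the products of \<open>P\<close> with Cotton equally from its
  \<open>w\<close> and \<open>r\<close> slots; hence the doubled coefficients.\<close>

lemma lap_delta_m:
  assumes x: "x \<in> U"
  shows "tr x (\<lambda>a b. nab4 nab_delta_m a b c d e x + P a d x * (2 * cotton c b e x) - P a e x * (2 * cotton c b d x)
        + g a e x * nab_delta_r b c d x - g a d x * nab_delta_r b c e x)
    = - 2 * lap_cotton c d e x + 2 * nab2 bach d e c x - 2 * nab2 bach e d c x + 4 * P_cotton d e c x - 4 * P_cotton e d c x"
  unfolding nab4_nab_delta_m[OF x] lap_cotton_def
  by (simp add: tr_add tr_diff tr_minus tr_cmult tr_g[OF x] P_cotton_tr[OF x] nab_delta_r_P_cotton[OF x])

text \<open>The coefficient 4 is 2 + 2, from the \<open>r\<close> and the \<open>m\<close> slot of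
  \<nabla>\<eta>. The products of \<open>P\<close> with Bach cancel except for the trace
  \<open>J\<close>.\<close>

lemma lap_delta_r:
  assumes x: "x \<in> U"
  shows "tr x (\<lambda>a b. nab3 nab_delta_r a b c d x + P a d x * bach b c x - tr x (\<lambda>e f. nab_delta_m b c d e x * P a f x))
    = - lap_bach d c x + 4 * tr2 x (\<lambda>a b e f. nab3 cotton a c d e x * P b f x)
      + 2 * tr x (\<lambda>e f. cotton c d e x * pd f J x) + J x * bach d c x"
proof -
  have lb: "lap_bach d c x = tr x (\<lambda>a b. nab3 (nab2 bach) a b d c x)"
    by (simp add: lap_bach_def tr_def)
  have 1: "tr2 x (\<lambda>a b e f. cotton c d e x * nab2 P a b f x) = tr x (\<lambda>e f. cotton c d e x * pd f J x)"
    by (subst tr_swap) (simp add: tr_cmult div_P[OF x])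
  have 2: "tr2 x (\<lambda>a b e f. nab3 cotton b c d e x * P a f x) = tr2 x (\<lambda>a b e f. nab3 cotton a c d e x * P b f x)"
    by (rule tr_sym[OF x])
  have 3: "tr x (\<lambda>e f. bach e c x * P d f x) = tr x (\<lambda>a b. P a d x * bach b c x)"
    by (subst tr_sym[OF x]) (simp add: P_sym[OF x, of d] mult.commute)
  show ?thesis
    unfolding nab3_nab_delta_r[OF x] nab_delta_m_def lb
    by (simp add: tr_add tr_diff tr_minus tr_cmult tr_g[OF x] J_tr left_diff_distrib distrib_right mult.assoc 1 2 3)
qed

section \<open>The slots of the operator\<close>

lemma end_bracket_tcurv_delta:
  assumes x: "x \<in> U"
  shows "end_bracket (\<lambda>F G. tcurv a c F G x) (\<lambda>F G. delta tcurv b F G x) D E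
    = adj x (\<lambda>d. 0) (\<lambda>d e. tr x (\<lambda>p q. weyl a c d p x * (- 2 * cotton b q e x)) - tr x (\<lambda>p q. - 2 * cotton b d p x * weyl a c q e x)) 0
        (\<lambda>d. tr x (\<lambda>p q. weyl a c d p x * (- bach q b x)) - tr x (\<lambda>p q. - 2 * cotton b d p x * cotton q a c x)) D E"
proof -
  have t: "(\<lambda>F G. tcurv a c F G x) = adj x (\<lambda>k. 0) (\<lambda>k l. weyl a c k l x) 0 (\<lambda>k. cotton k a c x)"
    by (intro ext) (rule tcurv_adj[OF x])
  have d: "(\<lambda>F G. delta tcurv b F G x) = adj x (\<lambda>c. 0) (\<lambda>c d. - 2 * cotton b c d x) 0 (\<lambda>c. - bach c b x)"
    by (intro ext) (rule delta_tcurv[OF x])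
  show ?thesis unfolding t d
  proof (rule end_bracket_adj[OF x])
    show "weyl a c k l x = - weyl a c l k x" for k l by (rule weyl_skew34[OF x])
    show "- 2 * cotton b k l x = - (- 2 * cotton b l k x)" for k l using cotton_skew[of b k l x] by simp
  qed
qed

lemma tr_tr_cong: "(\<And>a b p q. f a b p q = h a b p q) \<Longrightarrow>
    tr2 x (\<lambda>a b p q. f a b p q) = tr2 x (\<lambda>a b p q. h a b p q)"
  by simp

text \<open>All coefficients are 4 up to sign, so this is the definition of the Bach tensor together
  with its symmetry.\<close>

lemma w_slot_zero:
  assumes x: "x \<in> U"
  shows "- (4 * tr x (\<lambda>a b. nab3 cotton a c b d x) - 4 * bach d c x)
      - 4 * tr2 x (\<lambda>a b p q. P b p x * weyl q c a d x) = 0"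
proof -
  have "tr2 x (\<lambda>a b p q. P b p x * weyl q c a d x) = tr2 x (\<lambda>p q a b. P b q x * weyl p c a d x)"
    by (subst tr_swap, subst tr_sym[OF x]) (rule refl)
  also have "\<dots> = tr2 x (\<lambda>c' e d' f. weyl c' c d' d x * P e f x)"
    by (simp add: P_sym[OF x] mult.commute)
  finally have "tr2 x (\<lambda>a b p q. P b p x * weyl q c a d x) = bach c d x - tr x (\<lambda>a b. nab3 cotton a c b d x)"
    unfolding bach_tr[OF x] by simp
  then show ?thesis using bach_sym[OF x, of c d] by simp
qed

text \<open>By skewness of Cotton the second contraction is -1/2 times
  \<open>div_bach\<close>.\<close>

lemma f_slot_zero:
  assumes x: "x \<in> U"
  shows "- (2 * div_bach c x) - 4 * tr2 x (\<lambda>a b p q. P b p x * cotton a q c x) = 0"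
proof -
  have "tr2 x (\<lambda>a b p q. P b p x * cotton a q c x) = tr2 x (\<lambda>a b p q. P a q x * cotton b p c x)"
    by (subst tr_sym[OF x], subst (2) tr_sym[OF x]) (rule refl)
  also have "\<dots> = tr2 x (\<lambda>a b p q. - (cotton b c p x * P a q x))"
  proof (rule tr_tr_cong)
    show "P a q x * cotton b p c x = - (cotton b c p x * P a q x)" for a b p q
      using cotton_skew[of b p c x] by simp
  qed
  finally show ?thesis unfolding div_bach_def by (simp add: tr_minus)
qed

text \<open>The facts 1 to 6 bring every contraction into a form that occurs in
  \<open>lap_cotton_eq\<close>; after substitution the remaining identity is linear in
  \<open>W\<close>, \<open>V\<close>, \<open>Z\<close>, \<open>P_cotton\<close>, the derivatives of
  Bach and the products of \<open>J\<close> and its derivative with curvature.\<close>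

lemma m_slot_zero:
  assumes x: "x \<in> U"
  shows "- (- 2 * lap_cotton c d e x + 2 * nab2 bach d e c x - 2 * nab2 bach e d c x + 4 * P_cotton d e c x - 4 * P_cotton e d c x)
      - 6 * (J x * cotton c d e x) + 2 * tr x (\<lambda>a b. pd a J x * weyl b c d e x)
      + 4 * tr2 x (\<lambda>a b p q. P b p x * (nab4 weyl a q c d e x + g a e x * cotton d q c x - g a d x * cotton e q c x))
      + 2 * tr2 x (\<lambda>a b p q. cotton c a p x * weyl b q d e x)
      + 2 * tr x (\<lambda>a b. tr x (\<lambda>p q. weyl a c d p x * (- 2 * cotton b q e x)) - tr x (\<lambda>p q. - 2 * cotton b d p x * weyl a c q e x)) = 0"
proof -
  define Z where "Z d e = tr2 x (\<lambda>a b p q. weyl a d c p x * cotton q b e x)" for d e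
  define V where "V d e = tr2 x (\<lambda>a b p q. weyl a d p e x * cotton c b q x)" for d e
  define W where "W = tr2 x (\<lambda>a b p q. nab4 weyl a d e c p x * P b q x)"
  have 1: "tr x (\<lambda>a b. pd a J x * weyl b c d e x) = - tr x (\<lambda>p q. weyl d e c p x * pd q J x)"
    unfolding tr_minus[symmetric]
  proof (subst tr_sym[OF x], intro arg_cong[of _ _ "tr x"] ext)
    show "pd b J x * weyl a c d e x = - (weyl d e c a x * pd b J x)" for a b
      using weyl_pair[OF x, of a c d e] weyl_skew34[OF x, of d e a c] by simp
  qed
  have 2: "tr2 x (\<lambda>a b p q. P b p x * nab4 weyl a q c d e x) = - W"
  proof -
    have "tr2 x (\<lambda>a b p q. P b p x * nab4 weyl a q c d e x) = tr2 x (\<lambda>a b p q. P b q x * nab4 weyl a p c d e x)"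
      by (subst (2) tr_sym[OF x]) (rule refl)
    also have "\<dots> = tr2 x (\<lambda>a b p q. - (nab4 weyl a d e c p x * P b q x))"
    proof (rule tr_tr_cong)
      show "P b q x * nab4 weyl a p c d e x = - (nab4 weyl a d e c p x * P b q x)" for a b p q
        using nab4_pair[OF x, of a p c d e] nab4_skew34[OF x, of a d e p c] by simp
    qed
    finally show ?thesis unfolding W_def by (simp add: tr_minus)
  qed
  have 3: "tr2 x (\<lambda>a b p q. P b p x * (g a e x * cotton d q c x)) = P_cotton e c d x" for d e
  proof -
    have "tr2 x (\<lambda>a b p q. P b p x * (g a e x * cotton d q c x))
        = tr2 x (\<lambda>a b p q. g a e x * (P b p x * cotton d q c x))"
      by (simp add: mult.left_commute)
    also have "\<dots> = tr x (\<lambda>p q. P e p x * cotton d q c x)"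
      by (subst tr_swap) (simp add: tr_g[OF x])
    finally show ?thesis by (simp add: P_cotton_def)
  qed
  have 4: "tr2 x (\<lambda>a b p q. cotton c a p x * weyl b q d e x) = V d e - V e d"
  proof -
    have "tr2 x (\<lambda>a b p q. cotton c a p x * weyl b q d e x) = tr2 x (\<lambda>a b p q. cotton c b q x * weyl a p d e x)"
      by (subst tr_sym[OF x], subst (2) tr_sym[OF x]) (rule refl)
    also have "\<dots> = tr2 x (\<lambda>a b p q. weyl a d p e x * cotton c b q x - weyl a e p d x * cotton c b q x)"
    proof (rule tr_tr_cong)
      fix a b p q
      \<comment> \<open>The cyclic identity writes Weyl with \<open>d\<close>, \<open>e\<close>
        adjacent as a difference of the two arrangements in which \<open>V\<close> contracts
        it.\<close>
      have e: "weyl a p d e x = weyl a d p e x - weyl a e p d x"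
        using weyl_cyclic[OF x, of a d p e] weyl_cyclic[OF x, of a p d e]
          weyl_skew34[OF x, of a p d e] weyl_skew34[OF x, of a d p e] weyl_skew34[OF x, of a e p d]
          weyl_pair[OF x, of d e p a] weyl_pair[OF x, of e a p d] weyl_skew12[of e a p d x] weyl_skew34[OF x, of d e p a]
          weyl_pair[OF x, of a p d e] weyl_skew12[of p a d e x] weyl_skew34[OF x, of p a d e]
        by simp
      show "cotton c b q x * weyl a p d e x = weyl a d p e x * cotton c b q x - weyl a e p d x * cotton c b q x"
        unfolding e by (simp add: algebra_simps)
    qed
    finally show ?thesis unfolding V_def by (simp add: tr_diff)
  qed
  have 5: "tr2 x (\<lambda>a b p q. weyl a c d p x * (- 2 * cotton b q e x)) = - 2 * Z d e"
  proof -
    have "tr2 x (\<lambda>a b p q. weyl a c d p x * (- 2 * cotton b q e x))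
      = tr2 x (\<lambda>p q a b. weyl a c d p x * (- 2 * cotton b q e x))" by (rule tr_swap)
    also have "\<dots> = tr2 x (\<lambda>p q a b. - 2 * (weyl p d c a x * cotton b q e x))"
    proof (rule tr_tr_cong)
      show "weyl a c d p x * (- 2 * cotton b q e x) = - 2 * (weyl p d c a x * cotton b q e x)" for p q a b
        using weyl_pair[OF x, of a c d p] weyl_skew12[of d p a c x] weyl_skew34[OF x, of p d a c] by simp
    qed
    finally show ?thesis unfolding Z_def by (simp only: tr_cmult)
  qed
  have 6: "tr2 x (\<lambda>a b p q. - 2 * cotton b d p x * weyl a c q e x) = - 2 * Z e d"
  proof -
    have "tr2 x (\<lambda>a b p q. - 2 * cotton b d p x * weyl a c q e x)
      = tr2 x (\<lambda>p q a b. - 2 * cotton b d q x * weyl a c p e x)"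
      by (subst tr_swap, subst tr_sym[OF x]) (rule refl)
    also have "\<dots> = tr2 x (\<lambda>p q a b. - 2 * (weyl p e c a x * cotton b q d x))"
    proof (rule tr_tr_cong)
      show "- 2 * cotton b d q x * weyl a c p e x = - 2 * (weyl p e c a x * cotton b q d x)" for p q a b
        using weyl_pair[OF x, of a c p e] weyl_skew34[OF x, of p e a c] cotton_skew[of b d q x] by simp
    qed
    finally show ?thesis unfolding Z_def by (simp only: tr_cmult)
  qed
  have L: "lap_cotton c d e x = 2 * W + tr x (\<lambda>p q. weyl d e c p x * pd q J x)
      + 3 * (J x * cotton c d e x) + nab2 bach d e c x - nab2 bach e d c x
      + 2 * P_cotton d c e x - 2 * P_cotton e c d x + 2 * P_cotton d e c x - 2 * P_cotton e d c x - V d e + V e d + 2 * Z d e - 2 * Z e d"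
    unfolding lap_cotton_eq[OF x] W_def V_def Z_def by (simp add: nab2_bach_sym[OF x, of _ c])
  have s: "tr2 x (\<lambda>a b p q. P b p x * (nab4 weyl a q c d e x + g a e x * cotton d q c x - g a d x * cotton e q c x))
      = - W + P_cotton e c d x - P_cotton d c e x"
    by (simp add: distrib_left right_diff_distrib tr_add tr_diff 2 3)
  show ?thesis
    unfolding s 1 4 L tr_diff 5 6 by simp
qed

section \<open>The obstruction tensor\<close>

lemma obstruction6_tr:
  "16 * obstruction6 a b x = lap_bach a b x
     + 2 * tr2 x (\<lambda>c e d f. weyl a c b d x * bach e f x)
     - 4 * J x * bach a b x
     - 4 * tr2 x (\<lambda>c e d f. (nab3 cotton c a b d x + nab3 cotton c b a d x) * P e f x)
     - 2 * tr x (\<lambda>c d. pd d J x * (cotton a b c x + cotton b a c x))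
     + 4 * tr2 x (\<lambda>c h e k. tr x (\<lambda>d l. weyl a c b d x * P e h x * P k l x))
     + 2 * tr2 x (\<lambda>c e d f. cotton a e f x * cotton b c d x)
     - 4 * tr2 x (\<lambda>c e d f. cotton c a d x * cotton f b e x)"
proof -
  have 1: "(\<Sum>c\<in>UNIV. \<Sum>d\<in>UNIV. weyl a c b d x * bach_up c d x) = tr2 x (\<lambda>c e d f. weyl a c b d x * bach e f x)"
    unfolding bach_up_def sum_gi_gi[symmetric] by (simp add: mult.commute)
  have 2: "(\<Sum>c\<in>UNIV. \<Sum>d\<in>UNIV. P_up c d x * (1/2 * (nab3 cotton c a b d x + nab3 cotton c b a d x)))
      = 1/2 * tr2 x (\<lambda>c e d f. (nab3 cotton c a b d x + nab3 cotton c b a d x) * P e f x)"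
    unfolding P_up_def sum_gi_gi by (simp only: mult.assoc tr_cmult)
  have 3: "(\<Sum>c\<in>UNIV. \<Sum>d\<in>UNIV. gi c d x * pd d J x * (1/2 * (cotton a b c x + cotton b a c x)))
      = 1/2 * tr x (\<lambda>c d. pd d J x * (cotton a b c x + cotton b a c x))"
    by (simp add: tr_def sum_distrib_left mult_ac)
  have 4: "(\<Sum>c\<in>UNIV. \<Sum>d\<in>UNIV. \<Sum>e\<in>UNIV. weyl a c b d x * P_mix e c x * P_up e d x)
      = tr2 x (\<lambda>c h e k. tr x (\<lambda>d l. weyl a c b d x * P e h x * P k l x))"
  proof -
    have "(\<Sum>c\<in>UNIV. \<Sum>d\<in>UNIV. \<Sum>e\<in>UNIV. weyl a c b d x * P_mix e c x * P_up e d x)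
      = (\<Sum>c\<in>UNIV. \<Sum>e\<in>UNIV. \<Sum>d\<in>UNIV. P_up e d x * (weyl a c b d x * P_mix e c x))"
      by (rule sum.cong[OF refl], subst sum.swap) (simp add: mult_ac)
    also have "\<dots> = (\<Sum>c\<in>UNIV. tr2 x (\<lambda>e k d l. weyl a c b d x * P_mix e c x * P k l x))"
      unfolding P_up_def sum_gi_gi ..
    also have "\<dots> = (\<Sum>c\<in>UNIV. \<Sum>h\<in>UNIV. gi c h x * tr2 x (\<lambda>e k d l. weyl a c b d x * P e h x * P k l x))"
    proof (intro sum.cong refl)
      fix c
      have "tr2 x (\<lambda>e k d l. weyl a c b d x * P_mix e c x * P k l x)
          = tr2 x (\<lambda>e k d l. \<Sum>h\<in>UNIV. gi c h x * (weyl a c b d x * P e h x * P k l x))"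
        by (simp add: P_mix_def sum_distrib_left sum_distrib_right mult_ac)
      also have "\<dots> = (\<Sum>h\<in>UNIV. gi c h x * tr2 x (\<lambda>e k d l. weyl a c b d x * P e h x * P k l x))"
        by (simp only: tr_sum tr_cmult)
      finally show "tr2 x (\<lambda>e k d l. weyl a c b d x * P_mix e c x * P k l x) = \<dots>" .
    qed
    finally show ?thesis
      unfolding tr_def[of x "\<lambda>c h. tr2 x (\<lambda>e k d l. weyl a c b d x * P e h x * P k l x)"] .
  qed
  have 5: "(\<Sum>c\<in>UNIV. \<Sum>d\<in>UNIV. \<Sum>e\<in>UNIV. \<Sum>f\<in>UNIV. gi c e x * gi d f x * cotton a e f x * cotton b c d x)
      = tr2 x (\<lambda>c e d f. cotton a e f x * cotton b c d x)"
    by (rule sum_gi_gi'[of x "\<lambda>e f c d. cotton a e f x" "\<lambda>e f c d. cotton b c d x"])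
  have 6: "(\<Sum>c\<in>UNIV. \<Sum>d\<in>UNIV. \<Sum>e\<in>UNIV. \<Sum>f\<in>UNIV. gi c e x * gi d f x * cotton c a d x * cotton f b e x)
      = tr2 x (\<lambda>c e d f. cotton c a d x * cotton f b e x)"
    by (rule sum_gi_gi'[of x "\<lambda>e f c d. cotton c a d x" "\<lambda>e f c d. cotton f b e x"])
  show ?thesis unfolding obstruction6_def 1 2 3 4 5 6 by simp
qed

lemma lap_bach_sym: assumes x: "x \<in> U" shows "lap_bach a b x = lap_bach b a x"
proof -
  have "nab3 (nab2 bach) c d a b x = nab3 (nab2 bach) c d b a x" for c d
  proof -
    have "pd c (nab2 bach d a b) x = pd c (nab2 bach d b a) x" by (rule pd_cong[OF x]) (rule nab2_bach_sym)
    then show ?thesis unfolding nab3_def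
      by (simp add: nab2_bach_sym[OF x, of _ a b] nab2_bach_sym[OF x, of d _ b] nab2_bach_sym[OF x, of d a])
  qed
  then show ?thesis unfolding lap_bach_def by simp
qed

text \<open>The symmetrised terms of the obstruction tensor come in halves: Cotton with
  \<open>c\<close> in front from \<Delta>\<eta>, with \<open>d\<close> in front from the derivatives
  of \<Omega> and J. Likewise the coefficient 4 of J is 1 + 3.\<close>

lemma r_slot_obstruction:
  assumes x: "x \<in> U"
  shows "- (- lap_bach d c x + 4 * tr2 x (\<lambda>a b e f. nab3 cotton a c d e x * P b f x)
      + 2 * tr x (\<lambda>e f. cotton c d e x * pd f J x) + J x * bach d c x)
      - 3 * (J x * bach d c x) + 2 * tr x (\<lambda>a b. pd a J x * cotton d b c x)
      + 4 * tr2 x (\<lambda>a b p q. P b p x * (nab3 cotton a d q c x - tr x (\<lambda>k l. weyl q c d k x * P a l x)))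
      + 2 * tr2 x (\<lambda>a b p q. cotton c a p x * cotton d b q x)
      + 2 * tr x (\<lambda>a b. tr x (\<lambda>p q. weyl a c d p x * (- bach q b x)) - tr x (\<lambda>p q. - 2 * cotton b d p x * cotton q a c x))
    = 16 * obstruction6 c d x"
proof -
  have 1: "tr x (\<lambda>a b. pd a J x * cotton d b c x) = - tr x (\<lambda>a b. pd b J x * cotton d c a x)"
    by (subst tr_sym[OF x], subst cotton_skew) (simp add: tr_minus)
  have 2: "tr x (\<lambda>e f. cotton c d e x * pd f J x) = tr x (\<lambda>a b. pd b J x * cotton c d a x)"
    by (simp add: mult.commute)
  have 3: "tr2 x (\<lambda>a b p q. P b p x * nab3 cotton a d q c x)
      = - tr2 x (\<lambda>a b p q. nab3 cotton a d c p x * P b q x)"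
  proof -
    have "tr2 x (\<lambda>a b p q. P b p x * nab3 cotton a d q c x)
       = tr2 x (\<lambda>a b p q. P b q x * nab3 cotton a d p c x)"
      by (subst (2) tr_sym[OF x]) (rule refl)
    also have "\<dots> = tr2 x (\<lambda>a b p q. - (nab3 cotton a d c p x * P b q x))"
    proof (rule tr_tr_cong)
      show "P b q x * nab3 cotton a d p c x = - (nab3 cotton a d c p x * P b q x)" for a b p q
        using nab3_cotton_skew[OF x, of a d p c] by simp
    qed
    finally show ?thesis by (simp add: tr_minus)
  qed
  have 4: "tr2 x (\<lambda>a b p q. P b p x * tr x (\<lambda>k l. weyl q c d k x * P a l x))
      = - tr2 x (\<lambda>c' h e k. tr x (\<lambda>d' l. weyl c c' d d' x * P e h x * P k l x))"
  proof -
    have "tr2 x (\<lambda>a b p q. P b p x * tr x (\<lambda>k l. weyl q c d k x * P a l x))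
      = tr2 x (\<lambda>p q a b. P b p x * tr x (\<lambda>k l. weyl q c d k x * P a l x))" by (rule tr_swap)
    also have "\<dots> = tr2 x (\<lambda>p q a b. P a q x * tr x (\<lambda>k l. weyl p c d k x * P b l x))"
      by (subst tr_sym[OF x], subst (2) tr_sym[OF x]) (rule refl)
    also have "\<dots> = tr2 x (\<lambda>p q a b. - tr x (\<lambda>k l. weyl c p d k x * P a q x * P b l x))"
    proof (rule tr_tr_cong)
      fix p q a b
      have "- tr x (\<lambda>k l. weyl c p d k x * P a q x * P b l x) = tr x (\<lambda>k l. P a q x * (weyl p c d k x * P b l x))"
        unfolding tr_minus[symmetric]
      proof (intro arg_cong[of _ _ "tr x"] ext)
        show "- (weyl c p d k x * P a q x * P b l x) = P a q x * (weyl p c d k x * P b l x)" for k l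
          using weyl_skew12[of p c d k x] by simp
      qed
      then show "P a q x * tr x (\<lambda>k l. weyl p c d k x * P b l x) = - tr x (\<lambda>k l. weyl c p d k x * P a q x * P b l x)"
        by (simp add: tr_cmult)
    qed
    finally show ?thesis by (simp add: tr_minus)
  qed
  have 5: "tr2 x (\<lambda>a b p q. cotton c a p x * cotton d b q x) = tr2 x (\<lambda>a b p q. cotton c b q x * cotton d a p x)"
    by (subst tr_sym[OF x], subst (2) tr_sym[OF x]) (rule refl)
  have 6: "tr2 x (\<lambda>a b p q. weyl a c d p x * (- bach q b x)) = tr2 x (\<lambda>a b p q. weyl c a d p x * bach b q x)"
  proof (rule tr_tr_cong)
    show "weyl a c d p x * (- bach q b x) = weyl c a d p x * bach b q x" for a b p q
      using weyl_skew12[of a c d p x] bach_sym[OF x, of q b] by simp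
  qed
  have 7: "tr2 x (\<lambda>a b p q. - 2 * cotton b d p x * cotton q a c x) = 2 * tr2 x (\<lambda>a b p q. cotton a c p x * cotton q d b x)"
  proof -
    have "tr2 x (\<lambda>a b p q. - 2 * cotton b d p x * cotton q a c x) = tr2 x (\<lambda>p q a b. - 2 * cotton b d q x * cotton p a c x)"
      by (subst tr_swap, subst tr_sym[OF x]) (rule refl)
    also have "\<dots> = tr2 x (\<lambda>p q a b. 2 * (cotton p c a x * cotton b d q x))"
    proof (rule tr_tr_cong)
      show "- 2 * cotton b d q x * cotton p a c x = 2 * (cotton p c a x * cotton b d q x)" for p q a b
        using cotton_skew[of p a c x] by simp
    qed
    finally show ?thesis by (simp only: tr_cmult)
  qed
  show ?thesis
    unfolding obstruction6_tr right_diff_distrib tr_diff 1 2 3 4 5 6 7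
    by (simp add: distrib_left distrib_right tr_add lap_bach_sym[OF x, of d] bach_sym[OF x, of d])
qed

lemma frakD_tcurv_eq:
  assumes x: "x \<in> U"
  shows "frakD tcurv c D E x = adj x (\<lambda>d. 0) (\<lambda>d e. 0) 0 (\<lambda>d. 16 * obstruction6 c d x) D E"
  unfolding frakD_tcurv[OF x] end_bracket_tcurv_delta[OF x]
  unfolding nab2_delta[OF x] delta_tcurv[OF x] tcurv_adj[OF x] nab_tcurv[OF x]
    adj_cmult adj_tr adj_minus adj_add adj_diff
    lap_delta_w[OF x] lap_delta_f[OF x] lap_delta_m[OF x] lap_delta_r[OF x]
proof (rule adj_cong, goal_cases)
  case (1 d)
  show ?case by (rule trans[OF _ w_slot_zero[OF x, of c d]]) (simp add: tr_zero tr_minus)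
next
  case (2 d e)
  show ?case by (rule trans[OF _ m_slot_zero[OF x, of c d e]]) (simp add: tr_zero tr_minus)
next
  case 3
  show ?case by (rule trans[OF _ f_slot_zero[OF x, of c]]) (simp add: tr_zero tr_minus)
next
  case (4 d)
  show ?case by (rule trans[OF _ r_slot_obstruction[OF x, of d c]]) (simp add: tr_zero tr_minus)
qed

end

context smooth_chart_metric
begin

section \<open>Sections of the tractor bundle\<close>

text \<open>The tractor with components \<open>(\<sigma>, \<mu>, \<rho>)\<close>, constant in the splitting of \<open>g\<close>, as it appears in
  the splitting of \<open>exp (2\<upsilon>) g\<close>.\<close>

fun rescaled :: "real \<Rightarrow> ('n \<Rightarrow> real) \<Rightarrow> real \<Rightarrow> ('m \<Rightarrow> real) \<Rightarrow> 'n tidx \<Rightarrow> 'm \<Rightarrow> real" where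
  "rescaled \<sigma> \<mu> \<rho> \<upsilon> tY x = exp (\<upsilon> x) * \<sigma>"
| "rescaled \<sigma> \<mu> \<rho> \<upsilon> (tZ a) x = exp (\<upsilon> x) * (\<mu> a + pd a \<upsilon> x * \<sigma>)"
| "rescaled \<sigma> \<mu> \<rho> \<upsilon> tX x = exp (- \<upsilon> x) * (\<rho> - tr x (\<lambda>a b. pd a \<upsilon> x * \<mu> b) - 1/2 * tr x (\<lambda>a b. pd a \<upsilon> x * pd b \<upsilon> x) * \<sigma>)"

lemma sm_rescaled:
  assumes "sm \<upsilon>" shows "sm (rescaled \<sigma> \<mu> \<rho> \<upsilon> D)"
proof (cases D)
  case tY
  have "rescaled \<sigma> \<mu> \<rho> \<upsilon> tY = (\<lambda>x. exp (\<upsilon> x) * \<sigma>)" by (rule ext) simp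
  then show ?thesis using tY by (simp add: smooth_intros assms)
next
  case (tZ a)
  have "rescaled \<sigma> \<mu> \<rho> \<upsilon> (tZ a) = (\<lambda>x. exp (\<upsilon> x) * (\<mu> a + pd a \<upsilon> x * \<sigma>))" by (rule ext) simp
  then show ?thesis using tZ by (simp add: smooth_intros assms)
next
  case tX
  have "rescaled \<sigma> \<mu> \<rho> \<upsilon> tX = (\<lambda>x. exp (- \<upsilon> x) * (\<rho> - tr x (\<lambda>a b. pd a \<upsilon> x * \<mu> b) - 1/2 * tr x (\<lambda>a b. pd a \<upsilon> x * pd b \<upsilon> x) * \<sigma>))"
    by (rule ext) simp
  then show ?thesis unfolding tX by (auto intro!: smooth_intros assms simp del: times_divide_eq_left)
qed

lemma gi_rescale:
  assumes "smooth_chart_metric \<kappa> g'" and x: "x \<in> U" and r: "\<And>a b. g' a b x = exp (2 * \<upsilon>) * g a b x"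
  shows "chart_metric.gi g' a b x = exp (- 2 * \<upsilon>) * gi a b x"
proof -
  interpret L: smooth_chart_metric \<kappa> g' by fact
  have "(\<Sum>d\<in>UNIV. (\<Sum>c\<in>UNIV. L.gi a c x * g' c d x) * gi d b x) = L.gi a b x * exp (2 * \<upsilon>)"
  proof -
    have "(\<Sum>d\<in>UNIV. (\<Sum>c\<in>UNIV. L.gi a c x * g' c d x) * gi d b x)
        = (\<Sum>c\<in>UNIV. L.gi a c x * exp (2 * \<upsilon>) * (\<Sum>d\<in>UNIV. g c d x * gi d b x))"
      unfolding r sum_distrib_left sum_distrib_right by (subst sum.swap) (simp add: mult_ac)
    then show ?thesis by (simp add: g_gi[OF x])
  qed
  moreover have "(\<Sum>d\<in>UNIV. (\<Sum>c\<in>UNIV. L.gi a c x * g' c d x) * gi d b x) = gi a b x"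
    by (simp add: L.gi_g[OF x])
  ultimately have "gi a b x = L.gi a b x * exp (2 * \<upsilon>)" by simp
  then show ?thesis by (simp add: exp_minus field_simps)
qed

text \<open>Rescaling is a cocycle: first by \<upsilon>, which leads to \<open>g'\<close>, then by
  \<Upsilon>. The cross term of the squared gradient of the sum is supplied by the middle component,
  which has already been rescaled.\<close>

lemma rescaled_law:
  assumes g': "smooth_chart_metric \<kappa> g'" and x: "x \<in> U" and s: "sm \<upsilon>" "sm \<Upsilon>"
    and r: "\<And>a b. g' a b x = exp (2 * \<upsilon> x) * g a b x"
    and \<upsilon>': "\<And>y. y \<in> U \<Longrightarrow> \<upsilon>' y = \<upsilon> y + \<Upsilon> y"
  shows "rescaled \<sigma> \<mu> \<rho> \<upsilon>' tY x = exp (\<Upsilon> x) * rescaled \<sigma> \<mu> \<rho> \<upsilon> tY x"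
    and "rescaled \<sigma> \<mu> \<rho> \<upsilon>' (tZ a) x = exp (\<Upsilon> x) * (rescaled \<sigma> \<mu> \<rho> \<upsilon> (tZ a) x + pd a \<Upsilon> x * rescaled \<sigma> \<mu> \<rho> \<upsilon> tY x)"
    and "rescaled \<sigma> \<mu> \<rho> \<upsilon>' tX x = exp (- \<Upsilon> x) * (rescaled \<sigma> \<mu> \<rho> \<upsilon> tX x
      - (\<Sum>a\<in>UNIV. \<Sum>b\<in>UNIV. chart_metric.gi g' a b x * pd a \<Upsilon> x * rescaled \<sigma> \<mu> \<rho> \<upsilon> (tZ b) x)
      - 1/2 * (\<Sum>a\<in>UNIV. \<Sum>b\<in>UNIV. chart_metric.gi g' a b x * pd a \<Upsilon> x * pd b \<Upsilon> x) * rescaled \<sigma> \<mu> \<rho> \<upsilon> tY x)"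
proof -
  have p: "pd a \<upsilon>' x = pd a \<upsilon> x + pd a \<Upsilon> x" for a
    using pd_cong[OF x, of \<upsilon>' "\<lambda>y. \<upsilon> y + \<Upsilon> y" a] pd_add[OF x s, of a] \<upsilon>' by simp
  have e: "exp (\<upsilon>' x) = exp (\<Upsilon> x) * exp (\<upsilon> x)" "exp (- \<upsilon>' x) = exp (- \<Upsilon> x) * exp (- \<upsilon> x)"
    using \<upsilon>'[OF x] by (simp_all flip: exp_add)
  show "rescaled \<sigma> \<mu> \<rho> \<upsilon>' tY x = exp (\<Upsilon> x) * rescaled \<sigma> \<mu> \<rho> \<upsilon> tY x"
    by (simp add: e)
  show "rescaled \<sigma> \<mu> \<rho> \<upsilon>' (tZ a) x = exp (\<Upsilon> x) * (rescaled \<sigma> \<mu> \<rho> \<upsilon> (tZ a) x + pd a \<Upsilon> x * rescaled \<sigma> \<mu> \<rho> \<upsilon> tY x)"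
    by (simp add: e p algebra_simps)
  have em: "exp (- 2 * \<upsilon> x) * exp (\<upsilon> x) = exp (- \<upsilon> x)" by (simp flip: exp_add)
  have 1: "(\<Sum>a\<in>UNIV. \<Sum>b\<in>UNIV. chart_metric.gi g' a b x * pd a \<Upsilon> x * rescaled \<sigma> \<mu> \<rho> \<upsilon> (tZ b) x)
      = exp (- \<upsilon> x) * tr x (\<lambda>a b. pd a \<Upsilon> x * (\<mu> b + pd b \<upsilon> x * \<sigma>))"
    unfolding gi_rescale[OF g' x r] tr_def em[symmetric] by (simp add: sum_distrib_left mult_ac)
  have 2: "(\<Sum>a\<in>UNIV. \<Sum>b\<in>UNIV. chart_metric.gi g' a b x * pd a \<Upsilon> x * pd b \<Upsilon> x)
      = exp (- 2 * \<upsilon> x) * tr x (\<lambda>a b. pd a \<Upsilon> x * pd b \<Upsilon> x)"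
    unfolding gi_rescale[OF g' x r] tr_def by (simp add: sum_distrib_left mult_ac)
  have 3: "1/2 * (exp (- 2 * \<upsilon> x) * k) * rescaled \<sigma> \<mu> \<rho> \<upsilon> tY x = exp (- \<upsilon> x) * (1/2 * k * \<sigma>)" for k
    unfolding em[symmetric] by simp
  have 4: "tr x (\<lambda>a b. pd a \<upsilon> x * pd b \<Upsilon> x) = tr x (\<lambda>a b. pd a \<Upsilon> x * pd b \<upsilon> x)"
    by (subst tr_sym[OF x]) (simp add: mult.commute)
  show "rescaled \<sigma> \<mu> \<rho> \<upsilon>' tX x = exp (- \<Upsilon> x) * (rescaled \<sigma> \<mu> \<rho> \<upsilon> tX x
      - (\<Sum>a\<in>UNIV. \<Sum>b\<in>UNIV. chart_metric.gi g' a b x * pd a \<Upsilon> x * rescaled \<sigma> \<mu> \<rho> \<upsilon> (tZ b) x)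
      - 1/2 * (\<Sum>a\<in>UNIV. \<Sum>b\<in>UNIV. chart_metric.gi g' a b x * pd a \<Upsilon> x * pd b \<Upsilon> x) * rescaled \<sigma> \<mu> \<rho> \<upsilon> tY x)"
  proof -
    have "tr x (\<lambda>a b. (pd a \<upsilon> x + pd a \<Upsilon> x) * \<mu> b) = tr x (\<lambda>a b. pd a \<upsilon> x * \<mu> b) + tr x (\<lambda>a b. pd a \<Upsilon> x * \<mu> b)"
      by (simp add: distrib_right tr_add)
    moreover have "tr x (\<lambda>a b. (pd a \<upsilon> x + pd a \<Upsilon> x) * (pd b \<upsilon> x + pd b \<Upsilon> x))
        = tr x (\<lambda>a b. pd a \<upsilon> x * pd b \<upsilon> x) + 2 * tr x (\<lambda>a b. pd a \<Upsilon> x * pd b \<upsilon> x) + tr x (\<lambda>a b. pd a \<Upsilon> x * pd b \<Upsilon> x)"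
      by (simp add: distrib_right distrib_left tr_add 4)
    moreover have "tr x (\<lambda>a b. pd a \<Upsilon> x * (\<mu> b + pd b \<upsilon> x * \<sigma>))
        = tr x (\<lambda>a b. pd a \<Upsilon> x * \<mu> b) + tr x (\<lambda>a b. pd a \<Upsilon> x * pd b \<upsilon> x) * \<sigma>"
      by (simp add: distrib_left tr_add tr_multc flip: mult.assoc)
    ultimately show ?thesis
      unfolding 1 2 3 rescaled.simps(3) e p by (simp add: algebra_simps)
  qed
qed

lemma factor_unique:
  assumes x: "x \<in> U" and "\<And>a b. exp (2 * s) * g a b x = exp (2 * t) * g a b x"
  shows "s = t"
proof (rule ccontr)
  assume "s \<noteq> t"
  then have "g a b x = 0" for a b using assms(2)[of a b] by simp
  then show False using g_gi[OF x, of undefined undefined] by simp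
qed

lemma tnab_cong:
  assumes x: "x \<in> U" and "\<And>y F. y \<in> U \<Longrightarrow> V F y = V' F y"
  shows "tnab V a D x = tnab V' a D x"
proof -
  have "pd a (V F) x = pd a (V' F) x" for F by (rule pd_cong[OF x assms(2)])
  then show ?thesis unfolding tnab_def Let_def nab1_def by (simp add: assms)
qed

text \<open>For the frame section \<open>E\<close> the first derivative is column \<open>E\<close>
  of the connection matrix, so the commutator of second derivatives is that column of the
  curvature.\<close>

lemma tractor_curvature_tcurv:
  assumes V: "\<And>y F. y \<in> U \<Longrightarrow> V F y = of_bool (F = E)" and x: "x \<in> U"
  shows "tnab1 (tnab V) a b D x - tnab1 (tnab V) b a D x = tcurv a b D E x"
proof -
  have t: "tnab V b D y = tconn b D E y" if "y \<in> U" for b D y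
    unfolding tconn_def by (rule tnab_cong[OF that]) (rule V)
  have "pd a (tnab V b D) x = pd a (tconn b D E) x" for a b
    by (rule pd_cong[OF x]) (rule t)
  then have "tnab1 (tnab V) a b D x = pd a (tconn b D E) x - (\<Sum>e\<in>UNIV. chr e a b x * tconn e D E x)
      + (\<Sum>F\<in>UNIV. tconn a D F x * tconn b F E x)" for a b
    unfolding tnab1_def by (simp add: t x)
  then show ?thesis
    unfolding tcurv_def end_bracket_def end_mult_def by (simp add: chr_sym[OF x, of _ b a])
qed

text \<open>Agreement is needed on the whole chart domain, not only at \<open>x\<close>, because the
  operator differentiates its argument.\<close>

lemma frakD_cong:
  assumes x: "x \<in> U" and eq: "\<And>y a b D E. y \<in> U \<Longrightarrow> \<omega> a b D E y = \<omega>' a b D E y"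
  shows "frakD \<omega> c D E x = frakD \<omega>' c D E x"
proof -
  have d: "delta \<omega> c D E y = delta \<omega>' c D E y" if "y \<in> U" for c D E y
    unfolding delta_def using enab2_cong[OF that eq] by simp
  have q: "Q2 \<omega> b c D E y = Q2 \<omega>' b c D E y" if "y \<in> U" for b c D E y
    unfolding Q2_def ext_d_def P_hash_def
    using enab1_cong[OF that, of "delta \<omega>" "delta \<omega>'"] d by (simp add: eq[OF that])
  have "delta (Q2 \<omega>) c D E x = delta (Q2 \<omega>') c D E x"
    unfolding delta_def using enab2_cong[OF x q] by simp
  then show ?thesis
    unfolding frakD_def form_bracket_def by (simp add: d eq x)
qed

end

section \<open>From the conformal class on the manifold to one chart\<close>

lemma det_has_signature:
  fixes S :: "real^'n^'n"
  assumes "has_signature p q S" shows "det S \<noteq> 0"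
proof -
  obtain E :: "real^'n^'n" and \<epsilon> :: "'n \<Rightarrow> real" where E: "transpose E ** S ** E = (\<chi> i j. if i = j then \<epsilon> i else 0)"
    and e: "\<forall>i. \<epsilon> i = 1 \<or> \<epsilon> i = -1"
    using assms unfolding has_signature_def by blast
  have "det (\<chi> i j. if i = j then \<epsilon> i else 0) = (\<Prod>i\<in>UNIV. \<epsilon> i)"
    by (subst det_diagonal) simp_all
  moreover have "(\<Prod>i\<in>UNIV. \<epsilon> i) \<noteq> 0"
  proof -
    have "\<epsilon> i \<noteq> 0" for i using e[rule_format, of i] by auto
    then show ?thesis by simp
  qed
  ultimately show ?thesis using arg_cong[OF E, of det] by (auto simp: det_mul)
qed

lemma smooth_chart_metric_pseudo_metric:
  assumes "smooth_manifold M \<A>" "pseudo_metric \<A> p q g" "\<kappa> \<in> \<A>"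
  shows "smooth_chart_metric \<kappa> (g \<kappa>)"
proof
  have o: "openin M (chart_dom \<kappa>)" "open (coord \<kappa> ` chart_dom \<kappa>)"
    "homeomorphic_map (subtopology M (chart_dom \<kappa>)) (top_of_set (coord \<kappa> ` chart_dom \<kappa>)) (coord \<kappa>)"
    using assms(1,3) unfolding smooth_manifold_def by blast+
  show "open (coord \<kappa> ` chart_dom \<kappa>)" by (rule o)
  have "topspace (subtopology M (chart_dom \<kappa>)) = chart_dom \<kappa>"
    using openin_subset[OF o(1)] by auto
  then show "inj_on (coord \<kappa>) (chart_dom \<kappa>)"
    using homeomorphic_imp_injective_map[OF o(3)] by simp
  show "smooth_in \<kappa> (chart_dom \<kappa>) (g \<kappa> a b)" for a b
    using assms(2,3) unfolding pseudo_metric_def by blast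
  show "g \<kappa> a b x = g \<kappa> b a x" if "x \<in> chart_dom \<kappa>" for a b x
    using assms(2,3) that unfolding pseudo_metric_def by blast
  show "det (\<chi> i j. g \<kappa> i j x) \<noteq> 0" if "x \<in> chart_dom \<kappa>" for x
  proof -
    have "has_signature p q (\<chi> i j. g \<kappa> i j x)"
      using assms(2,3) that unfolding pseudo_metric_def by blast
    then show ?thesis by (rule det_has_signature)
  qed
qed

lemma conformal_class_factor:
  assumes "smooth_manifold M \<A>" "conformal_class \<A> p q c" "\<kappa> \<in> \<A>" "g \<in> c" "g' \<in> c"
  obtains \<upsilon> where "smooth_in \<kappa> (chart_dom \<kappa>) \<upsilon>" "\<And>x a b. x \<in> chart_dom \<kappa> \<Longrightarrow> g' \<kappa> a b x = exp (2 * \<upsilon> x) * g \<kappa> a b x"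
proof -
  obtain g0 where c: "c = {g. pseudo_metric \<A> p q g \<and> (\<exists>\<Upsilon>. smooth_function \<A> \<Upsilon> \<and>
      (\<forall>\<kappa>\<in>\<A>. \<forall>x\<in>chart_dom \<kappa>. \<forall>a b. g \<kappa> a b x = exp (2 * \<Upsilon> x) * g0 \<kappa> a b x))}"
    using assms(2) unfolding conformal_class_def by blast
  obtain u v where u: "smooth_function \<A> u" "\<forall>\<kappa>\<in>\<A>. \<forall>x\<in>chart_dom \<kappa>. \<forall>a b. g \<kappa> a b x = exp (2 * u x) * g0 \<kappa> a b x"
    and v: "smooth_function \<A> v" "\<forall>\<kappa>\<in>\<A>. \<forall>x\<in>chart_dom \<kappa>. \<forall>a b. g' \<kappa> a b x = exp (2 * v x) * g0 \<kappa> a b x"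
    and pm: "pseudo_metric \<A> p q g"
    using assms(4,5) unfolding c by blast
  interpret smooth_chart_metric \<kappa> "g \<kappa>"
    by (rule smooth_chart_metric_pseudo_metric[OF assms(1) pm assms(3)])
  show thesis
  proof (rule that[of "\<lambda>x. v x - u x"])
    show "sm (\<lambda>x. v x - u x)"
      using u(1) v(1) assms(3) unfolding smooth_function_def by (auto intro: sm_diff)
    show "g' \<kappa> a b x = exp (2 * (v x - u x)) * g \<kappa> a b x" if "x \<in> U" for x a b
    proof -
      have "exp (2 * (v x - u x)) * exp (2 * u x) = exp (2 * v x)"
        by (simp add: algebra_simps flip: exp_add)
      then show ?thesis using u(2) v(2) assms(3) that by (simp flip: mult.assoc)
    qed
  qed
qed

text \<open>The defining property of \<open>\<Omega>\<close> is tested on the sections that are constant in the splitting of \<open>g\<close>.\<close>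

lemma tractor_curvature_eq:
  assumes M: "smooth_manifold M \<A>" and c: "conformal_class \<A> p q c" and g: "g \<in> c" and \<kappa>: "\<kappa> \<in> \<A>"
    and \<Omega>: "tractor_curvature c \<kappa> g \<Omega>" and x: "x \<in> chart_dom \<kappa>"
  shows "\<Omega> a b D E x = smooth_chart_metric.tcurv \<kappa> (g \<kappa>) a b D E x"
proof -
  have pm: "pseudo_metric \<A> p q g'" if "g' \<in> c" for g'
    using c that unfolding conformal_class_def by blast
  note loc = smooth_chart_metric_pseudo_metric[OF M pm \<kappa>]
  interpret smooth_chart_metric \<kappa> "g \<kappa>" by (rule loc[OF g])
  define rel where "rel g' \<upsilon> \<longleftrightarrow> sm \<upsilon> \<and> (\<forall>x\<in>U. \<forall>a b. g' \<kappa> a b x = exp (2 * \<upsilon> x) * g \<kappa> a b x)"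
    for g' :: "('a, 'b) metric" and \<upsilon>
  \<comment> \<open>The factor is determined by the metric (\<open>factor_unique\<close>), so these
    choices are automatically additive under rescaling, as \<open>u\<close> shows.\<close>
  define \<upsilon> where "\<upsilon> g' = (SOME \<upsilon>. rel g' \<upsilon>)" for g'
  have rel: "rel g' (\<upsilon> g')" if g': "g' \<in> c" for g'
  proof -
    obtain u where "sm u" "\<And>x a b. x \<in> U \<Longrightarrow> g' \<kappa> a b x = exp (2 * u x) * g \<kappa> a b x"
      using conformal_class_factor[OF M c \<kappa> g g'] by blast
    then have "rel g' u" unfolding rel_def by blast
    then show ?thesis unfolding \<upsilon>_def by (rule someI[of "rel g'"])
  qed
  define V where "V g' = rescaled (of_bool (tY = E)) (\<lambda>a. of_bool (tZ a = E)) (of_bool (tX = E)) (\<upsilon> g')" for g'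
  have "tractor_section c \<kappa> V"
    unfolding tractor_section_def Let_def
  proof (intro conjI ballI allI impI)
    show "sm (V g' B)" if "g' \<in> c" for g' B
      unfolding V_def using rel[OF that] unfolding rel_def by (blast intro: sm_rescaled)
    fix g1 g2 \<Upsilon> y
    assume h: "g1 \<in> c" "g2 \<in> c" "sm \<Upsilon> \<and> (\<forall>x\<in>U. \<forall>a b. g2 \<kappa> a b x = exp (2 * \<Upsilon> x) * g1 \<kappa> a b x)" and y: "y \<in> U"
    have r1: "\<And>x a b. x \<in> U \<Longrightarrow> g1 \<kappa> a b x = exp (2 * \<upsilon> g1 x) * g \<kappa> a b x" and s1: "sm (\<upsilon> g1)"
      using rel[OF h(1)] unfolding rel_def by blast+
    have r2: "\<And>x a b. x \<in> U \<Longrightarrow> g2 \<kappa> a b x = exp (2 * \<upsilon> g2 x) * g \<kappa> a b x"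
      using rel[OF h(2)] unfolding rel_def by blast
    have u: "\<upsilon> g2 z = \<upsilon> g1 z + \<Upsilon> z" if z: "z \<in> U" for z
    proof (rule factor_unique[OF z])
      show "exp (2 * \<upsilon> g2 z) * g \<kappa> a b z = exp (2 * (\<upsilon> g1 z + \<Upsilon> z)) * g \<kappa> a b z" for a b
      proof -
        have "exp (2 * \<upsilon> g2 z) * g \<kappa> a b z = exp (2 * \<Upsilon> z) * (exp (2 * \<upsilon> g1 z) * g \<kappa> a b z)"
          using r1[OF z] r2[OF z] h(3) z by metis
        then show ?thesis by (simp add: distrib_left exp_add mult_ac)
      qed
    qed
    note law = rescaled_law[OF loc[OF h(1)] y s1 _ r1[OF y] u]
    show "V g2 tY y = exp (\<Upsilon> y) * V g1 tY y"
      unfolding V_def using law(1) h(3) by blast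
    show "V g2 (tZ a) y = exp (\<Upsilon> y) * (V g1 (tZ a) y + pd a \<Upsilon> y * V g1 tY y)" for a
      unfolding V_def using law(2) h(3) by blast
    show "V g2 tX y = exp (- \<Upsilon> y) * (V g1 tX y
          - (\<Sum>a\<in>UNIV. \<Sum>b\<in>UNIV. chart_metric.gi (g1 \<kappa>) a b y * pd a \<Upsilon> y * V g1 (tZ b) y)
          - 1/2 * (\<Sum>a\<in>UNIV. \<Sum>b\<in>UNIV. chart_metric.gi (g1 \<kappa>) a b y * pd a \<Upsilon> y * pd b \<Upsilon> y) * V g1 tY y)"
      unfolding V_def using law(3) h(3) by blast
  qed
  then have eq: "tnab1 (tnab (V g)) a b D x - tnab1 (tnab (V g)) b a D x = (\<Sum>F\<in>UNIV. \<Omega> a b D F x * V g F x)"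
    using \<Omega> x unfolding tractor_curvature_def Let_def by blast
  \<comment> \<open>In the splitting of \<open>g\<close> itself the factor is trivial, so the
    section reduces to the constant frame section \<open>E\<close>.\<close>
  have u0: "\<upsilon> g y = 0" if y: "y \<in> U" for y
  proof (rule factor_unique[OF y])
    show "exp (2 * \<upsilon> g y) * g \<kappa> a b y = exp (2 * 0) * g \<kappa> a b y" for a b
      using rel[OF g] y unfolding rel_def by auto
  qed
  have Vg: "V g F y = of_bool (F = E)" if y: "y \<in> U" for F y
  proof -
    have "pd a (\<upsilon> g) y = pd a (\<lambda>y. 0) y" for a by (rule pd_cong[OF y u0])
    then show ?thesis unfolding V_def by (cases F) (simp_all add: u0[OF y] pd_const tr_zero)
  qed
  show ?thesis using eq tractor_curvature_tcurv[of "V g" E x a b D, OF Vg x] by (simp add: Vg[OF x])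
qed

theorem theorem6p1:
  fixes M :: "'m topology"
    and \<A> :: "('m, 6) chart set"
    and c :: "('m, 6) metric set"
    and p q :: nat
    and g :: "('m, 6) metric"
    and \<kappa> :: "('m, 6) chart"
    and \<Omega> :: "6 \<Rightarrow> 6 \<Rightarrow> 6 tidx \<Rightarrow> 6 tidx \<Rightarrow> 'm \<Rightarrow> real"
    and x :: 'm
  assumes "smooth_manifold M \<A>"
    and "conformal_class \<A> p q c"
    and "g \<in> c"
    and "\<kappa> \<in> \<A>"
    and "tractor_curvature c \<kappa> g \<Omega>"
    and "x \<in> chart_dom \<kappa>"
  shows "(\<forall>i D E. chart_metric.frakD \<kappa> (g \<kappa>) \<Omega> i D E x =
            (\<Sum>d\<in>UNIV. (chart_metric.X_low (g \<kappa>) E x * Z_up D d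
                         - X_up D * chart_metric.Z_lowup (g \<kappa>) E d x)
                       * (16 * chart_metric.obstruction6 \<kappa> (g \<kappa>) i d x))) \<and>
         (\<forall>i e. chart_metric.obstruction6 \<kappa> (g \<kappa>) i e x =
            1/32 * (\<Sum>D\<in>UNIV. \<Sum>E\<in>UNIV.
              (Y_up E * chart_metric.Z_low (g \<kappa>) D e x
               - chart_metric.Y_low (g \<kappa>) D x * chart_metric.Z_mix (g \<kappa>) E e x)
              * chart_metric.frakD \<kappa> (g \<kappa>) \<Omega> i D E x))"
proof -
  have pm: "pseudo_metric \<A> p q g"
    using assms(2,3) unfolding conformal_class_def by blast
  interpret smooth_chart_metric \<kappa> "g \<kappa>"
    by (rule smooth_chart_metric_pseudo_metric[OF assms(1) pm assms(4)])
  interpret smooth_chart_metric6 \<kappa> "g \<kappa>"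
    by unfold_locales simp
  note x = assms(6)
  have F: "frakD \<Omega> i D E x = adj x (\<lambda>d. 0) (\<lambda>d e. 0) 0 (\<lambda>d. 16 * obstruction6 i d x) D E" for i D E
    unfolding frakD_tcurv_eq[OF x, symmetric]
    by (rule frakD_cong[OF x]) (rule tractor_curvature_eq[OF assms(1-5)])
  \<comment> \<open>The tractor metric pairs X with Y, so lowering the index exchanges the two
    positions.\<close>
  have X: "X_low E x = of_bool (E = tY)" for E
    by (cases E) (simp_all add: X_low_def X_up_def sum_tidx)
  have Y: "Y_low E x = of_bool (E = tX)" for E
    by (cases E) (simp_all add: Y_low_def Y_up_def sum_tidx)
  have Zm: "Z_mix tY e x = 0" "Z_mix (tZ d) e x = g \<kappa> e d x" "Z_mix tX e x = 0" for e d
    by (simp_all add: Z_mix_def Z_up_def)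
  have Zu: "Z_lowup tY d x = 0" "Z_lowup (tZ a) d x = gi a d x" "Z_lowup tX d x = 0" for a d
    by (simp_all add: Z_lowup_def Z_up_def sum_tidx)
  have Zl: "Z_low tY e x = 0" "Z_low (tZ a) e x = of_bool (a = e)" "Z_low tX e x = 0" for a e
    using gi_g[OF x, of a e] by (simp_all add: Z_low_def Zm sum_tidx g_sym[OF x, of e])
  have "frakD \<Omega> i D E x = (\<Sum>d\<in>UNIV. (X_low E x * Z_up D d - X_up D * Z_lowup E d x) * (16 * obstruction6 i d x))" for i D E
    unfolding F X
    by (cases D; cases E) (simp_all add: Zu Z_up_def X_up_def up_zero up_def sum_negf)
  moreover have "obstruction6 i e x = 1/32 * (\<Sum>D\<in>UNIV. \<Sum>E\<in>UNIV.
      (Y_up E * Z_low D e x - Y_low D x * Z_mix E e x) * frakD \<Omega> i D E x)" for i e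
  proof -
    \<comment> \<open>The \<open>r\<close> slot occurs in two blocks of the matrix, at
      \<open>tZ\<close>, \<open>tY\<close> and negated and raised at \<open>tX\<close>,
      \<open>tZ\<close>. Each contributes 16 times the obstruction tensor, which explains
      32.\<close>
    have "(\<Sum>d\<in>UNIV. g \<kappa> e d x * up x d (\<lambda>d. 16 * obstruction6 i d x)) = 16 * obstruction6 i e x"
      by (rule up_inverse[OF x])
    then show ?thesis
      unfolding F Y by (simp add: sum_tidx Y_up_def Zm Zl up_zero sum_negf)
  qed
  ultimately show ?thesis by blast
qed

end
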